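(* Let $(A,\bar{\mathfrak{m}})$ be a local-Cohen–Macaulay DG-ring with constant amplitude such that the ring $\mathrm{H}^0(A)$ is catenary. Then $A$ is a Cohen–Macaulay DG-ring.
   Context: All DG-rings are unital, non-positively graded, $A=\bigoplus_{n\le 0}A^n$ with differential of degree $+1$ satisfying the graded Leibniz rule, and commutative: $ba=(-1)^{\deg(a)\deg(b)}ab$ for homogeneous $a,b$, and $a^2=0$ for $a$ of odd degree. There is a natural surjection $\pi_A^0:A^0\to \mathrm{H}^0(A)$. For a DG-module $M$, $\inf(M)=\inf\{n\mid \mathrm{H}^n(M)\neq 0\}$. $\mathsf{D}(A)$ is the derived category of DG-modules over $A$, and $\mathsf{D}^+(A)$ is its full subcategory of DG-modules with bounded below cohomology. $A$ is noetherian if $\mathrm{H}^0(A)$ is a noetherian ring and each $\mathrm{H}^i(A)$, $i<0$, is a finitely generated $\mathrm{H}^0(A)$-module. $A$ has bounded cohomology if $\mathrm{H}^i(A)=0$ for $i\ll 0$. A noetherian local DG-ring $(A,\bar{\mathfrak{m}})$ is a noetherian DG-ring such that $\mathrm{H}^0(A)$ is a local ring with maximal ideal $\bar{\mathfrak{m}}$. Localization: for $\bar{\mathfrak{p}}\in\operatorname{Spec}(\mathrm{H}^0(A))$ put $\mathfrak{p}=(\pi_A^0)^{-1}(\bar{\mathfrak{p}})$ and $A_{\bar{\mathfrak{p}}}=A\otimes_{A^0}A^0_{\mathfrak{p}}$; then $\mathrm{H}^0(A_{\bar{\mathfrak{p}}})=\mathrm{H}^0(A)_{\bar{\mathfrak{p}}}$.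 Koszul complex: for $\bar a_1,\dots,\bar a_n\in \mathrm{H}^0(A)$ choose lifts $a_i\in A^0$ and set $K(A;\bar a_1,\dots,\bar a_n)=K(A^0;a_1,\dots,a_n)\otimes_{A^0}A$ (independent of the lifts up to isomorphism in the homotopy category of DG-rings); for $M\in\mathsf{D}(A)$, $K(M;\bar a_1,\dots,\bar a_n)=K(A;\bar a_1,\dots,\bar a_n)\otimes_A M$. Regular sequences: for a noetherian local DG-ring $(A,\bar{\mathfrak{m}})$ and $M\in\mathsf{D}^+(A)$, an element $\bar x\in\bar{\mathfrak{m}}$ is $M$-regular if multiplication by $\bar x$ on $\mathrm{H}^{\inf(M)}(M)$ is injective. A sequence $\bar a_1,\dots,\bar a_n\in\bar{\mathfrak{m}}$ is $M$-regular if $\bar a_1$ is $M$-regular and $\bar a_2,\dots,\bar a_n$ is $K(M;\bar a_1)$-regular. Cohen–Macaulay: a local-Cohen–Macaulay DG-ring is a noetherian local DG-ring $(A,\bar{\mathfrak{m}})$ with bounded cohomology such that the maximal length of an $A$-regular sequence in $\bar{\mathfrak{m}}$ (which is always at most $\dim \mathrm{H}^0(A)$) equals $\dim \mathrm{H}^0(A)$. A noetherian DG-ring $A$ with bounded cohomology is Cohen–Macaulay if $A_{\bar{\mathfrak{p}}}$ is local-Cohen–Macaulay for every $\bar{\mathfrak{p}}\in\operatorname{Spec}(\mathrm{H}^0(A))$. A noetherian DG-ring $A$ with bounded cohomology has constant amplitude if $\operatorname{Supp}(\mathrm{H}^{\inf(A)}(A))=\operatorname{Spec}(\mathrm{H}^0(A))$.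 *)

theory Defs
  imports "HOL-Algebra.Ring_Divisibility" "HOL-Algebra.Module" "HOL-Library.Extended_Nat"
begin

section \<open>Commutative rings: spectrum, dimension, catenarity, localization, support\<close>

definition spec :: "('a, 'b) ring_scheme \<Rightarrow> 'a set set" where
  "spec R = {p. primeideal p R}"

definition local_ring :: "('a, 'b) ring_scheme \<Rightarrow> 'a set \<Rightarrow> bool" where
  "local_ring R m \<longleftrightarrow> cring R \<and> maximalideal m R \<and> (\<forall>J. maximalideal J R \<longrightarrow> J = m)"

definition prime_chain :: "('a, 'b) ring_scheme \<Rightarrow> 'a set list \<Rightarrow> bool" where
  "prime_chain R ps \<longleftrightarrow> ps \<noteq> [] \<and> set ps \<subseteq> spec R \<and> sorted_wrt (\<subset>) ps"

text \<open>The supremum of the lengths \<open>n\<close> of chains \<open>p\<^sub>0 \<subset> \<dots> \<subset> p\<^sub>n\<close>. The zero ring has no primes and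
  gets dimension \<open>0\<close> here; the dimension is only used for local rings.\<close>

definition krull_dim :: "('a, 'b) ring_scheme \<Rightarrow> enat" where
  "krull_dim R = Sup {enat (length ps - 1) | ps. prime_chain R ps}"

definition saturated_prime_chain :: "('a, 'b) ring_scheme \<Rightarrow> 'a set list \<Rightarrow> bool" where
  "saturated_prime_chain R ps \<longleftrightarrow> prime_chain R ps \<and>
     (\<forall>i. Suc i < length ps \<longrightarrow> \<not> (\<exists>q \<in> spec R. ps ! i \<subset> q \<and> q \<subset> ps ! Suc i))"

definition catenary :: "('a, 'b) ring_scheme \<Rightarrow> bool" where
  "catenary R \<longleftrightarrow> (\<forall>p \<in> spec R. \<forall>q \<in> spec R. p \<subseteq> q \<longrightarrow> (\<exists>n.
     (\<forall>ps. prime_chain R ps \<and> hd ps = p \<and> last ps = q \<longrightarrow> length ps \<le> n) \<and>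
     (\<forall>ps. saturated_prime_chain R ps \<and> hd ps = p \<and> last ps = q \<longrightarrow> length ps = n)))"

definition fin_gen_module :: "('r, 'b) ring_scheme \<Rightarrow> ('r, 'm, 'c) module_scheme \<Rightarrow> bool" where
  "fin_gen_module R M \<longleftrightarrow> (\<exists>F. finite F \<and> F \<subseteq> carrier M \<and>
     (\<forall>N. submodule N R M \<and> F \<subseteq> N \<longrightarrow> N = carrier M))"

text \<open>The fraction \<open>m / s\<close>, as an equivalence class of pairs.\<close>

definition loc_frac :: "('r, 'm, 'c) module_scheme \<Rightarrow> 'r set \<Rightarrow> 'm \<Rightarrow> 'r \<Rightarrow> ('m \<times> 'r) set" where
  "loc_frac M S m s = {(m', s'). m' \<in> carrier M \<and> s' \<in> S \<and>
     (\<exists>u \<in> S. u \<odot>\<^bsub>M\<^esub> (s' \<odot>\<^bsub>M\<^esub> m) = u \<odot>\<^bsub>M\<^esub> (s \<odot>\<^bsub>M\<^esub> m'))}"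

text \<open>Operations on equivalence classes are unions over representatives of the resulting class,
  as in \<^const>\<open>rcoset_mult\<close>. The result is regarded as a module over \<open>R\<close>.\<close>

definition loc_module ::
  "('r, 'b) ring_scheme \<Rightarrow> ('r, 'm, 'c) module_scheme \<Rightarrow> 'r set \<Rightarrow> ('r, ('m \<times> 'r) set) module" where
  "loc_module R M S = \<lparr>
     carrier = {loc_frac M S m s | m s. m \<in> carrier M \<and> s \<in> S},
     monoid.mult = undefined,
     one = undefined,
     zero = loc_frac M S \<zero>\<^bsub>M\<^esub> \<one>\<^bsub>R\<^esub>,
     add = (\<lambda>X Y. \<Union>(m, s) \<in> X. \<Union>(n, t) \<in> Y.
              loc_frac M S (t \<odot>\<^bsub>M\<^esub> m \<oplus>\<^bsub>M\<^esub> s \<odot>\<^bsub>M\<^esub> n) (s \<otimes>\<^bsub>R\<^esub> t)),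
     smult = (\<lambda>r X. \<Union>(m, s) \<in> X. loc_frac M S (r \<odot>\<^bsub>M\<^esub> m) s)\<rparr>"

definition supp :: "('r, 'b) ring_scheme \<Rightarrow> ('r, 'm, 'c) module_scheme \<Rightarrow> 'r set set" where
  "supp R M = {p \<in> spec R. carrier (loc_module R M (carrier R - p)) \<noteq>
     {\<zero>\<^bsub>loc_module R M (carrier R - p)\<^esub>}}"


section \<open>DG-rings and DG-modules\<close>

definition sgn_pow :: "('a, 'b) ring_scheme \<Rightarrow> int \<Rightarrow> 'a \<Rightarrow> 'a" where
  "sgn_pow G n x = (if even n then x else \<ominus>\<^bsub>G\<^esub> x)"

definition decomposes :: "('a, 'b) ring_scheme \<Rightarrow> (int \<Rightarrow> 'a set) \<Rightarrow> 'a \<Rightarrow> (int \<Rightarrow> 'a) \<Rightarrow> bool" where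
  "decomposes G gr x f \<longleftrightarrow> (\<forall>n. f n \<in> gr n) \<and> finite {n. f n \<noteq> \<zero>\<^bsub>G\<^esub>} \<and>
     x = (\<Oplus>\<^bsub>G\<^esub>n\<in>{n. f n \<noteq> \<zero>\<^bsub>G\<^esub>}. f n)"

locale graded_complex = abelian_group G for G (structure) +
  fixes gr :: "int \<Rightarrow> 'a set" and d :: "'a \<Rightarrow> 'a"
  assumes gr_subgroup: "additive_subgroup (gr n) G"
    and gr_direct_sum: "x \<in> carrier G \<Longrightarrow> \<exists>!f. decomposes G gr x f"
    and d_add: "\<lbrakk>x \<in> carrier G; y \<in> carrier G\<rbrakk> \<Longrightarrow> d (x \<oplus> y) = d x \<oplus> d y"
    and d_degree: "x \<in> gr n \<Longrightarrow> d x \<in> gr (n + 1)"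
    and d_d: "x \<in> carrier G \<Longrightarrow> d (d x) = \<zero>"

record 'a dg_ring = "'a ring" +
  deg_part :: "int \<Rightarrow> 'a set"
  differential :: "'a \<Rightarrow> 'a"

locale dg_ring = ring A + graded_complex A "deg_part A" "differential A"
  for A :: "'a dg_ring" (structure) +
  assumes deg_one: "\<one> \<in> deg_part A 0"
    and deg_mult: "\<lbrakk>a \<in> deg_part A i; b \<in> deg_part A j\<rbrakk> \<Longrightarrow> a \<otimes> b \<in> deg_part A (i + j)"
    and non_positive: "n > 0 \<Longrightarrow> deg_part A n = {\<zero>}"
    and leibniz: "\<lbrakk>a \<in> deg_part A i; b \<in> carrier A\<rbrakk> \<Longrightarrow>
      differential A (a \<otimes> b) = differential A a \<otimes> b \<oplus> sgn_pow A i (a \<otimes> differential A b)"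
    and graded_comm: "\<lbrakk>a \<in> deg_part A i; b \<in> deg_part A j\<rbrakk> \<Longrightarrow> b \<otimes> a = sgn_pow A (i * j) (a \<otimes> b)"
    and odd_square: "\<lbrakk>a \<in> deg_part A i; odd i\<rbrakk> \<Longrightarrow> a \<otimes> a = \<zero>"

record ('a, 'm) dg_module = "('a, 'm) module" +
  mdeg_part :: "int \<Rightarrow> 'm set"
  mdifferential :: "'m \<Rightarrow> 'm"

locale dg_module = A?: dg_ring A + M?: graded_complex M "mdeg_part M" "mdifferential M"
  for A :: "'a dg_ring" (structure) and M :: "('a, 'm) dg_module" (structure) +
  assumes smult_closed: "\<lbrakk>a \<in> carrier A; x \<in> carrier M\<rbrakk> \<Longrightarrow> a \<odot>\<^bsub>M\<^esub> x \<in> carrier M"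
    and smult_l_distr: "\<lbrakk>a \<in> carrier A; b \<in> carrier A; x \<in> carrier M\<rbrakk> \<Longrightarrow>
      (a \<oplus> b) \<odot>\<^bsub>M\<^esub> x = a \<odot>\<^bsub>M\<^esub> x \<oplus>\<^bsub>M\<^esub> b \<odot>\<^bsub>M\<^esub> x"
    and smult_r_distr: "\<lbrakk>a \<in> carrier A; x \<in> carrier M; y \<in> carrier M\<rbrakk> \<Longrightarrow>
      a \<odot>\<^bsub>M\<^esub> (x \<oplus>\<^bsub>M\<^esub> y) = a \<odot>\<^bsub>M\<^esub> x \<oplus>\<^bsub>M\<^esub> a \<odot>\<^bsub>M\<^esub> y"
    and smult_assoc: "\<lbrakk>a \<in> carrier A; b \<in> carrier A; x \<in> carrier M\<rbrakk> \<Longrightarrow>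
      (a \<otimes> b) \<odot>\<^bsub>M\<^esub> x = a \<odot>\<^bsub>M\<^esub> (b \<odot>\<^bsub>M\<^esub> x)"
    and smult_one: "x \<in> carrier M \<Longrightarrow> \<one> \<odot>\<^bsub>M\<^esub> x = x"
    and deg_smult: "\<lbrakk>a \<in> deg_part A i; x \<in> mdeg_part M j\<rbrakk> \<Longrightarrow> a \<odot>\<^bsub>M\<^esub> x \<in> mdeg_part M (i + j)"
    and mleibniz: "\<lbrakk>a \<in> deg_part A i; x \<in> carrier M\<rbrakk> \<Longrightarrow>
      mdifferential M (a \<odot>\<^bsub>M\<^esub> x) =
        differential A a \<odot>\<^bsub>M\<^esub> x \<oplus>\<^bsub>M\<^esub> sgn_pow M i (a \<odot>\<^bsub>M\<^esub> mdifferential M x)"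

definition self_module :: "'a dg_ring \<Rightarrow> ('a, 'a) dg_module" where
  "self_module A = \<lparr>carrier = carrier A, monoid.mult = monoid.mult A, one = one A,
     zero = zero A, add = add A, smult = monoid.mult A,
     mdeg_part = deg_part A, mdifferential = differential A\<rparr>"


section \<open>Cohomology\<close>

definition cocycles :: "('a, 'm) dg_module \<Rightarrow> int \<Rightarrow> 'm set" where
  "cocycles M n = {x \<in> mdeg_part M n. mdifferential M x = \<zero>\<^bsub>M\<^esub>}"

definition coboundaries :: "('a, 'm) dg_module \<Rightarrow> int \<Rightarrow> 'm set" where
  "coboundaries M n = mdifferential M ` mdeg_part M (n - 1)"

text \<open>The group of cocycles modulo coboundaries. Scalars are elements of \<open>H\<^sup>0(A)\<close>, i.e.\ cosets
  in \<open>A\<^sup>0\<close>, and act through representatives.\<close>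

definition cohomology :: "('a, 'm) dg_module \<Rightarrow> int \<Rightarrow> ('a set, 'm set) module" where
  "cohomology M n = \<lparr>
     carrier = a_rcosets\<^bsub>M\<lparr>carrier := cocycles M n\<rparr>\<^esub> (coboundaries M n),
     monoid.mult = undefined,
     one = undefined,
     zero = coboundaries M n,
     add = set_add M,
     smult = (\<lambda>c X. \<Union>a\<in>c. \<Union>x\<in>X. coboundaries M n +>\<^bsub>M\<^esub> (a \<odot>\<^bsub>M\<^esub> x))\<rparr>"

definition nonzero_degrees :: "('a, 'm) dg_module \<Rightarrow> int set" where
  "nonzero_degrees M = {n. carrier (cohomology M n) \<noteq> {\<zero>\<^bsub>cohomology M n\<^esub>}}"

text \<open>For \<open>M\<close> with bounded below, nonzero cohomology this is the least degree with nonzero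
  cohomology. It is an unspecified integer if \<open>M\<close> is acyclic, in which case the cohomology in
  that degree is zero anyway.\<close>

definition dg_inf :: "('a, 'm) dg_module \<Rightarrow> int" where
  "dg_inf M = Inf (nonzero_degrees M)"

text \<open>\<open>A\<close> is non-positively graded, so all of \<open>A\<^sup>0\<close> consists of cocycles.\<close>

definition deg0_ring :: "'a dg_ring \<Rightarrow> 'a dg_ring" where
  "deg0_ring A = A\<lparr>carrier := deg_part A 0\<rparr>"

definition H0 :: "'a dg_ring \<Rightarrow> 'a set ring" where
  "H0 A = deg0_ring A Quot coboundaries (self_module A) 0"

definition H0_proj :: "'a dg_ring \<Rightarrow> 'a \<Rightarrow> 'a set" where
  "H0_proj A a = coboundaries (self_module A) 0 +>\<^bsub>deg0_ring A\<^esub> a"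

definition noetherian_dg_ring :: "'a dg_ring \<Rightarrow> bool" where
  "noetherian_dg_ring A \<longleftrightarrow> dg_ring A \<and> noetherian_ring (H0 A) \<and>
     (\<forall>i<0. fin_gen_module (H0 A) (cohomology (self_module A) i))"

definition bounded_cohomology :: "'a dg_ring \<Rightarrow> bool" where
  "bounded_cohomology A \<longleftrightarrow> (\<exists>N. \<forall>i<N. i \<notin> nonzero_degrees (self_module A))"

definition noetherian_local_dg_ring :: "'a dg_ring \<Rightarrow> 'a set set \<Rightarrow> bool" where
  "noetherian_local_dg_ring A m \<longleftrightarrow> noetherian_dg_ring A \<and> local_ring (H0 A) m"

definition constant_amplitude :: "'a dg_ring \<Rightarrow> bool" where
  "constant_amplitude A \<longleftrightarrow> noetherian_dg_ring A \<and> bounded_cohomology A \<and>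
     supp (H0 A) (cohomology (self_module A) (dg_inf (self_module A))) = spec (H0 A)"


section \<open>Localization\<close>

text \<open>\<open>A \<otimes>\<^bsub>A\<^sup>0\<^esub> A\<^sup>0\<^sub>p\<close>, realized as the fractions \<open>a / s\<close> with \<open>a \<in> A\<close> and \<open>s \<in> A\<^sup>0 - p\<close>, where \<open>p\<close> is
  the preimage of the prime \<open>P\<close> of \<open>H\<^sup>0(A)\<close>. Elements of \<open>A\<^sup>0\<close> are central cocycles, so
  \<open>(a/s)(b/t) = ab/st\<close> and \<open>d(a/s) = d(a)/s\<close>.\<close>

definition lift_compl :: "'a dg_ring \<Rightarrow> 'a set set \<Rightarrow> 'a set" where
  "lift_compl A P = {s \<in> deg_part A 0. H0_proj A s \<notin> P}"

definition dg_localization :: "'a dg_ring \<Rightarrow> 'a set set \<Rightarrow> ('a \<times> 'a) set dg_ring" where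
  "dg_localization A P = (let
       S = lift_compl A P;
       M = self_module A;
       L = loc_module (deg0_ring A) M S
     in \<lparr>carrier = carrier L,
         monoid.mult = (\<lambda>X Y. \<Union>(a, s) \<in> X. \<Union>(b, t) \<in> Y. loc_frac M S (a \<otimes>\<^bsub>A\<^esub> b) (s \<otimes>\<^bsub>A\<^esub> t)),
         one = loc_frac M S \<one>\<^bsub>A\<^esub> \<one>\<^bsub>A\<^esub>,
         zero = zero L,
         add = add L,
         deg_part = (\<lambda>n. {loc_frac M S a s | a s. a \<in> deg_part A n \<and> s \<in> S}),
         differential = (\<lambda>X. \<Union>(a, s) \<in> X. loc_frac M S (differential A a) s)\<rparr>)"


section \<open>Koszul complexes and regular sequences\<close>

text \<open>The automorphism of the graded ring \<open>A\<close> that is \<open>(-1)\<^sup>n\<close> in degree \<open>n\<close>.\<close>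

definition grading_involution :: "'a dg_ring \<Rightarrow> 'a \<Rightarrow> 'a" where
  "grading_involution A a = (let f = (THE f. decomposes A (deg_part A) a f) in
     \<Oplus>\<^bsub>A\<^esub>n\<in>{n. f n \<noteq> \<zero>\<^bsub>A\<^esub>}. sgn_pow A n (f n))"

text \<open>For \<open>a \<in> A\<^sup>0\<close> the DG-ring \<open>K(A; a)\<close> is free over \<open>A\<close> on \<open>1\<close> and \<open>e\<close> with \<open>deg e = -1\<close> and \<open>d(e) = a\<close>.
  Hence \<open>K(M; a) = (e \<otimes> M) \<oplus> (1 \<otimes> M)\<close>, with the pair \<open>(x, y)\<close> standing for \<open>e \<otimes> x + 1 \<otimes> y\<close>.
  Then \<open>d(e \<otimes> x) = 1 \<otimes> ax - e \<otimes> dx\<close>, and \<open>b \<cdot> (e \<otimes> x) = (-1)\<^sup>i e \<otimes> bx\<close> for \<open>b\<close> of degree \<open>i\<close>.\<close>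

definition koszul :: "'a dg_ring \<Rightarrow> ('a, 'm) dg_module \<Rightarrow> 'a \<Rightarrow> ('a, 'm \<times> 'm) dg_module" where
  "koszul A M a = \<lparr>
     carrier = carrier M \<times> carrier M,
     monoid.mult = undefined,
     one = undefined,
     zero = (\<zero>\<^bsub>M\<^esub>, \<zero>\<^bsub>M\<^esub>),
     add = (\<lambda>(x, y) (x', y'). (x \<oplus>\<^bsub>M\<^esub> x', y \<oplus>\<^bsub>M\<^esub> y')),
     smult = (\<lambda>b (x, y). (grading_involution A b \<odot>\<^bsub>M\<^esub> x, b \<odot>\<^bsub>M\<^esub> y)),
     mdeg_part = (\<lambda>n. mdeg_part M (n + 1) \<times> mdeg_part M n),
     mdifferential = (\<lambda>(x, y).
       (\<ominus>\<^bsub>M\<^esub> mdifferential M x, a \<odot>\<^bsub>M\<^esub> x \<oplus>\<^bsub>M\<^esub> mdifferential M y))\<rparr>"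

definition H0_lift :: "'a dg_ring \<Rightarrow> 'a set \<Rightarrow> 'a" where
  "H0_lift A x = (SOME a. a \<in> deg_part A 0 \<and> H0_proj A a = x)"

definition regular_elem :: "'a dg_ring \<Rightarrow> 'a set set \<Rightarrow> ('a, 'm) dg_module \<Rightarrow> 'a set \<Rightarrow> bool" where
  "regular_elem A m M x \<longleftrightarrow> x \<in> m \<and>
     inj_on (\<lambda>u. x \<odot>\<^bsub>cohomology M (dg_inf M)\<^esub> u) (carrier (cohomology M (dg_inf M)))"

text \<open>The recursive definition of regular sequences passes from \<open>M\<close> to \<open>K(M; a)\<close>, whose underlying
  type is \<^typ>\<open>'m \<times> 'm\<close>. To stay within one type, \<open>M\<close> is replaced by an isomorphic copy in a type
  into which its own square embeds.\<close>

datatype 'm nest = Leaf 'm | Node "'m nest \<times> 'm nest"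

definition transport :: "('m \<Rightarrow> 'n) \<Rightarrow> ('a, 'm) dg_module \<Rightarrow> ('a, 'n) dg_module" where
  "transport f M = \<lparr>
     carrier = f ` carrier M,
     monoid.mult = undefined,
     one = undefined,
     zero = f \<zero>\<^bsub>M\<^esub>,
     add = (\<lambda>x y. f (the_inv f x \<oplus>\<^bsub>M\<^esub> the_inv f y)),
     smult = (\<lambda>a x. f (a \<odot>\<^bsub>M\<^esub> the_inv f x)),
     mdeg_part = (\<lambda>n. f ` mdeg_part M n),
     mdifferential = (\<lambda>x. f (mdifferential M (the_inv f x)))\<rparr>"

primrec regular_seq_nest ::
  "'a dg_ring \<Rightarrow> 'a set set \<Rightarrow> ('a, 'm nest) dg_module \<Rightarrow> 'a set list \<Rightarrow> bool" where
  "regular_seq_nest A m M [] \<longleftrightarrow> True"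
| "regular_seq_nest A m M (x # xs) \<longleftrightarrow> regular_elem A m M x \<and>
     regular_seq_nest A m (transport Node (koszul A M (H0_lift A x))) xs"

definition regular_seq :: "'a dg_ring \<Rightarrow> 'a set set \<Rightarrow> ('a, 'm) dg_module \<Rightarrow> 'a set list \<Rightarrow> bool" where
  "regular_seq A m M xs \<longleftrightarrow> regular_seq_nest A m (transport Leaf M) xs"


section \<open>Cohen-Macaulay DG-rings\<close>

definition max_regular_length :: "'a dg_ring \<Rightarrow> 'a set set \<Rightarrow> enat" where
  "max_regular_length A m = Sup {enat (length xs) | xs. regular_seq A m (self_module A) xs}"

definition local_cohen_macaulay :: "'a dg_ring \<Rightarrow> 'a set set \<Rightarrow> bool" where
  "local_cohen_macaulay A m \<longleftrightarrow> noetherian_local_dg_ring A m \<and> bounded_cohomology A \<and>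
     max_regular_length A m = krull_dim (H0 A)"

definition cohen_macaulay :: "'a dg_ring \<Rightarrow> bool" where
  "cohen_macaulay A \<longleftrightarrow> noetherian_dg_ring A \<and> bounded_cohomology A \<and>
     (\<forall>P \<in> spec (H0 A). \<exists>m. local_cohen_macaulay (dg_localization A P) m)"

end

theory Submission
  imports Defs "HOL-Algebra.Subrings"
begin

text \<open>Put \<open>R = H\<^sup>0(A)\<close>, \<open>d = dim R\<close> and \<open>i = inf A\<close>. If \<open>x\<close> is regular on \<open>M\<close>, then \<open>H\<^sup>i(M)/x\<close> embeds into
  \<open>H\<^sup>i(K(M; x))\<close>, so every associated prime of \<open>H\<^sup>i(M)\<close> is strictly contained in one of \<open>H\<^sup>i(K(M; x))\<close>.
  Hence an \<open>M\<close>-regular sequence of length \<open>r\<close> yields a chain of \<open>r + 1\<close> primes starting at any given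
  associated prime of \<open>H\<^sup>i(M)\<close>; in particular \<open>r \<le> d\<close>. Moreover all maximal regular sequences in the
  maximal ideal have the same length, here \<open>d\<close>.

  Let a chain of \<open>h + 1\<close> primes end at \<open>p\<close>, and let \<open>x\<^sub>1, \<dots>, x\<^sub>r\<close> be a maximal regular sequence inside \<open>p\<close>.
  Then \<open>p\<close> lies in an associated prime \<open>q\<close> of \<open>H\<^sup>i(K(A; x\<^sub>1, \<dots>, x\<^sub>r))\<close>, and the sequence extends to length \<open>d\<close>, so there
  is a chain of \<open>d - r + 1\<close> primes starting at \<open>q\<close>. Concatenation gives \<open>h + (d - r) \<le> d\<close>, that is,
  \<open>r \<ge> h\<close>. Constant amplitude keeps \<open>inf A\<^sub>p = i\<close>, so regular sequences inside \<open>p\<close> stay regular over \<open>A\<^sub>p\<close>.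
  Catenarity only serves to bound the lengths of regular sequences, which makes \<open>d\<close> finite.\<close>

section \<open>Noetherian modules and associated primes\<close>

text \<open>That maximal regular sequences have equal length comes from reading one Koszul complex
  in two orders. If \<open>xs\<close> has no regular extension, all of \<open>m\<close> kills some
  nonzero class in degree i of K(A; xs), and every further factor, taken from a regular sequence
  \<open>zs\<close>, moves such a class down by one degree. In the other order K(A; zs) starts in
  degree i, and each factor from \<open>xs\<close> lowers the start by at most one. Hence
  \<open>zs\<close> is not longer than \<open>xs\<close>.

  The obstacle is that Koszul complexes depend on lifts to A^0 of elements of H^0(A), and the lifts
  chosen over A and over A_p are unrelated. Two lifts differ by a boundary d(b), and multiplication
  by d(b) is null-homotopic through b. Such homotopies survive in every iterated Koszul complex and
  repair the comparison maps. One kind of map, a localization of complexes at a multiplicative set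
  S, serves for passing to A_p, for exchanging two factors and for relabelling carriers; the last
  two are the case S = {1}.\<close>

lemma (in abelian_group) add_diff_cancel_left:
  "\<lbrakk>x \<in> carrier G; a \<in> carrier G; b \<in> carrier G\<rbrakk> \<Longrightarrow> (x \<oplus> a) \<ominus> (x \<oplus> b) = a \<ominus> b"
proof -
  assume c: "x \<in> carrier G" "a \<in> carrier G" "b \<in> carrier G"
  then have "(x \<oplus> a) \<oplus> (\<ominus> x \<oplus> \<ominus> b) = (x \<oplus> \<ominus> x) \<oplus> (a \<oplus> \<ominus> b)" by (simp only: a_ac a_closed a_inv_closed)
  then show ?thesis using c by (simp add: a_minus_def minus_add r_neg)
qed

text \<open>Additive inverses come for free as multiples by \<ominus> \<one>, so no closure
  condition for them appears.\<close>

lemma (in cring) ideal_intro: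
  assumes "I \<subseteq> carrier R" "\<zero> \<in> I" "\<And>a b. a \<in> I \<Longrightarrow> b \<in> I \<Longrightarrow> a \<oplus> b \<in> I"
    "\<And>a r. a \<in> I \<Longrightarrow> r \<in> carrier R \<Longrightarrow> r \<otimes> a \<in> I"
  shows "ideal I R"
proof (rule idealI)
  show "ring R" by (rule ring_axioms)
  have neg: "\<ominus> a \<in> I" if "a \<in> I" for a
  proof -
    have "\<ominus> \<one> \<otimes> a \<in> I" using assms(4)[OF that] by simp
    then show ?thesis using assms(1) that by (metis l_minus l_one one_closed subsetD)
  qed
  show "subgroup I (add_monoid R)"
    by (rule add.subgroupI) (use assms neg in \<open>auto simp: a_inv_def\<close>)
  fix a x assume a: "a \<in> I" and x: "x \<in> carrier R"
  show "x \<otimes> a \<in> I" using assms(4)[OF a x] .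
  then show "a \<otimes> x \<in> I" using m_comm[of a x] a x assms(1) by auto
qed

section \<open>Submodules, spans and finite generation\<close>

text \<open>If F leaves the carrier, no submodule contains it and the intersection is the whole
  type; this is why the closure lemmas assume F \<subseteq> carrier M.\<close>

definition mod_span :: "('a, 'b) ring_scheme \<Rightarrow> ('a, 'm, 'c) module_scheme \<Rightarrow> 'm set \<Rightarrow> 'm set" where
  "mod_span R M F = \<Inter>{N. submodule N R M \<and> F \<subseteq> N}"

definition annihilator :: "('a, 'b) ring_scheme \<Rightarrow> ('a, 'm, 'c) module_scheme \<Rightarrow> 'm \<Rightarrow> 'a set" where
  "annihilator R M v = {r \<in> carrier R. r \<odot>\<^bsub>M\<^esub> v = \<zero>\<^bsub>M\<^esub>}"

text \<open>The zero vector never contributes: its annihilator is the whole ring, which is not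
  prime.\<close>

definition ass_primes :: "('a, 'b) ring_scheme \<Rightarrow> ('a, 'm, 'c) module_scheme \<Rightarrow> 'a set set" where
  "ass_primes R M = {p \<in> spec R. \<exists>v \<in> carrier M. p = annihilator R M v}"

context module
begin

lemma submodule_intro:
  assumes "N \<subseteq> carrier M" "\<zero>\<^bsub>M\<^esub> \<in> N" "\<And>a b. a \<in> N \<Longrightarrow> b \<in> N \<Longrightarrow> a \<oplus>\<^bsub>M\<^esub> b \<in> N"
    "\<And>r a. r \<in> carrier R \<Longrightarrow> a \<in> N \<Longrightarrow> r \<odot>\<^bsub>M\<^esub> a \<in> N"
  shows "submodule N R M"
proof (rule submoduleI)
  fix a assume a: "a \<in> N"
  have "\<ominus>\<^bsub>R\<^esub> \<one>\<^bsub>R\<^esub> \<odot>\<^bsub>M\<^esub> a \<in> N" using assms(4) a by simp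
  then show "\<ominus>\<^bsub>M\<^esub> a \<in> N" using smult_l_minus[of "\<one>\<^bsub>R\<^esub>" a] a assms(1) by auto
qed (use assms in auto)

lemma submodule_zero: "submodule N R M \<Longrightarrow> \<zero>\<^bsub>M\<^esub> \<in> N"
  using subgroup.one_closed[OF submodule.axioms(1), of N R M] by simp

lemma submodule_diff:
  "\<lbrakk>submodule N R M; a \<in> N; b \<in> N\<rbrakk> \<Longrightarrow> a \<ominus>\<^bsub>M\<^esub> b \<in> N"
  unfolding a_minus_def by (meson submoduleE(3,5))

lemma zero_submodule: "submodule {\<zero>\<^bsub>M\<^esub>} R M"
  by (rule submodule_intro) auto

lemma submodule_Int: "submodule N R M \<Longrightarrow> submodule N' R M \<Longrightarrow> submodule (N \<inter> N') R M"
proof -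
  assume N: "submodule N R M" and N': "submodule N' R M"
  show ?thesis
  proof (rule submodule_intro)
    show "N \<inter> N' \<subseteq> carrier M" using submoduleE(1)[OF N] by blast
    show "\<zero>\<^bsub>M\<^esub> \<in> N \<inter> N'" using submodule_zero[OF N] submodule_zero[OF N'] by blast
  qed (use submoduleE(4,5)[OF N] submoduleE(4,5)[OF N'] in blast)+
qed

lemma span_submodule:
  assumes "F \<subseteq> carrier M"
  shows "submodule (mod_span R M F) R M"
proof (rule submodule_intro)
  show "mod_span R M F \<subseteq> carrier M"
    unfolding mod_span_def using carrier_is_submodule assms by blast
qed (auto simp: mod_span_def submodule_zero intro: submoduleE(4,5))

lemma span_incl: "F \<subseteq> mod_span R M F"
  unfolding mod_span_def by blast

lemma span_least: "submodule N R M \<Longrightarrow> F \<subseteq> N \<Longrightarrow> mod_span R M F \<subseteq> N"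
  unfolding mod_span_def by blast

lemma span_mono: "F \<subseteq> G \<Longrightarrow> mod_span R M F \<subseteq> mod_span R M G"
  unfolding mod_span_def by blast

lemma span_empty: "mod_span R M {} = {\<zero>\<^bsub>M\<^esub>}"
  using span_least[OF zero_submodule, of "{}"] submodule_zero[OF span_submodule[of "{}"]] by auto

lemma span_closed: "F \<subseteq> carrier M \<Longrightarrow> mod_span R M F \<subseteq> carrier M"
  by (rule submoduleE(1)[OF span_submodule])

text \<open>Splitting off one generator. This normal form drives the inductions on generating sets,
  both for submodules of finitely generated modules and for Nakayama's lemma.\<close>

lemma span_insert:
  assumes v: "v \<in> carrier M" and F: "F \<subseteq> carrier M"
  shows "mod_span R M (insert v F) = {r \<odot>\<^bsub>M\<^esub> v \<oplus>\<^bsub>M\<^esub> w | r w. r \<in> carrier R \<and> w \<in> mod_span R M F}"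
    (is "?L = ?S")
proof
  note W = span_submodule[OF F]
  have Wc: "w \<in> carrier M" if "w \<in> mod_span R M F" for w using that span_closed[OF F] by auto
  have "submodule ?S R M"
  proof (rule submodule_intro)
    show "?S \<subseteq> carrier M" using Wc v by auto
    show "\<zero>\<^bsub>M\<^esub> \<in> ?S"
      using submodule_zero[OF W] v by (auto intro!: exI[of _ "\<zero>\<^bsub>R\<^esub>"] exI[of _ "\<zero>\<^bsub>M\<^esub>"])
  next
    fix a b assume "a \<in> ?S" "b \<in> ?S"
    then obtain r w s u where e: "a = r \<odot>\<^bsub>M\<^esub> v \<oplus>\<^bsub>M\<^esub> w" "b = s \<odot>\<^bsub>M\<^esub> v \<oplus>\<^bsub>M\<^esub> u"
      "r \<in> carrier R" "s \<in> carrier R" "w \<in> mod_span R M F" "u \<in> mod_span R M F" by blast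
    have "a \<oplus>\<^bsub>M\<^esub> b = (r \<oplus>\<^bsub>R\<^esub> s) \<odot>\<^bsub>M\<^esub> v \<oplus>\<^bsub>M\<^esub> (w \<oplus>\<^bsub>M\<^esub> u)"
      using e Wc v by (simp add: smult_l_distr M.a_ac)
    then show "a \<oplus>\<^bsub>M\<^esub> b \<in> ?S" using e submoduleE(5)[OF W] R.a_closed by blast
  next
    fix r a assume r: "r \<in> carrier R" and "a \<in> ?S"
    then obtain s u where e: "a = s \<odot>\<^bsub>M\<^esub> v \<oplus>\<^bsub>M\<^esub> u" "s \<in> carrier R" "u \<in> mod_span R M F" by blast
    have "r \<odot>\<^bsub>M\<^esub> a = (r \<otimes>\<^bsub>R\<^esub> s) \<odot>\<^bsub>M\<^esub> v \<oplus>\<^bsub>M\<^esub> r \<odot>\<^bsub>M\<^esub> u"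
      using e r Wc v by (simp add: smult_assoc1 smult_r_distr)
    then show "r \<odot>\<^bsub>M\<^esub> a \<in> ?S" using e r submoduleE(4)[OF W] R.m_closed by blast
  qed
  moreover have "insert v F \<subseteq> ?S"
  proof -
    have "v = \<one>\<^bsub>R\<^esub> \<odot>\<^bsub>M\<^esub> v \<oplus>\<^bsub>M\<^esub> \<zero>\<^bsub>M\<^esub>" using v by simp
    moreover have "w = \<zero>\<^bsub>R\<^esub> \<odot>\<^bsub>M\<^esub> v \<oplus>\<^bsub>M\<^esub> w" if "w \<in> F" for w using v F that by auto
    ultimately show ?thesis using span_incl[of F] submodule_zero[OF W] by blast
  qed
  ultimately show "?L \<subseteq> ?S" by (rule span_least)
  note L = span_submodule[of "insert v F"]
  show "?S \<subseteq> ?L"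
  proof
    fix x assume "x \<in> ?S"
    then obtain r w where e: "x = r \<odot>\<^bsub>M\<^esub> v \<oplus>\<^bsub>M\<^esub> w" "r \<in> carrier R" "w \<in> mod_span R M F" by blast
    have "v \<in> ?L" "w \<in> ?L" using span_incl[of "insert v F"] span_mono[of F "insert v F"] e by auto
    then show "x \<in> ?L" using e submoduleE(4,5)[OF L] v F by auto
  qed
qed

text \<open>The ideal of leading coefficients: when W is the span of the other generators, it
  consists of the coefficients of v in those elements of N that have the form r v + w.\<close>

lemma colon_ideal:
  assumes W: "submodule W R M" and N: "submodule N R M" and v: "v \<in> carrier M"
  shows "ideal {r \<in> carrier R. \<exists>w \<in> W. r \<odot>\<^bsub>M\<^esub> v \<oplus>\<^bsub>M\<^esub> w \<in> N} R"
proof (rule R.ideal_intro)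
  note Wc = submoduleE(1)[OF W, THEN subsetD]
  have "\<zero>\<^bsub>R\<^esub> \<odot>\<^bsub>M\<^esub> v \<oplus>\<^bsub>M\<^esub> \<zero>\<^bsub>M\<^esub> \<in> N" using v submodule_zero[OF N] by simp
  then show "\<zero>\<^bsub>R\<^esub> \<in> {r \<in> carrier R. \<exists>w \<in> W. r \<odot>\<^bsub>M\<^esub> v \<oplus>\<^bsub>M\<^esub> w \<in> N}"
    using submodule_zero[OF W] by blast
  fix a assume "a \<in> {r \<in> carrier R. \<exists>w \<in> W. r \<odot>\<^bsub>M\<^esub> v \<oplus>\<^bsub>M\<^esub> w \<in> N}"
  then obtain w where a: "a \<in> carrier R" "w \<in> W" "a \<odot>\<^bsub>M\<^esub> v \<oplus>\<^bsub>M\<^esub> w \<in> N" by blast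
  {
    fix b assume "b \<in> {r \<in> carrier R. \<exists>w \<in> W. r \<odot>\<^bsub>M\<^esub> v \<oplus>\<^bsub>M\<^esub> w \<in> N}"
    then obtain u where b: "b \<in> carrier R" "u \<in> W" "b \<odot>\<^bsub>M\<^esub> v \<oplus>\<^bsub>M\<^esub> u \<in> N" by blast
    have "(a \<oplus>\<^bsub>R\<^esub> b) \<odot>\<^bsub>M\<^esub> v \<oplus>\<^bsub>M\<^esub> (w \<oplus>\<^bsub>M\<^esub> u) = (a \<odot>\<^bsub>M\<^esub> v \<oplus>\<^bsub>M\<^esub> w) \<oplus>\<^bsub>M\<^esub> (b \<odot>\<^bsub>M\<^esub> v \<oplus>\<^bsub>M\<^esub> u)"
      using a b v Wc by (simp add: smult_l_distr M.a_ac)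
    then have "(a \<oplus>\<^bsub>R\<^esub> b) \<odot>\<^bsub>M\<^esub> v \<oplus>\<^bsub>M\<^esub> (w \<oplus>\<^bsub>M\<^esub> u) \<in> N"
      using submoduleE(5)[OF N a(3) b(3)] by simp
    then show "a \<oplus>\<^bsub>R\<^esub> b \<in> {r \<in> carrier R. \<exists>w \<in> W. r \<odot>\<^bsub>M\<^esub> v \<oplus>\<^bsub>M\<^esub> w \<in> N}"
      using submoduleE(5)[OF W a(2) b(2)] a b by blast
  next
    fix r assume r: "r \<in> carrier R"
    have "(r \<otimes>\<^bsub>R\<^esub> a) \<odot>\<^bsub>M\<^esub> v \<oplus>\<^bsub>M\<^esub> (r \<odot>\<^bsub>M\<^esub> w) = r \<odot>\<^bsub>M\<^esub> (a \<odot>\<^bsub>M\<^esub> v \<oplus>\<^bsub>M\<^esub> w)"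
      using a r v Wc by (simp add: smult_r_distr smult_assoc1)
    then have "(r \<otimes>\<^bsub>R\<^esub> a) \<odot>\<^bsub>M\<^esub> v \<oplus>\<^bsub>M\<^esub> (r \<odot>\<^bsub>M\<^esub> w) \<in> N"
      using submoduleE(4)[OF N r a(3)] by simp
    then show "r \<otimes>\<^bsub>R\<^esub> a \<in> {r \<in> carrier R. \<exists>w \<in> W. r \<odot>\<^bsub>M\<^esub> v \<oplus>\<^bsub>M\<^esub> w \<in> N}"
      using submoduleE(4)[OF W r a(2)] a r by blast
  }
qed (rule Collect_restrict)

lemma annihilator_ideal:
  assumes v: "v \<in> carrier M"
  shows "ideal (annihilator R M v) R"
proof (rule R.ideal_intro)
  fix a r assume "a \<in> annihilator R M v" and r: "r \<in> carrier R"
  then have a: "a \<in> carrier R" "a \<odot>\<^bsub>M\<^esub> v = \<zero>\<^bsub>M\<^esub>" by (auto simp: annihilator_def)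
  then have "(r \<otimes>\<^bsub>R\<^esub> a) \<odot>\<^bsub>M\<^esub> v = \<zero>\<^bsub>M\<^esub>" using r v by (simp add: smult_assoc1)
  then show "r \<otimes>\<^bsub>R\<^esub> a \<in> annihilator R M v" using a r by (simp add: annihilator_def)
qed (use v in \<open>auto simp add: annihilator_def smult_l_distr\<close>)

text \<open>Induction on the number of generators, in the manner of Hilbert's basis argument:
  elements of N realizing generators of its leading coefficient ideal, together with generators of N
  \<inter> W for W the span of the remaining generators, generate N.\<close>

theorem submodule_of_span_fin_gen:
  assumes noeth: "noetherian_ring R" and F: "finite F" "F \<subseteq> carrier M"
    and N: "submodule N R M" "N \<subseteq> mod_span R M F"
  shows "\<exists>G. finite G \<and> G \<subseteq> N \<and> N = mod_span R M G"
  using F N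
proof (induction F arbitrary: N rule: finite_induct)
  case empty
  have "N = mod_span R M {}" using empty.prems(3) submodule_zero[OF empty.prems(2)] unfolding span_empty by blast
  then show ?case by (intro exI[of _ "{}"]) simp
next
  case (insert v F)
  note N = insert.prems(2)
  have v: "v \<in> carrier M" and F: "F \<subseteq> carrier M" using insert.prems(1) by auto
  let ?W = "mod_span R M F"
  note W = span_submodule[OF F]
  note Wc = span_closed[OF F, THEN subsetD]
  define I where "I = {r \<in> carrier R. \<exists>w \<in> ?W. r \<odot>\<^bsub>M\<^esub> v \<oplus>\<^bsub>M\<^esub> w \<in> N}"
  have "ideal I R" unfolding I_def by (rule colon_ideal[OF W N v])
  then obtain B where B: "finite B" "B \<subseteq> carrier R" "I = genideal R B"
    using noetherian_ring.finetely_gen[OF noeth] by blast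
  have BI: "B \<subseteq> I" using R.genideal_self[OF B(2)] B(3) by simp
  then have "\<forall>r. \<exists>w. r \<in> B \<longrightarrow> w \<in> ?W \<and> r \<odot>\<^bsub>M\<^esub> v \<oplus>\<^bsub>M\<^esub> w \<in> N" unfolding I_def by blast
  from choice[OF this] obtain w where w: "\<And>r. r \<in> B \<Longrightarrow> w r \<in> ?W \<and> r \<odot>\<^bsub>M\<^esub> v \<oplus>\<^bsub>M\<^esub> w r \<in> N" by blast
  obtain G' where G': "finite G'" "G' \<subseteq> N \<inter> ?W" "N \<inter> ?W = mod_span R M G'"
    using insert.IH[OF F submodule_Int[OF N W] Int_lower2] by (elim exE conjE) (rule that)
  define G where "G = (\<lambda>r. r \<odot>\<^bsub>M\<^esub> v \<oplus>\<^bsub>M\<^esub> w r) ` B \<union> G'"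
  have GN: "G \<subseteq> N" unfolding G_def using w G'(2) by blast
  have Gc: "G \<subseteq> carrier M" using GN submoduleE(1)[OF N] by auto
  note S = span_submodule[OF Gc]
  have SN: "mod_span R M G \<subseteq> N" by (rule span_least[OF N GN])
  \<comment> \<open>The coefficients realized inside the span of G again form an ideal. It contains
    the generators B of I, hence all of I, so the leading coefficient of any n \<in> N can be
    matched within that span.\<close>
  define I' where "I' = {r \<in> carrier R. \<exists>w \<in> ?W. r \<odot>\<^bsub>M\<^esub> v \<oplus>\<^bsub>M\<^esub> w \<in> mod_span R M G}"
  have "ideal I' R" unfolding I'_def by (rule colon_ideal[OF W S v])
  moreover have "B \<subseteq> I'" using w B(2) span_incl[of G] unfolding I'_def G_def by blast
  ultimately have II: "I \<subseteq> I'" using R.genideal_minimal B(3) by simp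
  have "N \<subseteq> mod_span R M G"
  proof
    fix n assume n: "n \<in> N"
    then obtain r u where e: "n = r \<odot>\<^bsub>M\<^esub> v \<oplus>\<^bsub>M\<^esub> u" "r \<in> carrier R" "u \<in> ?W"
      using insert.prems(3) span_insert[OF v F] by blast
    then have "r \<in> I" using n unfolding I_def by blast
    then obtain u' where u': "u' \<in> ?W" "r \<odot>\<^bsub>M\<^esub> v \<oplus>\<^bsub>M\<^esub> u' \<in> mod_span R M G" using II I'_def by blast
    have nc: "n \<in> carrier M" using n submoduleE(1)[OF N] by auto
    \<comment> \<open>Subtracting an element with the same coefficient of v leaves u - u', which
      lies in N and in W and is therefore covered by G'.\<close>
    have d: "n \<ominus>\<^bsub>M\<^esub> (r \<odot>\<^bsub>M\<^esub> v \<oplus>\<^bsub>M\<^esub> u') = u \<ominus>\<^bsub>M\<^esub> u'"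
      unfolding e(1) using e(2) v Wc[OF e(3)] Wc[OF u'(1)] by (simp add: M.add_diff_cancel_left)
    have "r \<odot>\<^bsub>M\<^esub> v \<oplus>\<^bsub>M\<^esub> u' \<in> N" using u'(2) SN by (rule subsetD[rotated])
    from submodule_diff[OF N n this] have "u \<ominus>\<^bsub>M\<^esub> u' \<in> N \<inter> ?W"
      using submodule_diff[OF W e(3) u'(1)] unfolding d by (rule IntI)
    then have "u \<ominus>\<^bsub>M\<^esub> u' \<in> mod_span R M G" using G'(3) span_mono[of G' G] G_def by blast
    then have "(u \<ominus>\<^bsub>M\<^esub> u') \<oplus>\<^bsub>M\<^esub> (r \<odot>\<^bsub>M\<^esub> v \<oplus>\<^bsub>M\<^esub> u') \<in> mod_span R M G"
      using submoduleE(5)[OF S] u'(2) by blast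
    moreover have "(u \<ominus>\<^bsub>M\<^esub> u') \<oplus>\<^bsub>M\<^esub> (r \<odot>\<^bsub>M\<^esub> v \<oplus>\<^bsub>M\<^esub> u') = n"
      unfolding d[symmetric] using nc e(2) v Wc[OF u'(1)]
      by (simp add: a_minus_def M.a_assoc M.l_neg)
    ultimately show "n \<in> mod_span R M G" by simp
  qed
  then have "N = mod_span R M G" using SN by auto
  moreover have "finite G" using G_def B(1) G'(1) by auto
  ultimately show ?case using GN by blast
qed

end

locale noeth_module = module +
  assumes submodule_fin_gen: "submodule N R M \<Longrightarrow> \<exists>G. finite G \<and> G \<subseteq> N \<and> N = mod_span R M G"

lemma (in module) noeth_moduleI:
  assumes "noetherian_ring R" "fin_gen_module R M"
  shows "noeth_module R M"
proof -
  obtain F where F: "finite F" "F \<subseteq> carrier M" "\<And>N. submodule N R M \<Longrightarrow> F \<subseteq> N \<Longrightarrow> N = carrier M"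
    using assms(2) unfolding fin_gen_module_def by blast
  have "mod_span R M F = carrier M" using F(3)[OF span_submodule[OF F(2)] span_incl] .
  then show ?thesis
    using submodule_of_span_fin_gen[OF assms(1) F(1,2)] submoduleE(1) by unfold_locales metis
qed

text \<open>The generators supplied by the locale lie in the span of V but perhaps not in V itself.
  Each of them already lies in the span of a finite part of V, and these finitely many parts are
  collected.\<close>

lemma (in noeth_module) ex_finite_generators:
  assumes V: "V \<subseteq> carrier M"
  shows "\<exists>G. finite G \<and> G \<subseteq> V \<and> V \<subseteq> mod_span R M G"
proof -
  obtain F where F: "finite F" "F \<subseteq> mod_span R M V" "mod_span R M V = mod_span R M F"
    using submodule_fin_gen[OF span_submodule[OF V]] by blast
  \<comment> \<open>The union of the spans of all finite subsets of V; the union is directed, hence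
    a submodule.\<close>
  let ?U = "{x. \<exists>G. finite G \<and> G \<subseteq> V \<and> x \<in> mod_span R M G}"
  have "submodule ?U R M"
  proof (rule submodule_intro)
    show "?U \<subseteq> carrier M" using span_closed V by blast
    show "\<zero>\<^bsub>M\<^esub> \<in> ?U" using span_empty by blast
  next
    fix a b assume "a \<in> ?U" "b \<in> ?U"
    then obtain G G' where G: "finite G" "G \<subseteq> V" "a \<in> mod_span R M G"
      and G': "finite G'" "G' \<subseteq> V" "b \<in> mod_span R M G'" by blast
    have "a \<in> mod_span R M (G \<union> G')" "b \<in> mod_span R M (G \<union> G')"
      using span_mono[of G "G \<union> G'"] span_mono[of G' "G \<union> G'"] G G' by auto
    then have "a \<oplus>\<^bsub>M\<^esub> b \<in> mod_span R M (G \<union> G')"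
      using submoduleE(5)[OF span_submodule] G G' V by (meson Un_least subset_trans)
    then show "a \<oplus>\<^bsub>M\<^esub> b \<in> ?U" using G G' by (intro CollectI exI[of _ "G \<union> G'"]) auto
  next
    fix r a assume "r \<in> carrier R" "a \<in> ?U"
    then show "r \<odot>\<^bsub>M\<^esub> a \<in> ?U" using submoduleE(4)[OF span_submodule] V subset_trans by (smt (verit) mem_Collect_eq)
  qed
  moreover have "V \<subseteq> ?U"
  proof
    fix v assume "v \<in> V"
    then have "finite {v} \<and> {v} \<subseteq> V \<and> v \<in> mod_span R M {v}" using span_incl[of "{v}"] by auto
    then show "v \<in> ?U" by blast
  qed
  ultimately have "mod_span R M V \<subseteq> ?U" by (rule span_least)
  with F(2) have "F \<subseteq> ?U" by (rule subset_trans)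
  then have "\<forall>x. \<exists>G. x \<in> F \<longrightarrow> finite G \<and> G \<subseteq> V \<and> x \<in> mod_span R M G" by blast
  from choice[OF this] obtain g where
    g: "\<And>x. x \<in> F \<Longrightarrow> finite (g x) \<and> g x \<subseteq> V \<and> x \<in> mod_span R M (g x)" by blast
  let ?G = "\<Union>(g ` F)"
  have G: "finite ?G" "?G \<subseteq> V" using F(1) g by auto
  have "F \<subseteq> mod_span R M ?G" using g span_mono[of _ ?G] by blast
  then have "mod_span R M V \<subseteq> mod_span R M ?G"
    unfolding F(3) using span_least[OF span_submodule] G(2) V by (meson subset_trans)
  with span_incl have "V \<subseteq> mod_span R M ?G" by (rule subset_trans)
  then show ?thesis using G by blast
qed

section \<open>Maximal members of families of ideals, prime ideals and prime avoidance\<close>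

text \<open>The union of a nonempty chain of ideals in a noetherian ring is itself a member of the
  chain, so Zorn's lemma applies to an arbitrary family.\<close>

lemma (in noetherian_ring) ideal_family_maximal:
  assumes "\<C> \<noteq> {}" "\<And>I. I \<in> \<C> \<Longrightarrow> ideal I R"
  shows "\<exists>I\<in>\<C>. \<forall>J\<in>\<C>. I \<subseteq> J \<longrightarrow> J = I"
proof (rule subset_Zorn_nonempty[OF assms(1)])
  fix C assume "C \<noteq> {}" and C: "subset.chain \<C> C"
  then have "subset.chain {I. ideal I R} C"
    using assms(2) by (simp add: pred_on.chain_def subset_iff)
  then have "\<Union>C \<in> C" using ideal_chain_is_trivial \<open>C \<noteq> {}\<close> by blast
  then show "\<Union>C \<in> \<C>" using C unfolding pred_on.chain_def by blast
qed

lemma spec_ideal: "p \<in> spec R \<Longrightarrow> ideal p R"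
  by (simp add: spec_def primeideal_def)

lemma spec_carrier: "p \<in> spec R \<Longrightarrow> a \<in> p \<Longrightarrow> a \<in> carrier R"
  using spec_ideal ideal.Icarr by fastforce

lemma spec_one: "p \<in> spec R \<Longrightarrow> \<one>\<^bsub>R\<^esub> \<notin> p"
  using ideal.one_imp_carrier[of p R] primeideal.I_notcarr[of p R] spec_ideal[of p R]
  by (auto simp: spec_def)

lemma spec_mult: "p \<in> spec R \<Longrightarrow> a \<in> carrier R \<Longrightarrow> b \<in> carrier R \<Longrightarrow> a \<otimes>\<^bsub>R\<^esub> b \<in> p \<Longrightarrow> a \<in> p \<or> b \<in> p"
  using primeideal.I_prime by (fastforce simp: spec_def)

lemma (in cring) spec_intro:
  assumes "ideal p R" "\<one> \<notin> p"
    and "\<And>a b. a \<in> carrier R \<Longrightarrow> b \<in> carrier R \<Longrightarrow> a \<otimes> b \<in> p \<Longrightarrow> a \<in> p \<or> b \<in> p"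
  shows "p \<in> spec R"
  unfolding spec_def mem_Collect_eq
  by (rule primeidealI[OF assms(1) is_cring]) (use assms in auto)

text \<open>Multiply together one element of each Q outside p: primality keeps the product outside
  p, and each factor puts it into its own Q.\<close>

lemma (in cring) prime_not_contains_Inter:
  assumes p: "p \<in> spec R" and "finite \<Q>" "\<And>Q. Q \<in> \<Q> \<Longrightarrow> ideal Q R \<and> \<not> Q \<subseteq> p"
  shows "\<exists>b\<in>carrier R. b \<notin> p \<and> (\<forall>Q\<in>\<Q>. b \<in> Q)"
  using assms(2,3)
proof (induction \<Q> rule: finite_induct)
  case empty
  then show ?case using spec_one[OF p] by blast
next
  case (insert Q \<Q>)
  obtain b where b: "b \<in> carrier R" "b \<notin> p" "\<forall>Q\<in>\<Q>. b \<in> Q" using insert by blast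
  have Q: "ideal Q R" using insert.prems by blast
  obtain c where c: "c \<in> Q" "c \<notin> p" using insert.prems by blast
  have cc: "c \<in> carrier R" using ideal.Icarr[OF Q c(1)] .
  have "b \<otimes> c \<notin> p" using spec_mult[OF p b(1) cc] b c by blast
  moreover have "b \<otimes> c \<in> Q" using ideal.I_l_closed[OF Q c(1) b(1)] .
  moreover have "b \<otimes> c \<in> Q'" if "Q' \<in> \<Q>" for Q'
    using ideal.I_r_closed[of Q' R b c] insert.prems that b cc by blast
  ultimately show ?case using b cc by blast
qed

text \<open>For an antichain of primes no minimality argument is needed.\<close>

lemma (in cring) prime_avoidance_antichain:
  assumes I: "ideal I R" and "finite \<Q>" "\<And>Q. Q \<in> \<Q> \<Longrightarrow> Q \<in> spec R \<and> \<not> I \<subseteq> Q"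
    and "\<And>Q Q'. Q \<in> \<Q> \<Longrightarrow> Q' \<in> \<Q> \<Longrightarrow> Q \<subseteq> Q' \<Longrightarrow> Q = Q'"
  shows "\<exists>a\<in>I. \<forall>Q\<in>\<Q>. a \<notin> Q"
  using assms(2-)
proof (induction \<Q> rule: finite_induct)
  case empty
  then show ?case using additive_subgroup.zero_closed[OF ideal.axioms(1)[OF I]] by blast
next
  case (insert P \<Q>)
  have "\<exists>a\<in>I. \<forall>Q\<in>\<Q>. a \<notin> Q" by (rule insert.IH) (use insert.prems in blast)+
  then obtain a where a: "a \<in> I" "\<forall>Q\<in>\<Q>. a \<notin> Q" by blast
  have P: "P \<in> spec R" using insert.prems by blast
  show ?case
  proof (cases "a \<in> P")
    case False
    then show ?thesis using a by blast
  next
    case True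
    \<comment> \<open>The correction term b lies in I and in every earlier Q but not in P. Adding it
      to a moves a out of P and changes nothing modulo the other primes. The antichain condition
      guarantees that no earlier Q is contained in P.\<close>
    have "\<exists>b\<in>carrier R. b \<notin> P \<and> (\<forall>Q\<in>insert I \<Q>. b \<in> Q)"
    proof (rule prime_not_contains_Inter[OF P])
      fix Q assume "Q \<in> insert I \<Q>"
      then consider "Q = I" | "Q \<in> \<Q>" by blast
      then show "ideal Q R \<and> \<not> Q \<subseteq> P"
      proof cases
        case 1
        then show ?thesis using I insert.prems(1)[of P] by blast
      next
        case 2
        then have "Q \<noteq> P" using insert.hyps by blast
        then show ?thesis
          using 2 insert.prems(1)[of Q] insert.prems(2)[of Q P] spec_ideal[of Q R] by blast
      qed
    qed (use insert.hyps in blast)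
    then obtain b where b: "b \<in> carrier R" "b \<notin> P" "b \<in> I" "\<And>Q. Q \<in> \<Q> \<Longrightarrow> b \<in> Q" by blast
    have ac: "a \<in> carrier R" using ideal.Icarr[OF I a(1)] .
    have diff: "x \<oplus> y \<in> Q \<Longrightarrow> x \<in> Q \<Longrightarrow> y \<in> carrier R \<Longrightarrow> y \<in> Q" if Q: "ideal Q R" for Q x y
    proof -
      assume h: "x \<oplus> y \<in> Q" "x \<in> Q" "y \<in> carrier R"
      interpret Q: ideal Q R by (rule Q)
      have "\<ominus> x \<oplus> (x \<oplus> y) \<in> Q" using h by blast
      then show "y \<in> Q" using h Q.Icarr[OF h(2)] by (simp add: r_neg1)
    qed
    have "a \<oplus> b \<in> I" using additive_subgroup.a_closed[OF ideal.axioms(1)[OF I] a(1) b(3)] .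
    moreover have "a \<oplus> b \<notin> P" using diff[OF spec_ideal[OF P] _ True b(1)] b(2) by blast
    moreover have "a \<oplus> b \<notin> Q" if "Q \<in> \<Q>" for Q
    proof
      assume h: "a \<oplus> b \<in> Q"
      have "Q \<in> spec R" using insert.prems that by blast
      moreover have "b \<oplus> a \<in> Q" using h a_comm[OF ac b(1)] by simp
      ultimately have "a \<in> Q" using diff[OF spec_ideal _ b(4)[OF that] ac] by blast
      then show False using a that by blast
    qed
    ultimately show ?thesis by blast
  qed
qed

section \<open>Annihilators and associated primes\<close>

context module
begin

lemma annihilator_one: "v \<in> carrier M \<Longrightarrow> \<one>\<^bsub>R\<^esub> \<in> annihilator R M v \<longleftrightarrow> v = \<zero>\<^bsub>M\<^esub>"
  by (simp add: annihilator_def)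

lemma ass_primeD:
  assumes "q \<in> ass_primes R M"
  obtains v where "v \<in> carrier M" "v \<noteq> \<zero>\<^bsub>M\<^esub>" "q = annihilator R M v" "q \<in> spec R"
  using assms annihilator_one spec_one unfolding ass_primes_def by blast

lemma annihilator_smult:
  assumes "r \<in> carrier R" "v \<in> carrier M"
  shows "annihilator R M v \<subseteq> annihilator R M (r \<odot>\<^bsub>M\<^esub> v)"
proof
  fix a assume "a \<in> annihilator R M v"
  then have a: "a \<in> carrier R" "a \<odot>\<^bsub>M\<^esub> v = \<zero>\<^bsub>M\<^esub>" by (simp_all add: annihilator_def)
  have "a \<odot>\<^bsub>M\<^esub> (r \<odot>\<^bsub>M\<^esub> v) = r \<odot>\<^bsub>M\<^esub> (a \<odot>\<^bsub>M\<^esub> v)"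
    using assms a(1) by (simp add: smult_assoc1[symmetric] R.m_comm)
  then show "a \<in> annihilator R M (r \<odot>\<^bsub>M\<^esub> v)" using a assms by (simp add: annihilator_def)
qed

text \<open>If ab kills v while bv \<noteq> 0, the annihilator of bv contains that of v, so the two
  agree by maximality, and a lies in the former.\<close>

lemma maximal_annihilator_prime:
  assumes v: "v \<in> carrier M" "v \<noteq> \<zero>\<^bsub>M\<^esub>"
    and max: "\<And>w. w \<in> carrier M \<Longrightarrow> w \<noteq> \<zero>\<^bsub>M\<^esub> \<Longrightarrow> annihilator R M v \<subseteq> annihilator R M w
      \<Longrightarrow> annihilator R M w = annihilator R M v"
  shows "annihilator R M v \<in> ass_primes R M"
proof -
  have "annihilator R M v \<in> spec R"
  proof (rule R.spec_intro[OF annihilator_ideal[OF v(1)]])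
    fix a b assume ab: "a \<in> carrier R" "b \<in> carrier R" "a \<otimes>\<^bsub>R\<^esub> b \<in> annihilator R M v"
    show "a \<in> annihilator R M v \<or> b \<in> annihilator R M v"
    proof (cases "b \<odot>\<^bsub>M\<^esub> v = \<zero>\<^bsub>M\<^esub>")
      case False
      then have "annihilator R M (b \<odot>\<^bsub>M\<^esub> v) = annihilator R M v"
        using max[of "b \<odot>\<^bsub>M\<^esub> v"] annihilator_smult[of b v] ab v by simp
      moreover have "a \<in> annihilator R M (b \<odot>\<^bsub>M\<^esub> v)"
        using ab v by (simp add: annihilator_def smult_assoc1)
      ultimately show ?thesis by simp
    qed (use ab in \<open>simp add: annihilator_def\<close>)
  qed (use v annihilator_one in simp)
  then show ?thesis using v unfolding ass_primes_def by blast
qed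

text \<open>The maximal member is taken among annihilators containing that of u. Anything above it
  also contains that of u, so it is maximal among the annihilators of all nonzero vectors.\<close>

lemma ex_maximal_annihilator:
  assumes noeth: "noetherian_ring R" and u: "u \<in> carrier M" "u \<noteq> \<zero>\<^bsub>M\<^esub>"
  shows "\<exists>v\<in>carrier M. v \<noteq> \<zero>\<^bsub>M\<^esub> \<and> annihilator R M u \<subseteq> annihilator R M v \<and>
    (\<forall>w\<in>carrier M. w \<noteq> \<zero>\<^bsub>M\<^esub> \<longrightarrow> annihilator R M v \<subseteq> annihilator R M w \<longrightarrow> annihilator R M w = annihilator R M v)"
proof -
  define \<C> where "\<C> = {annihilator R M v | v. v \<in> carrier M \<and> v \<noteq> \<zero>\<^bsub>M\<^esub> \<and> annihilator R M u \<subseteq> annihilator R M v}"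
  have "annihilator R M u \<in> \<C>" unfolding \<C>_def using u by blast
  then have ne: "\<C> \<noteq> {}" by blast
  have id: "\<And>I. I \<in> \<C> \<Longrightarrow> ideal I R" unfolding \<C>_def using annihilator_ideal by blast
  obtain q where q: "q \<in> \<C>" "\<forall>J\<in>\<C>. q \<subseteq> J \<longrightarrow> J = q"
    using noetherian_ring.ideal_family_maximal[OF noeth ne id] by blast
  then obtain v where v: "v \<in> carrier M" "v \<noteq> \<zero>\<^bsub>M\<^esub>" "annihilator R M u \<subseteq> annihilator R M v" "q = annihilator R M v"
    unfolding \<C>_def by blast
  have "annihilator R M w = annihilator R M v"
    if w: "w \<in> carrier M" "w \<noteq> \<zero>\<^bsub>M\<^esub>" "annihilator R M v \<subseteq> annihilator R M w" for w
  proof -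
    have "annihilator R M w \<in> \<C>" unfolding \<C>_def using w v(3) by blast
    then show ?thesis using q(2) w(3) unfolding v(4) by blast
  qed
  then show ?thesis using v(1-3) by blast
qed

lemma ex_ass_prime_above:
  assumes "noetherian_ring R" "u \<in> carrier M" "u \<noteq> \<zero>\<^bsub>M\<^esub>"
  shows "\<exists>q\<in>ass_primes R M. annihilator R M u \<subseteq> q"
proof -
  obtain v where v: "v \<in> carrier M" "v \<noteq> \<zero>\<^bsub>M\<^esub>" "annihilator R M u \<subseteq> annihilator R M v"
    "\<And>w. w\<in>carrier M \<Longrightarrow> w \<noteq> \<zero>\<^bsub>M\<^esub> \<Longrightarrow> annihilator R M v \<subseteq> annihilator R M w \<Longrightarrow> annihilator R M w = annihilator R M v"
    using ex_maximal_annihilator[OF assms] by blast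
  show ?thesis using maximal_annihilator_prime[OF v(1,2,4)] v(3) by blast
qed

end

text \<open>Only the maximal annihilators are considered: they are primes forming an antichain, and
  there are finitely many of them, because a finite set G of vectors generating all vectors with
  maximal annihilator already realizes each one. If I were contained in none, prime avoidance would
  produce an element of I outside all of them, which could kill no nonzero vector.\<close>

theorem (in noeth_module) zero_divisor_ideal_le_ass_prime:
  assumes noeth: "noetherian_ring R" and I: "ideal I R"
    and zd: "\<And>a. a \<in> I \<Longrightarrow> \<exists>v\<in>carrier M. v \<noteq> \<zero>\<^bsub>M\<^esub> \<and> a \<odot>\<^bsub>M\<^esub> v = \<zero>\<^bsub>M\<^esub>"
  shows "\<exists>q\<in>ass_primes R M. I \<subseteq> q"
proof -
  let ?ann = "annihilator R M"
  define V where "V = {v \<in> carrier M. v \<noteq> \<zero>\<^bsub>M\<^esub> \<and>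
    (\<forall>w\<in>carrier M. w \<noteq> \<zero>\<^bsub>M\<^esub> \<longrightarrow> ?ann v \<subseteq> ?ann w \<longrightarrow> ?ann w = ?ann v)}"
  have Vc: "V \<subseteq> carrier M" unfolding V_def by (rule Collect_restrict)
  have Vass: "?ann v \<in> ass_primes R M" if "v \<in> V" for v
    by (rule maximal_annihilator_prime) (use that in \<open>simp_all add: V_def\<close>)
  have Vspec: "?ann v \<in> spec R" if "v \<in> V" for v
    using Vass[OF that] by (simp add: ass_primes_def)
  have Vmax: "?ann w = ?ann v" if "v \<in> V" "w \<in> V" "?ann v \<subseteq> ?ann w" for v w
    using that by (simp add: V_def)
  obtain G where G: "finite G" "G \<subseteq> V" "V \<subseteq> mod_span R M G"
    using ex_finite_generators[OF Vc] by blast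
  have VG: "?ann v \<in> ?ann ` G" if v: "v \<in> V" for v
  proof (rule ccontr)
    assume n: "?ann v \<notin> ?ann ` G"
    have "\<exists>b\<in>carrier R. b \<notin> ?ann v \<and> (\<forall>Q\<in>?ann ` G. b \<in> Q)"
    proof (rule R.prime_not_contains_Inter[OF Vspec[OF v]])
      fix Q assume "Q \<in> ?ann ` G"
      then obtain g where g: "g \<in> G" "Q = ?ann g" by blast
      have "\<not> ?ann g \<subseteq> ?ann v" using Vmax[of g v] g n G(2) v by blast
      moreover have "ideal (?ann g) R" using annihilator_ideal g G(2) Vc by blast
      ultimately show "ideal Q R \<and> \<not> Q \<subseteq> ?ann v" using g by simp
    qed (use G in blast)
    then obtain b where b: "b \<in> carrier R" "b \<notin> ?ann v" "\<And>g. g \<in> G \<Longrightarrow> b \<in> ?ann g" by blast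
    \<comment> \<open>The vectors killed by b form a submodule containing G, hence containing v,
      against the choice of b.\<close>
    have "submodule {w \<in> carrier M. b \<odot>\<^bsub>M\<^esub> w = \<zero>\<^bsub>M\<^esub>} R M"
    proof (rule submodule_intro)
      fix r a assume h: "r \<in> carrier R" "a \<in> {w \<in> carrier M. b \<odot>\<^bsub>M\<^esub> w = \<zero>\<^bsub>M\<^esub>}"
      have "b \<odot>\<^bsub>M\<^esub> (r \<odot>\<^bsub>M\<^esub> a) = r \<odot>\<^bsub>M\<^esub> (b \<odot>\<^bsub>M\<^esub> a)"
        using h b(1) smult_assoc1[of b r a] smult_assoc1[of r b a] by (simp add: R.m_comm)
      then show "r \<odot>\<^bsub>M\<^esub> a \<in> {w \<in> carrier M. b \<odot>\<^bsub>M\<^esub> w = \<zero>\<^bsub>M\<^esub>}" using h by simp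
    qed (use b(1) in \<open>auto simp: smult_r_distr\<close>)
    moreover have "G \<subseteq> {w \<in> carrier M. b \<odot>\<^bsub>M\<^esub> w = \<zero>\<^bsub>M\<^esub>}"
      using b(3) G(2) Vc by (auto simp: annihilator_def)
    ultimately have "v \<in> {w \<in> carrier M. b \<odot>\<^bsub>M\<^esub> w = \<zero>\<^bsub>M\<^esub>}" using span_least G(3) v by blast
    then show False using b(1,2) by (simp add: annihilator_def)
  qed
  show ?thesis
  proof (rule ccontr)
    assume n: "\<not> ?thesis"
    have "\<exists>a\<in>I. \<forall>Q\<in>?ann ` G. a \<notin> Q"
    proof (rule R.prime_avoidance_antichain[OF I])
      fix Q assume "Q \<in> ?ann ` G"
      then show "Q \<in> spec R \<and> \<not> I \<subseteq> Q" using n Vass Vspec G(2) by blast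
    next
      \<comment> \<open>Maximality of the annihilators turns inclusion into equality, which is the
        antichain condition.\<close>
      fix Q Q' assume "Q \<in> ?ann ` G" "Q' \<in> ?ann ` G" "Q \<subseteq> Q'"
      then show "Q = Q'" using Vmax G(2) by blast
    qed (use G in blast)
    then obtain a where a: "a \<in> I" "\<forall>Q\<in>?ann ` G. a \<notin> Q" by blast
    obtain u where u: "u \<in> carrier M" "u \<noteq> \<zero>\<^bsub>M\<^esub>" "a \<odot>\<^bsub>M\<^esub> u = \<zero>\<^bsub>M\<^esub>" using zd[OF a(1)] by blast
    obtain v where v: "v \<in> carrier M" "v \<noteq> \<zero>\<^bsub>M\<^esub>" "?ann u \<subseteq> ?ann v"
      "\<forall>w\<in>carrier M. w \<noteq> \<zero>\<^bsub>M\<^esub> \<longrightarrow> ?ann v \<subseteq> ?ann w \<longrightarrow> ?ann w = ?ann v"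
      using ex_maximal_annihilator[OF noeth u(1,2)] by blast
    have "v \<in> V" unfolding V_def using v by blast
    then have "?ann v \<in> ?ann ` G" by (rule VG)
    moreover have "a \<in> ?ann u" using u ideal.Icarr[OF I a(1)] by (simp add: annihilator_def)
    ultimately show False using a(2) v(3) by blast
  qed
qed

section \<open>Noetherian local rings and Nakayama's lemma\<close>

locale noeth_local_ring = noetherian_ring R for R (structure) +
  fixes m :: "'a set"
  assumes local: "local_ring R m"
begin

sublocale cring R using local by (simp add: local_ring_def)

lemma max_ideal: "maximalideal m R" using local by (simp add: local_ring_def)

lemma m_ideal: "ideal m R" using max_ideal by (simp add: maximalideal_def)

lemma m_carrier: "x \<in> m \<Longrightarrow> x \<in> carrier R" using ideal.Icarr[OF m_ideal] .

lemma one_notin_m: "\<one> \<notin> m"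
  using ideal.one_imp_carrier[OF m_ideal] maximalideal.I_notcarr[OF max_ideal] by blast

lemma m_spec: "m \<in> spec R"
  unfolding spec_def using maximalideal_prime[OF max_ideal] by simp

text \<open>The noetherian condition yields a maximal ideal above I, and by locality it is
  m.\<close>

lemma proper_ideal_le:
  assumes I: "ideal I R" "I \<noteq> carrier R"
  shows "I \<subseteq> m"
proof -
  let ?C = "{J. ideal J R \<and> I \<subseteq> J \<and> J \<noteq> carrier R}"
  have "\<exists>J\<in>?C. \<forall>K\<in>?C. J \<subseteq> K \<longrightarrow> K = J"
  proof (rule ideal_family_maximal)
    have "I \<in> ?C" using I by simp
    then show "?C \<noteq> {}" by blast
  qed simp
  then obtain J where "J \<in> ?C" and max: "\<forall>K\<in>?C. J \<subseteq> K \<longrightarrow> K = J" by (elim bexE)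
  then have J: "ideal J R" "I \<subseteq> J" "J \<noteq> carrier R" by simp_all
  have "maximalideal J R"
  proof (rule maximalidealI[OF J(1)])
    show "carrier R \<noteq> J" using J(3) by simp
    fix K assume "ideal K R" "J \<subseteq> K"
    then show "K = J \<or> K = carrier R" using max J(2) by auto
  qed
  then show ?thesis using local J(2) by (simp add: local_ring_def)
qed

lemma spec_le_m: "p \<in> spec R \<Longrightarrow> p \<subseteq> m"
  using proper_ideal_le[OF spec_ideal] spec_one[of p] by (metis one_closed)

lemma unit_outside_m:
  assumes x: "x \<in> carrier R" "x \<notin> m"
  shows "\<exists>y\<in>carrier R. y \<otimes> x = \<one>"
proof -
  have "PIdl x = carrier R"
    using proper_ideal_le[OF cgenideal_ideal[OF x(1)]] cgenideal_self[OF x(1)] x(2) by blast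
  then have "\<one> \<in> PIdl x" by simp
  then show ?thesis unfolding cgenideal_def mem_Collect_eq by metis
qed

end

text \<open>Induction on the number of generators: f = x(rf + u) with u in the span of the others
  gives (1 - xr) f = xu, and 1 - xr is a unit because it lies outside m. So f is redundant.\<close>

lemma (in module) nakayama:
  assumes "noeth_local_ring R m" and x: "x \<in> m" and "finite F" "F \<subseteq> carrier M"
    and "\<And>v. v \<in> mod_span R M F \<Longrightarrow> \<exists>w \<in> mod_span R M F. v = x \<odot>\<^bsub>M\<^esub> w"
  shows "mod_span R M F = {\<zero>\<^bsub>M\<^esub>}"
  using assms(3-)
proof (induction F rule: finite_induct)
  case empty
  show ?case by (rule span_empty)
next
  case (insert f F)
  interpret L: noeth_local_ring R m by (rule assms(1))
  have f: "f \<in> carrier M" and F: "F \<subseteq> carrier M" using insert.prems(1) by auto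
  note xc = L.m_carrier[OF x]
  note S = span_submodule[OF F]
  have "f \<in> mod_span R M (insert f F)" using span_incl by blast
  then obtain r u where ru: "r \<in> carrier R" "u \<in> mod_span R M F" "f = x \<odot>\<^bsub>M\<^esub> (r \<odot>\<^bsub>M\<^esub> f \<oplus>\<^bsub>M\<^esub> u)"
    using insert.prems(2) unfolding span_insert[OF f F] by blast
  have uc: "u \<in> carrier M" using ru(2) span_closed[OF F] by blast
  define c where "c = \<one>\<^bsub>R\<^esub> \<ominus>\<^bsub>R\<^esub> x \<otimes>\<^bsub>R\<^esub> r"
  have cc: "c \<in> carrier R" unfolding c_def using xc ru(1) by simp
  have "c \<notin> m"
  proof
    assume h: "c \<in> m"
    have "x \<otimes>\<^bsub>R\<^esub> r \<in> m" using ideal.I_r_closed[OF L.m_ideal x ru(1)] .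
    then have "c \<oplus>\<^bsub>R\<^esub> x \<otimes>\<^bsub>R\<^esub> r \<in> m"
      using additive_subgroup.a_closed[OF ideal.axioms(1)[OF L.m_ideal] h] by blast
    moreover have "c \<oplus>\<^bsub>R\<^esub> x \<otimes>\<^bsub>R\<^esub> r = \<one>\<^bsub>R\<^esub>"
      unfolding c_def using xc ru(1) by (simp add: a_minus_def R.a_assoc R.l_neg)
    ultimately show False using L.one_notin_m by simp
  qed
  then obtain y where y: "y \<in> carrier R" "y \<otimes>\<^bsub>R\<^esub> c = \<one>\<^bsub>R\<^esub>" using L.unit_outside_m[OF cc] by blast
  have e: "f = (x \<otimes>\<^bsub>R\<^esub> r) \<odot>\<^bsub>M\<^esub> f \<oplus>\<^bsub>M\<^esub> x \<odot>\<^bsub>M\<^esub> u"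
    using ru(3) xc ru(1) uc f by (simp add: smult_r_distr smult_assoc1)
  have "c \<odot>\<^bsub>M\<^esub> f = f \<oplus>\<^bsub>M\<^esub> \<ominus>\<^bsub>M\<^esub> ((x \<otimes>\<^bsub>R\<^esub> r) \<odot>\<^bsub>M\<^esub> f)"
    unfolding c_def a_minus_def using xc ru(1) f by (simp add: smult_l_distr smult_l_minus)
  also have "\<dots> = ((x \<otimes>\<^bsub>R\<^esub> r) \<odot>\<^bsub>M\<^esub> f \<oplus>\<^bsub>M\<^esub> x \<odot>\<^bsub>M\<^esub> u) \<oplus>\<^bsub>M\<^esub> \<ominus>\<^bsub>M\<^esub> ((x \<otimes>\<^bsub>R\<^esub> r) \<odot>\<^bsub>M\<^esub> f)"
    using e by (rule arg_cong)
  also have "\<dots> = x \<odot>\<^bsub>M\<^esub> u"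
    using xc ru(1) f uc by (simp add: M.a_comm[of "(x \<otimes>\<^bsub>R\<^esub> r) \<odot>\<^bsub>M\<^esub> f" "x \<odot>\<^bsub>M\<^esub> u"] M.a_assoc M.r_neg)
  finally have "y \<odot>\<^bsub>M\<^esub> (c \<odot>\<^bsub>M\<^esub> f) = y \<odot>\<^bsub>M\<^esub> (x \<odot>\<^bsub>M\<^esub> u)" by simp
  then have "f = y \<odot>\<^bsub>M\<^esub> (x \<odot>\<^bsub>M\<^esub> u)"
    using y cc f by (simp add: smult_assoc1[symmetric])
  then have "f \<in> mod_span R M F" using submoduleE(4)[OF S] y(1) xc ru(2) by metis
  \<comment> \<open>Both spans agree, so the divisibility hypothesis for the larger generating set
    is one for the smaller set.\<close>
  then have eq: "mod_span R M (insert f F) = mod_span R M F"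
    using span_least[OF S, of "insert f F"] span_incl[of F] span_mono[of F "insert f F"] by blast
  show ?case using insert.IH[OF F] insert.prems(2) unfolding eq by blast
qed

section \<open>Complexes over the degree zero part\<close>

context graded_complex
begin

lemma gr_closed: "x \<in> gr n \<Longrightarrow> x \<in> carrier G"
  using additive_subgroup.a_subset[OF gr_subgroup] by blast

lemma gr_zero: "\<zero> \<in> gr n"
  by (rule additive_subgroup.zero_closed[OF gr_subgroup])

lemma gr_add: "x \<in> gr n \<Longrightarrow> y \<in> gr n \<Longrightarrow> x \<oplus> y \<in> gr n"
  by (rule additive_subgroup.a_closed[OF gr_subgroup])

lemma gr_neg: "x \<in> gr n \<Longrightarrow> \<ominus> x \<in> gr n"
  by (metis abelian_subgroup.axioms(1) abelian_subgroupI3 abelian_group_axioms additive_subgroup.a_subgroup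
      group.subgroupE(3) a_group gr_subgroup a_inv_def)

lemma d_zero: "d \<zero> = \<zero>"
proof -
  have c: "d \<zero> \<in> carrier G" using d_degree[OF gr_zero] gr_closed by blast
  have "d \<zero> = d (\<zero> \<oplus> \<zero>)" by simp
  also have "\<dots> = d \<zero> \<oplus> d \<zero>" by (rule d_add) simp_all
  finally show ?thesis using c by (metis add.r_cancel_one')
qed

lemma d_finsum:
  assumes "finite F" "\<And>n. n \<in> F \<Longrightarrow> f n \<in> gr n"
  shows "d (\<Oplus>n\<in>F. f n) = (\<Oplus>n\<in>F. d (f n))"
  using assms
proof (induction F rule: finite_induct)
  case empty
  then show ?case using d_zero by simp
next
  case (insert k F)
  have f: "f \<in> F \<rightarrow> carrier G" "f k \<in> carrier G"
    and df: "(\<lambda>n. d (f n)) \<in> F \<rightarrow> carrier G" "d (f k) \<in> carrier G"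
    using insert.prems gr_closed d_degree by blast+
  show ?case
    using insert f df by (simp add: finsum_insert d_add finsum_closed)
qed

text \<open>The axioms place \<open>d x\<close> in the carrier only for homogeneous x; a general x
  is a finite sum of such elements.\<close>

lemma d_closed: "x \<in> carrier G \<Longrightarrow> d x \<in> carrier G"
proof -
  assume "x \<in> carrier G"
  then obtain f where "decomposes G gr x f" using gr_direct_sum by blast
  then have f: "\<And>n. f n \<in> gr n" "finite {n. f n \<noteq> \<zero>}" "x = (\<Oplus>n\<in>{n. f n \<noteq> \<zero>}. f n)"
    by (auto simp: decomposes_def)
  have "d x = (\<Oplus>n\<in>{n. f n \<noteq> \<zero>}. d (f n))" unfolding f(3) by (rule d_finsum[OF f(2,1)])
  moreover have "(\<lambda>n. d (f n)) \<in> {n. f n \<noteq> \<zero>} \<rightarrow> carrier G" using gr_closed[OF d_degree[OF f(1)]] by blast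
  ultimately show ?thesis using finsum_closed by simp
qed

lemma decomposes_homogeneous:
  assumes "x \<in> gr n"
  shows "decomposes G gr x (\<lambda>k. if k = n then x else \<zero>)"
proof (cases "x = \<zero>")
  case True
  then show ?thesis by (simp add: decomposes_def gr_zero)
next
  case False
  then have "{k. (if k = n then x else \<zero>) \<noteq> \<zero>} = {n}" by auto
  then show ?thesis using assms gr_closed[OF assms] by (simp add: decomposes_def gr_zero)
qed

lemma decomposes_unique:
  "x \<in> carrier G \<Longrightarrow> decomposes G gr x f \<Longrightarrow> (THE f. decomposes G gr x f) = f"
  using gr_direct_sum by (simp add: the1_equality)

end

section \<open>The degree zero part of a DG-ring and the ring H^0\<close>

abbreviation boundary_ideal :: "'a dg_ring \<Rightarrow> 'a set" where
  "boundary_ideal A \<equiv> coboundaries (self_module A) 0"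

lemma deg0_ring_simps [simp]:
  "carrier (deg0_ring A) = deg_part A 0" "monoid.mult (deg0_ring A) = monoid.mult A"
  "one (deg0_ring A) = one A" "zero (deg0_ring A) = zero A" "add (deg0_ring A) = add A"
  by (simp_all add: deg0_ring_def)

lemma self_module_simps [simp]:
  "carrier (self_module A) = carrier A" "zero (self_module A) = zero A" "add (self_module A) = add A"
  "smult (self_module A) = monoid.mult A" "mdeg_part (self_module A) = deg_part A"
  "mdifferential (self_module A) = differential A"
  by (simp_all add: self_module_def)

lemma boundary_ideal_eq: "boundary_ideal A = differential A ` deg_part A (- 1)"
  by (simp add: coboundaries_def)

context dg_ring
begin

lemma deg0_subcring: "subcring (deg_part A 0) A"
proof (rule subcringI)
  show "subring (deg_part A 0) A"
  proof (rule subringI)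
    show "\<And>h1 h2. h1 \<in> deg_part A 0 \<Longrightarrow> h2 \<in> deg_part A 0 \<Longrightarrow> h1 \<otimes> h2 \<in> deg_part A 0"
      using deg_mult[of _ 0 _ 0] by simp
  qed (use gr_closed gr_neg gr_add deg_one in auto)
  fix a b assume "a \<in> deg_part A 0" "b \<in> deg_part A 0"
  then show "a \<otimes> b = b \<otimes> a" using graded_comm[of b 0 a 0] by (simp add: sgn_pow_def)
qed

lemma deg0_cring: "cring (deg0_ring A)"
  unfolding deg0_ring_def using subcring_iff[of "deg_part A 0"] deg0_subcring gr_closed by blast

lemma deg0_a_inv: "a \<in> deg_part A 0 \<Longrightarrow> \<ominus>\<^bsub>deg0_ring A\<^esub> a = \<ominus> a"
proof -
  interpret R: cring "deg0_ring A" by (rule deg0_cring)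
  assume a: "a \<in> deg_part A 0"
  have "\<ominus> a \<oplus>\<^bsub>deg0_ring A\<^esub> a = \<zero>\<^bsub>deg0_ring A\<^esub>" using gr_closed[OF a] by (simp add: l_neg)
  then show ?thesis using R.minus_equality a gr_neg[OF a] by simp
qed

lemma d_deg0: "a \<in> deg_part A 0 \<Longrightarrow> differential A a = \<zero>"
  using d_degree[of a 0] non_positive[of 1] by simp

lemma deg0_central: "a \<in> deg_part A 0 \<Longrightarrow> b \<in> deg_part A n \<Longrightarrow> b \<otimes> a = a \<otimes> b"
  using graded_comm[of a 0 b n] by (simp add: sgn_pow_def)

lemma d_deg0_smult: "a \<in> deg_part A 0 \<Longrightarrow> b \<in> carrier A \<Longrightarrow> differential A (a \<otimes> b) = a \<otimes> differential A b"
  using leibniz[of a 0 b] d_closed gr_closed by (simp add: d_deg0 sgn_pow_def)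

lemma boundary_ideal_deg0: "c \<in> boundary_ideal A \<Longrightarrow> c \<in> deg_part A 0"
  unfolding boundary_ideal_eq using d_degree[of _ "-1"] by auto

text \<open>Elements of degree zero are cocycles because there is nothing in degree one, so r d(x) =
  d(r x); this makes the boundaries an ideal and not merely a subgroup.\<close>

lemma boundary_ideal: "ideal (boundary_ideal A) (deg0_ring A)"
proof (rule cring.ideal_intro[OF deg0_cring])
  show "boundary_ideal A \<subseteq> carrier (deg0_ring A)" using boundary_ideal_deg0 by auto
  show "\<zero>\<^bsub>deg0_ring A\<^esub> \<in> boundary_ideal A"
    unfolding boundary_ideal_eq using d_zero gr_zero by (auto intro!: image_eqI[of _ _ \<zero>])
next
  fix a b assume "a \<in> boundary_ideal A" "b \<in> boundary_ideal A"
  then obtain x y where xy: "x \<in> deg_part A (-1)" "y \<in> deg_part A (-1)"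
    "a = differential A x" "b = differential A y" unfolding boundary_ideal_eq by blast
  have "a \<oplus> b = differential A (x \<oplus> y)" using xy gr_closed d_add by simp
  then show "a \<oplus>\<^bsub>deg0_ring A\<^esub> b \<in> boundary_ideal A"
    unfolding boundary_ideal_eq using gr_add[OF xy(1,2)] by auto
next
  fix a r assume "a \<in> boundary_ideal A" and r: "r \<in> carrier (deg0_ring A)"
  then obtain x where x: "x \<in> deg_part A (-1)" "a = differential A x" unfolding boundary_ideal_eq by blast
  have "r \<otimes> a = differential A (r \<otimes> x)" using x r gr_closed d_deg0_smult by simp
  then show "r \<otimes>\<^bsub>deg0_ring A\<^esub> a \<in> boundary_ideal A"
    unfolding boundary_ideal_eq using deg_mult[of r 0 x "-1"] r x(1) by auto
qed

lemma H0_cring: "cring (H0 A)"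
  unfolding H0_def by (rule ideal.quotient_is_cring[OF boundary_ideal deg0_cring])

lemma H0_proj_hom: "H0_proj A \<in> ring_hom (deg0_ring A) (H0 A)"
  unfolding H0_def H0_proj_def by (rule ideal.rcos_ring_hom[OF boundary_ideal])

lemma carrier_H0: "carrier (H0 A) = H0_proj A ` deg_part A 0"
  unfolding H0_def H0_proj_def FactRing_def A_RCOSETS_defs by (auto simp: a_r_coset_def)

lemma H0_proj_closed: "a \<in> deg_part A 0 \<Longrightarrow> H0_proj A a \<in> carrier (H0 A)"
  by (simp add: carrier_H0)

lemma H0_lift_ex: "x \<in> carrier (H0 A) \<Longrightarrow> H0_lift A x \<in> deg_part A 0 \<and> H0_proj A (H0_lift A x) = x"
  unfolding H0_lift_def carrier_H0 by (rule someI_ex) auto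

lemma H0_lift_closed: "x \<in> carrier (H0 A) \<Longrightarrow> H0_lift A x \<in> deg_part A 0"
  using H0_lift_ex by blast

lemma H0_proj_lift: "x \<in> carrier (H0 A) \<Longrightarrow> H0_proj A (H0_lift A x) = x"
  using H0_lift_ex by blast

lemma H0_proj_simps:
  assumes "a \<in> deg_part A 0" "b \<in> deg_part A 0"
  shows "H0_proj A (a \<oplus> b) = H0_proj A a \<oplus>\<^bsub>H0 A\<^esub> H0_proj A b"
    "H0_proj A (a \<otimes> b) = H0_proj A a \<otimes>\<^bsub>H0 A\<^esub> H0_proj A b"
  using ring_hom_add[OF H0_proj_hom, of a b] ring_hom_mult[OF H0_proj_hom, of a b] assms by simp_all

lemma H0_proj_one: "H0_proj A \<one> = \<one>\<^bsub>H0 A\<^esub>"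
  using ring_hom_one[OF H0_proj_hom] by simp

lemma zero_H0: "\<zero>\<^bsub>H0 A\<^esub> = boundary_ideal A"
  by (simp add: H0_def FactRing_def)

lemma mem_H0_proj:
  assumes "a \<in> deg_part A 0"
  shows "b \<in> H0_proj A a \<longleftrightarrow> (\<exists>c\<in>boundary_ideal A. b = c \<oplus> a)"
  unfolding H0_proj_def a_r_coset_def r_coset_def by auto

lemma H0_proj_eq_iff:
  assumes a: "a \<in> deg_part A 0" and b: "b \<in> deg_part A 0"
  shows "H0_proj A a = H0_proj A b \<longleftrightarrow> a \<ominus> b \<in> boundary_ideal A"
proof -
  interpret J: ideal "boundary_ideal A" "deg0_ring A" by (rule boundary_ideal)
  have "H0_proj A a = H0_proj A b \<longleftrightarrow> a \<in> H0_proj A b"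
    unfolding H0_proj_def
    using J.a_repr_independence'[of a b] J.a_rcos_self[of a] a b by auto
  also have "\<dots> \<longleftrightarrow> a \<ominus> b \<in> boundary_ideal A"
    unfolding H0_proj_def using J.a_rcos_module[of b a] a b
    by (simp add: a_minus_def deg0_a_inv)
  finally show ?thesis .
qed

lemma H0_proj_zero_iff:
  assumes "a \<in> deg_part A 0"
  shows "H0_proj A a = \<zero>\<^bsub>H0 A\<^esub> \<longleftrightarrow> a \<in> boundary_ideal A"
proof -
  interpret J: ideal "boundary_ideal A" "deg0_ring A" by (rule boundary_ideal)
  have "H0_proj A \<zero> = \<zero>\<^bsub>H0 A\<^esub>"
    unfolding zero_H0 H0_proj_def using J.a_rcos_const[OF additive_subgroup.zero_closed[OF J.is_additive_subgroup]] by simp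
  then show ?thesis using H0_proj_eq_iff[OF assms gr_zero] gr_closed[OF assms] by (simp add: a_minus_def)
qed

text \<open>A homogeneous element has at most one nonzero component, which evaluates the description
  in \<open>grading_involution\<close>. Degree zero elements are then fixed, so
  \<open>A\<^sup>0\<close> acts on Koszul complexes without signs.\<close>

lemma grading_involution_homogeneous:
  assumes a: "a \<in> deg_part A n"
  shows "grading_involution A a = sgn_pow A n a"
proof -
  let ?f = "\<lambda>k. if k = n then a else \<zero>"
  have "(THE f. decomposes A (deg_part A) a f) = ?f"
    using decomposes_unique[OF gr_closed[OF a] decomposes_homogeneous[OF a]] .
  then have e: "grading_involution A a = (\<Oplus>k\<in>{k. ?f k \<noteq> \<zero>}. sgn_pow A k (?f k))"
    by (simp add: grading_involution_def Let_def)
  show ?thesis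
  proof (cases "a = \<zero>")
    case True
    then show ?thesis using e by (simp add: sgn_pow_def)
  next
    case False
    then have s: "{k. ?f k \<noteq> \<zero>} = {n}" by auto
    have "sgn_pow A n a \<in> carrier A" using gr_closed[OF a] by (simp add: sgn_pow_def)
    then show ?thesis unfolding e s by simp
  qed
qed

lemma grading_involution_deg0: "a \<in> deg_part A 0 \<Longrightarrow> grading_involution A a = a"
  by (simp add: grading_involution_homogeneous sgn_pow_def)

end

section \<open>Complexes over the degree zero part and their cohomology\<close>

text \<open>An \<open>A\<^sup>0\<close>-linear homotopy of degree -1 from multiplication by c to
  zero. Linearity is what makes the cross terms with a Koszul element cancel later.\<close>

definition nullhomotopy :: "'a dg_ring \<Rightarrow> ('a, 'm) dg_module \<Rightarrow> 'a \<Rightarrow> ('m \<Rightarrow> 'm) \<Rightarrow> bool" where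
  "nullhomotopy A M c h \<longleftrightarrow>
     (\<forall>x\<in>carrier M. h x \<in> carrier M) \<and>
     (\<forall>x\<in>carrier M. \<forall>y\<in>carrier M. h (x \<oplus>\<^bsub>M\<^esub> y) = h x \<oplus>\<^bsub>M\<^esub> h y) \<and>
     (\<forall>a\<in>deg_part A 0. \<forall>x\<in>carrier M. h (a \<odot>\<^bsub>M\<^esub> x) = a \<odot>\<^bsub>M\<^esub> h x) \<and>
     (\<forall>n. \<forall>x\<in>mdeg_part M n. h x \<in> mdeg_part M (n - 1)) \<and>
     (\<forall>x\<in>carrier M. mdifferential M (h x) \<oplus>\<^bsub>M\<^esub> h (mdifferential M x) = c \<odot>\<^bsub>M\<^esub> x)"

text \<open>Instead of the action of all of \<open>A\<close>, only that of \<open>A\<^sup>0\<close> is retained, together with the fact that the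
  boundaries in \<open>A\<^sup>0\<close> act null-homotopically; this suffices for \<open>H\<^sup>0(A)\<close> to act on cohomology and is
  inherited by Koszul complexes.\<close>

locale cplx = dg: dg_ring A + module "deg0_ring A" M
  for A :: "'a dg_ring" and M :: "('a, 'm) dg_module" (structure) +
  assumes gr_submodule: "submodule (mdeg_part M n) (deg0_ring A) M"
    and d_closed: "x \<in> carrier M \<Longrightarrow> mdifferential M x \<in> carrier M"
    and d_add: "\<lbrakk>x \<in> carrier M; y \<in> carrier M\<rbrakk> \<Longrightarrow> mdifferential M (x \<oplus> y) = mdifferential M x \<oplus> mdifferential M y"
    and d_smult: "\<lbrakk>a \<in> deg_part A 0; x \<in> carrier M\<rbrakk> \<Longrightarrow> mdifferential M (a \<odot> x) = a \<odot> mdifferential M x"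
    and d_degree: "x \<in> mdeg_part M n \<Longrightarrow> mdifferential M x \<in> mdeg_part M (n + 1)"
    and d_d: "x \<in> carrier M \<Longrightarrow> mdifferential M (mdifferential M x) = \<zero>"
    and ex_nullhomotopy: "c \<in> boundary_ideal A \<Longrightarrow> \<exists>h. nullhomotopy A M c h"

context dg_ring
begin

lemma self_abelian_group: "abelian_group (self_module A)"
  by (rule abelian_groupI) (auto simp: a_ac intro: l_neg bexI[of _ "\<ominus> _"])

text \<open>For b of degree -1 the Leibniz rule reads d(bx) = d(b) x - b d(x), so left
  multiplication by b is a homotopy for d(b).\<close>

lemma self_nullhomotopy:
  assumes b: "b \<in> deg_part A (- 1)"
  shows "nullhomotopy A (self_module A) (differential A b) (\<lambda>x. b \<otimes> x)"
proof -
  have bc: "b \<in> carrier A" using b gr_closed by blast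
  have "b \<otimes> (a \<otimes> x) = a \<otimes> (b \<otimes> x)" if "a \<in> deg_part A 0" "x \<in> carrier A" for a x
    using that bc deg0_central[OF that(1) b] gr_closed[OF that(1)] by (simp add: m_assoc[symmetric])
  moreover have "differential A (b \<otimes> x) \<oplus> b \<otimes> differential A x = differential A b \<otimes> x"
    if x: "x \<in> carrier A" for x
  proof -
    have "differential A (b \<otimes> x) = differential A b \<otimes> x \<oplus> \<ominus> (b \<otimes> differential A x)"
      using leibniz[OF b x] by (simp add: sgn_pow_def)
    then show ?thesis using x bc d_closed by (simp add: a_assoc l_neg)
  qed
  ultimately show ?thesis
    unfolding nullhomotopy_def using bc deg_mult[OF b]
    by (auto simp: r_distr algebra_simps)
qed

lemma self_cplx: "cplx A (self_module A)"
proof -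
  have "module (deg0_ring A) (self_module A)"
    by (rule moduleI[OF deg0_cring self_abelian_group])
      (auto simp: l_distr r_distr m_assoc gr_closed)
  then interpret module "deg0_ring A" "self_module A" .
  show ?thesis
  proof (intro cplx.intro cplx_axioms.intro)
    show "dg_ring A" by (rule dg_ring_axioms)
    show "module (deg0_ring A) (self_module A)" by (rule module_axioms)
    fix n
    show "submodule (mdeg_part (self_module A) n) (deg0_ring A) (self_module A)"
      by (rule submodule_intro) (use deg_mult[of _ 0 _ n] in \<open>auto simp: gr_closed gr_zero gr_add\<close>)
  qed (auto simp: d_add d_degree d_d d_closed d_deg0_smult boundary_ideal_eq intro: self_nullhomotopy)
qed

end

lemma (in abelian_subgroup) coset_eq_iff:
  assumes "x \<in> carrier G" "y \<in> carrier G"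
  shows "H +> x = H +> y \<longleftrightarrow> x \<ominus> y \<in> H"
  using a_repr_independence'[of x y] a_rcos_self[of x] a_rcos_module[of y x] assms
  by (auto simp: a_minus_def)

definition coh_class :: "('a, 'm) dg_module \<Rightarrow> int \<Rightarrow> 'm \<Rightarrow> 'm set" where
  "coh_class M n u = coboundaries M n +>\<^bsub>M\<^esub> u"

context cplx
begin

lemma gr_closed: "x \<in> mdeg_part M n \<Longrightarrow> x \<in> carrier M"
  using submoduleE(1)[OF gr_submodule] by blast

lemma gr_zero: "\<zero> \<in> mdeg_part M n"
  by (rule submodule_zero[OF gr_submodule])

lemma gr_add: "x \<in> mdeg_part M n \<Longrightarrow> y \<in> mdeg_part M n \<Longrightarrow> x \<oplus> y \<in> mdeg_part M n"
  by (rule submoduleE(5)[OF gr_submodule])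

lemma gr_neg: "x \<in> mdeg_part M n \<Longrightarrow> \<ominus> x \<in> mdeg_part M n"
  by (rule submoduleE(3)[OF gr_submodule])

lemma gr_diff: "x \<in> mdeg_part M n \<Longrightarrow> y \<in> mdeg_part M n \<Longrightarrow> x \<ominus> y \<in> mdeg_part M n"
  by (rule submodule_diff[OF gr_submodule])

lemma gr_smult: "a \<in> deg_part A 0 \<Longrightarrow> x \<in> mdeg_part M n \<Longrightarrow> a \<odot> x \<in> mdeg_part M n"
  using submoduleE(4)[OF gr_submodule] by simp

lemma smult_cl [simp]: "a \<in> deg_part A 0 \<Longrightarrow> x \<in> carrier M \<Longrightarrow> a \<odot> x \<in> carrier M"
  using smult_closed by simp

lemma d_zero [simp]: "mdifferential M \<zero> = \<zero>"
  using d_add[of \<zero> \<zero>] d_closed[of \<zero>] by (metis M.zero_closed M.l_zero M.add.r_cancel_one')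

lemma d_neg: "x \<in> carrier M \<Longrightarrow> mdifferential M (\<ominus> x) = \<ominus> mdifferential M x"
  using d_add[of "\<ominus> x" x] d_closed by (simp add: M.l_neg M.minus_equality)

lemma minus_zero: "\<ominus> \<zero> = \<zero>"
  by (rule M.minus_equality) simp_all

lemma cocycle_submodule: "submodule (cocycles M n) (deg0_ring A) M"
  by (rule submodule_intro)
    (auto simp: cocycles_def gr_zero gr_add gr_smult d_add gr_closed d_smult)

lemma coboundary_submodule: "submodule (coboundaries M n) (deg0_ring A) M"
proof (rule submodule_intro)
  show "coboundaries M n \<subseteq> carrier M" unfolding coboundaries_def using gr_closed d_closed by blast
  show "\<zero> \<in> coboundaries M n" unfolding coboundaries_def using d_zero gr_zero by (auto intro!: image_eqI[of _ _ \<zero>])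
next
  fix a b assume "a \<in> coboundaries M n" "b \<in> coboundaries M n"
  then obtain p q where "p \<in> mdeg_part M (n - 1)" "q \<in> mdeg_part M (n - 1)"
    "a = mdifferential M p" "b = mdifferential M q" unfolding coboundaries_def by blast
  then have "a \<oplus> b = mdifferential M (p \<oplus> q)" "p \<oplus> q \<in> mdeg_part M (n - 1)"
    using d_add gr_closed gr_add by simp_all
  then show "a \<oplus> b \<in> coboundaries M n" unfolding coboundaries_def by blast
next
  fix r a assume r: "r \<in> carrier (deg0_ring A)" and "a \<in> coboundaries M n"
  then obtain p where "p \<in> mdeg_part M (n - 1)" "a = mdifferential M p" unfolding coboundaries_def by blast
  then have "r \<odot> a = mdifferential M (r \<odot> p)" "r \<odot> p \<in> mdeg_part M (n - 1)"
    using d_smult gr_closed gr_smult r by simp_all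
  then show "r \<odot> a \<in> coboundaries M n" unfolding coboundaries_def by blast
qed

lemma coboundary_closed: "u \<in> coboundaries M n \<Longrightarrow> u \<in> carrier M"
  using submoduleE(1)[OF coboundary_submodule] by blast

lemma coboundary_cocycle: "u \<in> coboundaries M n \<Longrightarrow> u \<in> cocycles M n"
  unfolding coboundaries_def cocycles_def using d_degree[of _ "n - 1"] d_d gr_closed by auto

lemma cocycle_closed: "u \<in> cocycles M n \<Longrightarrow> u \<in> carrier M"
  using submoduleE(1)[OF cocycle_submodule] by blast

text \<open>On a cocycle the homotopy identity reduces to d(h u) = c u.\<close>

lemma boundary_acts_trivially:
  assumes c: "c \<in> boundary_ideal A" and u: "u \<in> cocycles M n"
  shows "c \<odot> u \<in> coboundaries M n"
proof -
  obtain h where h: "nullhomotopy A M c h" using ex_nullhomotopy[OF c] by blast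
  have u': "u \<in> carrier M" "u \<in> mdeg_part M n" "mdifferential M u = \<zero>"
    using u gr_closed by (auto simp: cocycles_def)
  have "h \<zero> \<oplus> h \<zero> = h \<zero>" "h \<zero> \<in> carrier M"
    using h unfolding nullhomotopy_def by (metis M.zero_closed M.l_zero)+
  then have "h \<zero> = \<zero>" by (metis M.add.r_cancel_one')
  then have "mdifferential M (h u) = c \<odot> u"
    using h u' d_closed unfolding nullhomotopy_def by (metis M.r_zero)
  moreover have "h u \<in> mdeg_part M (n - 1)" using h u' unfolding nullhomotopy_def by blast
  ultimately show ?thesis unfolding coboundaries_def by (metis imageI)
qed

lemma coboundary_subgroup: "abelian_subgroup (coboundaries M n) M"
  by (rule abelian_subgroupI3)
    (use coboundary_submodule M.abelian_group_axioms in \<open>auto simp: submodule_def additive_subgroup_def\<close>)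

lemma coh_class_eq_iff:
  "u \<in> carrier M \<Longrightarrow> v \<in> carrier M \<Longrightarrow> coh_class M n u = coh_class M n v \<longleftrightarrow> u \<ominus> v \<in> coboundaries M n"
  unfolding coh_class_def by (rule abelian_subgroup.coset_eq_iff[OF coboundary_subgroup])

lemma coh_class_add: "u \<in> carrier M \<Longrightarrow> v \<in> carrier M \<Longrightarrow>
    coh_class M n u <+>\<^bsub>M\<^esub> coh_class M n v = coh_class M n (u \<oplus> v)"
  unfolding coh_class_def by (rule abelian_subgroup.a_rcos_sum[OF coboundary_subgroup])

lemma mem_coh_class: "v \<in> carrier M \<Longrightarrow> u \<in> coh_class M n v \<longleftrightarrow> u \<in> carrier M \<and> u \<ominus> v \<in> coboundaries M n"
  unfolding coh_class_def a_minus_def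
  using abelian_subgroup.a_rcos_module[OF coboundary_subgroup, of v u n]
    abelian_subgroup.a_elemrcos_carrier[OF coboundary_subgroup, of v u n] by blast

lemma coh_class_zero: "u \<in> coboundaries M n \<Longrightarrow> coh_class M n u = coboundaries M n"
  unfolding coh_class_def by (rule abelian_subgroup.a_rcos_const[OF coboundary_subgroup])

lemma carrier_cohomology: "carrier (cohomology M n) = coh_class M n ` cocycles M n"
  unfolding cohomology_def coh_class_def A_RCOSETS_defs by (auto simp: a_r_coset_defs)

lemma zero_cohomology: "zero (cohomology M n) = coboundaries M n"
  by (simp add: cohomology_def)

lemma coh_class_zero_iff:
  assumes "u \<in> carrier M"
  shows "coh_class M n u = zero (cohomology M n) \<longleftrightarrow> u \<in> coboundaries M n"
  using coh_class_eq_iff[OF assms M.zero_closed, of n] coh_class_zero[OF submodule_zero[OF coboundary_submodule], of n]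
    assms minus_zero by (simp add: zero_cohomology a_minus_def)

lemma add_cohomology:
  "u \<in> carrier M \<Longrightarrow> v \<in> carrier M \<Longrightarrow>
    coh_class M n u \<oplus>\<^bsub>cohomology M n\<^esub> coh_class M n v = coh_class M n (u \<oplus> v)"
  by (simp add: cohomology_def coh_class_add)

text \<open>The scalar product in \<open>cohomology\<close> is a union over all representatives. It
  collapses to one coset because for b = c + a with c a boundary, bv - au = b(v - u) + cu, and both
  terms on the right are coboundaries.\<close>

lemma smult_cohomology:
  assumes a: "a \<in> deg_part A 0" and u: "u \<in> cocycles M n"
  shows "H0_proj A a \<odot>\<^bsub>cohomology M n\<^esub> coh_class M n u = coh_class M n (a \<odot> u)"
proof -
  note uc = cocycle_closed[OF u]
  have *: "coboundaries M n +>\<^bsub>M\<^esub> (b \<odot> v) = coh_class M n (a \<odot> u)"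
    if b: "b \<in> H0_proj A a" and v: "v \<in> coh_class M n u" for b v
  proof -
    obtain c where c: "c \<in> boundary_ideal A" "b = c \<oplus>\<^bsub>A\<^esub> a"
      using b dg.mem_H0_proj[OF a] by blast
    have c0: "c \<in> deg_part A 0" by (rule dg.boundary_ideal_deg0[OF c(1)])
    have b0: "b \<in> deg_part A 0" using c c0 a dg.gr_add by simp
    have vc: "v \<in> carrier M" and vu: "v \<ominus> u \<in> coboundaries M n"
      using v mem_coh_class[OF uc] by blast+
    have "b \<odot> (v \<ominus> u) \<in> coboundaries M n"
      using submoduleE(4)[OF coboundary_submodule _ vu] b0 by simp
    moreover have "c \<odot> u \<in> coboundaries M n" by (rule boundary_acts_trivially[OF c(1) u])
    ultimately have "b \<odot> (v \<ominus> u) \<oplus> c \<odot> u \<in> coboundaries M n"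
      by (rule submoduleE(5)[OF coboundary_submodule])
    moreover have "b \<odot> (v \<ominus> u) \<oplus> c \<odot> u = b \<odot> v \<ominus> a \<odot> u"
    proof -
      have bu: "b \<odot> u = c \<odot> u \<oplus> a \<odot> u" using smult_l_distr[of c a u] c c0 a uc by simp
      have "b \<odot> (v \<ominus> u) \<oplus> c \<odot> u = b \<odot> v \<oplus> (\<ominus> (c \<odot> u \<oplus> a \<odot> u) \<oplus> c \<odot> u)"
        using b0 vc uc c0 a smult_r_distr[of b v "\<ominus> u"] smult_r_minus[of b u]
        by (simp add: a_minus_def bu M.a_assoc)
      also have "\<ominus> (c \<odot> u \<oplus> a \<odot> u) \<oplus> c \<odot> u = \<ominus> (a \<odot> u)"
        using c0 a uc by (simp add: M.minus_add M.a_assoc M.a_comm[of "\<ominus> (c \<odot> u)"] M.l_neg)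
      finally show ?thesis by (simp add: a_minus_def)
    qed
    ultimately show ?thesis
      using coh_class_eq_iff[of "b \<odot> v" "a \<odot> u" n] b0 a vc uc by (simp add: coh_class_def)
  qed
  \<comment> \<open>Both cosets are nonempty; otherwise the union would be empty.\<close>
  have ne: "a \<in> H0_proj A a" "u \<in> coh_class M n u"
  proof -
    have "a = \<zero>\<^bsub>A\<^esub> \<oplus>\<^bsub>A\<^esub> a" using dg.gr_closed[OF a] by simp
    moreover have "\<zero>\<^bsub>A\<^esub> \<in> boundary_ideal A"
      unfolding boundary_ideal_eq using dg.d_zero dg.gr_zero by (auto intro!: image_eqI[of _ _ "\<zero>\<^bsub>A\<^esub>"])
    ultimately show "a \<in> H0_proj A a" unfolding dg.mem_H0_proj[OF a] by blast
    show "u \<in> coh_class M n u"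
      using mem_coh_class[OF uc] uc submodule_zero[OF coboundary_submodule] by (simp add: a_minus_def M.r_neg)
  qed
  have "H0_proj A a \<odot>\<^bsub>cohomology M n\<^esub> coh_class M n u =
      (\<Union>b\<in>H0_proj A a. \<Union>v\<in>coh_class M n u. coboundaries M n +>\<^bsub>M\<^esub> (b \<odot> v))"
    by (simp add: cohomology_def)
  also have "\<dots> = (\<Union>b\<in>H0_proj A a. \<Union>v\<in>coh_class M n u. coh_class M n (a \<odot> u))"
    using * by (intro SUP_cong refl) blast
  also have "\<dots> = coh_class M n (a \<odot> u)" using ne by blast
  finally show ?thesis .
qed

lemma cohomologyE:
  assumes "X \<in> carrier (cohomology M n)"
  obtains u where "u \<in> cocycles M n" "X = coh_class M n u"
  using assms unfolding carrier_cohomology by blast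

lemma coh_class_closed: "u \<in> cocycles M n \<Longrightarrow> coh_class M n u \<in> carrier (cohomology M n)"
  unfolding carrier_cohomology by blast

lemma cocycle_add: "u \<in> cocycles M n \<Longrightarrow> v \<in> cocycles M n \<Longrightarrow> u \<oplus> v \<in> cocycles M n"
  by (rule submoduleE(5)[OF cocycle_submodule])

lemma cocycle_smult: "a \<in> deg_part A 0 \<Longrightarrow> u \<in> cocycles M n \<Longrightarrow> a \<odot> u \<in> cocycles M n"
  using submoduleE(4)[OF cocycle_submodule] by simp

lemma cohomology_module: "module (H0 A) (cohomology M n)"
proof (rule moduleI)
  show "cring (H0 A)" by (rule dg.H0_cring)
  show "abelian_group (cohomology M n)"
  proof (rule abelian_groupI)
    fix X Y assume X: "X \<in> carrier (cohomology M n)" and Y: "Y \<in> carrier (cohomology M n)"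
    then obtain u v where u: "u \<in> cocycles M n" "X = coh_class M n u"
      and v: "v \<in> cocycles M n" "Y = coh_class M n v" by (elim cohomologyE) blast
    show "X \<oplus>\<^bsub>cohomology M n\<^esub> Y \<in> carrier (cohomology M n)"
      using u v by (simp add: add_cohomology cocycle_closed coh_class_closed cocycle_add)
    show "X \<oplus>\<^bsub>cohomology M n\<^esub> Y = Y \<oplus>\<^bsub>cohomology M n\<^esub> X"
      using u v by (simp add: add_cohomology cocycle_closed M.a_comm)
    fix Z assume "Z \<in> carrier (cohomology M n)"
    then obtain w where w: "w \<in> cocycles M n" "Z = coh_class M n w" by (rule cohomologyE)
    show "X \<oplus>\<^bsub>cohomology M n\<^esub> Y \<oplus>\<^bsub>cohomology M n\<^esub> Z = X \<oplus>\<^bsub>cohomology M n\<^esub> (Y \<oplus>\<^bsub>cohomology M n\<^esub> Z)"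
      using u v w by (simp add: add_cohomology cocycle_closed M.a_assoc)
  next
    have z: "\<zero>\<^bsub>cohomology M n\<^esub> = coh_class M n \<zero>"
      using coh_class_zero[OF submodule_zero[OF coboundary_submodule]] by (simp add: zero_cohomology)
    show "\<zero>\<^bsub>cohomology M n\<^esub> \<in> carrier (cohomology M n)"
      unfolding z by (rule coh_class_closed[OF submodule_zero[OF cocycle_submodule]])
    fix X assume "X \<in> carrier (cohomology M n)"
    then obtain u where u: "u \<in> cocycles M n" "X = coh_class M n u" by (rule cohomologyE)
    show "\<zero>\<^bsub>cohomology M n\<^esub> \<oplus>\<^bsub>cohomology M n\<^esub> X = X"
      using u by (simp add: z add_cohomology cocycle_closed)
    have "coh_class M n (\<ominus> u) \<oplus>\<^bsub>cohomology M n\<^esub> X = \<zero>\<^bsub>cohomology M n\<^esub>"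
      using u by (simp add: z add_cohomology cocycle_closed M.l_neg)
    then show "\<exists>Y\<in>carrier (cohomology M n). Y \<oplus>\<^bsub>cohomology M n\<^esub> X = \<zero>\<^bsub>cohomology M n\<^esub>"
      using coh_class_closed[OF submoduleE(3)[OF cocycle_submodule u(1)]] by blast
  qed
next
  fix x y X Y assume x: "x \<in> carrier (H0 A)" and X: "X \<in> carrier (cohomology M n)"
  then obtain a u where a: "a \<in> deg_part A 0" "x = H0_proj A a"
    and u: "u \<in> cocycles M n" "X = coh_class M n u" by (metis dg.carrier_H0 cohomologyE imageE)
  note s = smult_cohomology cocycle_closed cocycle_smult cocycle_add coh_class_closed add_cohomology
  show "x \<odot>\<^bsub>cohomology M n\<^esub> X \<in> carrier (cohomology M n)" using a u by (simp add: s)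
  {
    assume "Y \<in> carrier (cohomology M n)"
    then obtain v where v: "v \<in> cocycles M n" "Y = coh_class M n v" by (rule cohomologyE)
    show "x \<odot>\<^bsub>cohomology M n\<^esub> (X \<oplus>\<^bsub>cohomology M n\<^esub> Y) =
        x \<odot>\<^bsub>cohomology M n\<^esub> X \<oplus>\<^bsub>cohomology M n\<^esub> x \<odot>\<^bsub>cohomology M n\<^esub> Y"
      using a u v by (simp add: s smult_r_distr)
  }
  {
    assume "y \<in> carrier (H0 A)"
    then obtain b where b: "b \<in> deg_part A 0" "y = H0_proj A b" by (metis dg.carrier_H0 imageE)
    have ab: "a \<oplus>\<^bsub>A\<^esub> b \<in> deg_part A 0" "a \<otimes>\<^bsub>A\<^esub> b \<in> deg_part A 0"
      using a b dg.gr_add dg.deg_mult[of a 0 b 0] by simp_all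
    show "(x \<oplus>\<^bsub>H0 A\<^esub> y) \<odot>\<^bsub>cohomology M n\<^esub> X =
        x \<odot>\<^bsub>cohomology M n\<^esub> X \<oplus>\<^bsub>cohomology M n\<^esub> y \<odot>\<^bsub>cohomology M n\<^esub> X"
      using a b u ab smult_l_distr[of a b u] by (simp add: s dg.H0_proj_simps[symmetric])
    show "x \<otimes>\<^bsub>H0 A\<^esub> y \<odot>\<^bsub>cohomology M n\<^esub> X = x \<odot>\<^bsub>cohomology M n\<^esub> (y \<odot>\<^bsub>cohomology M n\<^esub> X)"
      using a b u ab smult_assoc1[of a b u] by (simp add: s dg.H0_proj_simps[symmetric])
  }
next
  fix X assume "X \<in> carrier (cohomology M n)"
  then obtain u where u: "u \<in> cocycles M n" "X = coh_class M n u" by (rule cohomologyE)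
  show "\<one>\<^bsub>H0 A\<^esub> \<odot>\<^bsub>cohomology M n\<^esub> X = X"
    using smult_cohomology[OF dg.deg_one u(1)] smult_one[of u] u
    by (simp add: dg.H0_proj_one cocycle_closed)
qed

lemma smult_cohomology_lift:
  "x \<in> carrier (H0 A) \<Longrightarrow> u \<in> cocycles M n \<Longrightarrow>
    x \<odot>\<^bsub>cohomology M n\<^esub> coh_class M n u = coh_class M n (H0_lift A x \<odot> u)"
  using smult_cohomology[of "H0_lift A x" u n] dg.H0_lift_ex[of x] by simp

lemma nonzero_degrees_iff: "n \<in> nonzero_degrees M \<longleftrightarrow> \<not> cocycles M n \<subseteq> coboundaries M n"
proof -
  interpret H: module "H0 A" "cohomology M n" by (rule cohomology_module)
  have "n \<in> nonzero_degrees M \<longleftrightarrow> (\<exists>X\<in>carrier (cohomology M n). X \<noteq> \<zero>\<^bsub>cohomology M n\<^esub>)"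
    unfolding nonzero_degrees_def using H.zero_closed by auto
  also have "\<dots> \<longleftrightarrow> \<not> cocycles M n \<subseteq> coboundaries M n"
    unfolding carrier_cohomology using coh_class_zero_iff cocycle_closed by auto
  finally show ?thesis .
qed

end

section \<open>Module homomorphisms and extensions of noetherian modules\<close>

definition module_hom :: "('a, 'b) ring_scheme \<Rightarrow> ('a, 'm, 'c) module_scheme \<Rightarrow> ('a, 'n, 'd) module_scheme \<Rightarrow> ('m \<Rightarrow> 'n) \<Rightarrow> bool" where
  "module_hom R M N f \<longleftrightarrow> (\<forall>x\<in>carrier M. f x \<in> carrier N) \<and>
    (\<forall>x\<in>carrier M. \<forall>y\<in>carrier M. f (x \<oplus>\<^bsub>M\<^esub> y) = f x \<oplus>\<^bsub>N\<^esub> f y) \<and>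
    (\<forall>r\<in>carrier R. \<forall>x\<in>carrier M. f (r \<odot>\<^bsub>M\<^esub> x) = r \<odot>\<^bsub>N\<^esub> f x)"

lemma module_hom_zero:
  assumes "module R M" "module R N" "module_hom R M N f"
  shows "f \<zero>\<^bsub>M\<^esub> = \<zero>\<^bsub>N\<^esub>"
proof -
  interpret M: module R M by fact
  interpret N: module R N by fact
  have "f \<zero>\<^bsub>M\<^esub> \<in> carrier N" using assms(3) by (simp add: module_hom_def)
  moreover have "f (\<zero>\<^bsub>R\<^esub> \<odot>\<^bsub>M\<^esub> \<zero>\<^bsub>M\<^esub>) = \<zero>\<^bsub>R\<^esub> \<odot>\<^bsub>N\<^esub> f \<zero>\<^bsub>M\<^esub>"
    using assms(3) M.R.zero_closed M.M.zero_closed unfolding module_hom_def by blast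
  ultimately show ?thesis by simp
qed

lemma module_hom_image_submodule:
  assumes M: "module R M" and N: "module R N" and f: "module_hom R M N f" and S: "submodule S R M"
  shows "submodule (f ` S) R N"
proof -
  interpret M: module R M by fact
  interpret N: module R N by fact
  note Sc = M.submoduleE(1)[OF S, THEN subsetD]
  show ?thesis
  proof (rule N.submodule_intro)
    show "f ` S \<subseteq> carrier N" using f Sc unfolding module_hom_def by blast
    show "\<zero>\<^bsub>N\<^esub> \<in> f ` S"
      using module_hom_zero[OF M N f] M.submodule_zero[OF S] by (metis imageI)
  next
    fix a b assume "a \<in> f ` S" "b \<in> f ` S"
    then obtain x y where "x \<in> S" "y \<in> S" "a = f x" "b = f y" by blast
    then have "a \<oplus>\<^bsub>N\<^esub> b = f (x \<oplus>\<^bsub>M\<^esub> y)" "x \<oplus>\<^bsub>M\<^esub> y \<in> S"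
      using f Sc M.submoduleE(5)[OF S] by (simp_all add: module_hom_def)
    then show "a \<oplus>\<^bsub>N\<^esub> b \<in> f ` S" by blast
  next
    fix r a assume r: "r \<in> carrier R" and "a \<in> f ` S"
    then obtain x where "x \<in> S" "a = f x" by blast
    then have "r \<odot>\<^bsub>N\<^esub> a = f (r \<odot>\<^bsub>M\<^esub> x)" "r \<odot>\<^bsub>M\<^esub> x \<in> S"
      using f Sc M.submoduleE(4)[OF S] r by (simp_all add: module_hom_def)
    then show "r \<odot>\<^bsub>N\<^esub> a \<in> f ` S" by blast
  qed
qed

lemma module_hom_vimage_submodule:
  assumes M: "module R M" and N: "module R N" and f: "module_hom R M N f" and S: "submodule S R N"
  shows "submodule {x \<in> carrier M. f x \<in> S} R M"
proof -
  interpret M: module R M by fact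
  interpret N: module R N by fact
  show ?thesis
  proof (rule M.submodule_intro)
    show "\<zero>\<^bsub>M\<^esub> \<in> {x \<in> carrier M. f x \<in> S}"
      using module_hom_zero[OF M N f] N.submodule_zero[OF S] by simp
  next
    fix a b assume "a \<in> {x \<in> carrier M. f x \<in> S}" "b \<in> {x \<in> carrier M. f x \<in> S}"
    then show "a \<oplus>\<^bsub>M\<^esub> b \<in> {x \<in> carrier M. f x \<in> S}"
      using f N.submoduleE(5)[OF S] by (simp add: module_hom_def)
  next
    fix r a assume "r \<in> carrier R" "a \<in> {x \<in> carrier M. f x \<in> S}"
    then show "r \<odot>\<^bsub>M\<^esub> a \<in> {x \<in> carrier M. f x \<in> S}"
      using f N.submoduleE(4)[OF S] by (simp add: module_hom_def)
  qed (rule Collect_restrict)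
qed

text \<open>A submodule S of M is generated by lifts to S of generators of its image under p,
  together with the images under i of generators of its preimage in L.\<close>

theorem noeth_module_extension:
  assumes L: "noeth_module R L" and M: "module R M" and N: "noeth_module R N"
    and i: "module_hom R L M i" and p: "module_hom R M N p"
    and exact: "\<And>x. x \<in> carrier M \<Longrightarrow> p x = \<zero>\<^bsub>N\<^esub> \<Longrightarrow> x \<in> i ` carrier L"
  shows "noeth_module R M"
proof -
  interpret L: noeth_module R L by fact
  interpret N: noeth_module R N by fact
  interpret M: module R M by fact
  note Lm = L.module_axioms and Nm = N.module_axioms
  show ?thesis
  proof unfold_locales
    fix S assume S: "submodule S R M"
    note Sc = M.submoduleE(1)[OF S, THEN subsetD]
    obtain G1 where G1: "finite G1" "G1 \<subseteq> p ` S" "p ` S = mod_span R N G1"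
      using N.submodule_fin_gen[OF module_hom_image_submodule[OF M Nm p S]] by (elim exE conjE) (rule that)
    obtain F where F: "F \<subseteq> S" "finite F" "G1 = p ` F" using finite_subset_image[OF G1(1,2)] by metis
    let ?T = "{x \<in> carrier L. i x \<in> S}"
    obtain G2 where G2: "finite G2" "G2 \<subseteq> ?T" "?T = mod_span R L G2"
      using L.submodule_fin_gen[OF module_hom_vimage_submodule[OF Lm M i S]] by (elim exE conjE) (rule that)
    let ?G = "F \<union> i ` G2"
    have GS: "?G \<subseteq> S" using F(1) G2(2) by blast
    have Gc: "?G \<subseteq> carrier M" "F \<subseteq> carrier M" using GS Sc by blast+
    note sp = M.span_submodule[OF Gc(1)]
    have "S \<subseteq> mod_span R M ?G"
    proof
      fix x assume x: "x \<in> S"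
      \<comment> \<open>Some w in the span of the lifted generators F has p x = p w; the difference
        x - w then lies in the kernel of p and hence comes from L.\<close>
      have "mod_span R N G1 \<subseteq> p ` mod_span R M F"
        using N.span_least[OF module_hom_image_submodule[OF M Nm p M.span_submodule[OF Gc(2)]]]
          M.span_incl[of F] unfolding F(3) by (meson image_mono)
      moreover have "p x \<in> mod_span R N G1" unfolding G1(3)[symmetric] using x by (rule imageI)
      ultimately obtain w where w: "w \<in> mod_span R M F" "p x = p w" by blast
      have wS: "w \<in> S" using w(1) M.span_least[OF S F(1)] by blast
      have xw: "x \<ominus>\<^bsub>M\<^esub> w \<in> S" by (rule M.submodule_diff[OF S x wS])
      have e: "(x \<ominus>\<^bsub>M\<^esub> w) \<oplus>\<^bsub>M\<^esub> w = x" using Sc[OF x] Sc[OF wS] by (simp add: a_minus_def M.M.a_assoc M.M.l_neg)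
      have pc: "p w \<in> carrier N" "p (x \<ominus>\<^bsub>M\<^esub> w) \<in> carrier N"
        using p Sc[OF wS] Sc[OF xw] by (simp_all add: module_hom_def)
      have "p (x \<ominus>\<^bsub>M\<^esub> w) \<oplus>\<^bsub>N\<^esub> p w = p w"
        using p Sc[OF wS] Sc[OF xw] e w(2) unfolding module_hom_def by metis
      then have "p (x \<ominus>\<^bsub>M\<^esub> w) = \<zero>\<^bsub>N\<^esub>" using N.M.add.l_cancel_one[of "p w" "p (x \<ominus>\<^bsub>M\<^esub> w)"] N.M.add.r_cancel_one[of "p w" "p (x \<ominus>\<^bsub>M\<^esub> w)"] pc by simp
      then obtain v where v: "v \<in> carrier L" "x \<ominus>\<^bsub>M\<^esub> w = i v" using exact[OF Sc[OF xw]] by blast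
      have "v \<in> ?T" using v xw by simp
      then have "v \<in> mod_span R L G2" unfolding G2(3)[symmetric] .
      moreover have "mod_span R L G2 \<subseteq> {x \<in> carrier L. i x \<in> mod_span R M ?G}"
        by (rule L.span_least[OF module_hom_vimage_submodule[OF Lm M i sp]])
          (use M.span_incl[of ?G] G2(2) in blast)
      ultimately have "x \<ominus>\<^bsub>M\<^esub> w \<in> mod_span R M ?G" using v(2) by auto
      moreover have "w \<in> mod_span R M ?G" using w(1) M.span_mono[of F ?G] by blast
      ultimately show "x \<in> mod_span R M ?G" using M.submoduleE(5)[OF sp] e by metis
    qed
    then have "S = mod_span R M ?G" using M.span_least[OF S GS] by (rule subset_antisym)
    moreover have "finite ?G" using F(2) G2(1) by blast
    ultimately show "\<exists>G. finite G \<and> G \<subseteq> S \<and> S = mod_span R M G"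
      using GS by (intro exI[of _ ?G] conjI) assumption+
  qed
qed

text \<open>The induced map on cohomology through an arbitrary representative; for additive f
  respecting cocycles and coboundaries, \<open>coh_map_class\<close> removes the choice.\<close>

definition coh_map :: "('a, 'm) dg_module \<Rightarrow> int \<Rightarrow> ('b, 'n) dg_module \<Rightarrow> int \<Rightarrow> ('m \<Rightarrow> 'n) \<Rightarrow> 'm set \<Rightarrow> 'n set" where
  "coh_map M n N k f X = coh_class N k (f (SOME u. u \<in> cocycles M n \<and> X = coh_class M n u))"

lemma coh_map_class:
  assumes "cplx A M" "cplx A' N"
    and f: "\<And>u. u \<in> cocycles M n \<Longrightarrow> f u \<in> cocycles N k"
    and fB: "\<And>u. u \<in> coboundaries M n \<Longrightarrow> f u \<in> coboundaries N k"
    and add: "\<And>u v. u \<in> cocycles M n \<Longrightarrow> v \<in> cocycles M n \<Longrightarrow> f (u \<oplus>\<^bsub>M\<^esub> v) = f u \<oplus>\<^bsub>N\<^esub> f v"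
    and u: "u \<in> cocycles M n"
  shows "coh_map M n N k f (coh_class M n u) = coh_class N k (f u)"
proof -
  interpret M: cplx A M by fact
  interpret N: cplx A' N by fact
  let ?v = "SOME v. v \<in> cocycles M n \<and> coh_class M n u = coh_class M n v"
  have v: "?v \<in> cocycles M n \<and> coh_class M n u = coh_class M n ?v"
    by (rule someI[of _ u]) (use u in simp)
  note c = M.cocycle_closed[OF u] M.cocycle_closed[OF conjunct1[OF v]]
  have B: "?v \<ominus>\<^bsub>M\<^esub> u \<in> coboundaries M n" using M.coh_class_eq_iff[of ?v u n] c v by simp
  have "(?v \<ominus>\<^bsub>M\<^esub> u) \<oplus>\<^bsub>M\<^esub> u = ?v" using c by (simp add: a_minus_def M.M.a_assoc M.M.l_neg)
  then have e: "f ?v = f (?v \<ominus>\<^bsub>M\<^esub> u) \<oplus>\<^bsub>N\<^esub> f u" using add[OF M.coboundary_cocycle[OF B] u] by simp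
  note fc = N.coboundary_closed[OF fB[OF B]] N.cocycle_closed[OF f[OF u]]
  have "f ?v \<ominus>\<^bsub>N\<^esub> f u = f (?v \<ominus>\<^bsub>M\<^esub> u)" unfolding e using fc by (simp add: a_minus_def N.M.a_assoc N.M.r_neg)
  then have "f ?v \<ominus>\<^bsub>N\<^esub> f u \<in> coboundaries N k" using fB[OF B] by simp
  then show ?thesis
    unfolding coh_map_def using N.coh_class_eq_iff[of "f ?v" "f u" k] fc(2) N.cocycle_closed[OF f[OF conjunct1[OF v]]] by simp
qed

section \<open>Koszul complexes\<close>

text \<open>One step of the recursion in \<open>regular_seq_nest\<close>, named so that it can be
  computed on elements of the form \<open>Node (x, y)\<close>.\<close>

definition kos :: "'a dg_ring \<Rightarrow> ('a, 'm nest) dg_module \<Rightarrow> 'a \<Rightarrow> ('a, 'm nest) dg_module" where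
  "kos A M a = transport Node (koszul A M a)"

lemma the_inv_Node [simp]: "the_inv Node (Node p) = p"
  by (rule the_inv_f_f) (simp add: inj_def)

lemma Node_image [simp]: "Node p \<in> Node ` S \<longleftrightarrow> p \<in> S"
  by (auto simp: image_iff)

lemma kos_simps [simp]:
  "carrier (kos A M a) = Node ` (carrier M \<times> carrier M)"
  "\<zero>\<^bsub>kos A M a\<^esub> = Node (\<zero>\<^bsub>M\<^esub>, \<zero>\<^bsub>M\<^esub>)"
  "Node (x, y) \<oplus>\<^bsub>kos A M a\<^esub> Node (x', y') = Node (x \<oplus>\<^bsub>M\<^esub> x', y \<oplus>\<^bsub>M\<^esub> y')"
  "b \<odot>\<^bsub>kos A M a\<^esub> Node (x, y) = Node (grading_involution A b \<odot>\<^bsub>M\<^esub> x, b \<odot>\<^bsub>M\<^esub> y)"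
  "mdeg_part (kos A M a) n = Node ` (mdeg_part M (n + 1) \<times> mdeg_part M n)"
  "mdifferential (kos A M a) (Node (x, y)) = Node (\<ominus>\<^bsub>M\<^esub> mdifferential M x, a \<odot>\<^bsub>M\<^esub> x \<oplus>\<^bsub>M\<^esub> mdifferential M y)"
  by (simp_all add: kos_def transport_def koszul_def)

locale nest_cplx = cplx A M for A :: "'a dg_ring" and M :: "('a, 'm nest) dg_module" (structure)
begin

declare minus_zero [simp]

lemma neg_zero_iff: "x \<in> carrier M \<Longrightarrow> \<ominus> x = \<zero> \<longleftrightarrow> x = \<zero>"
  using M.minus_minus[of x] minus_zero by auto

lemma kos_abelian_group: "abelian_group (kos A M a)"
proof (rule abelian_groupI)
  fix x assume "x \<in> carrier (kos A M a)"
  then obtain p q where "x = Node (p, q)" "p \<in> carrier M" "q \<in> carrier M" by auto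
  then show "\<exists>y\<in>carrier (kos A M a). y \<oplus>\<^bsub>kos A M a\<^esub> x = \<zero>\<^bsub>kos A M a\<^esub>"
    by (intro bexI[of _ "Node (\<ominus> p, \<ominus> q)"]) (simp_all add: M.l_neg)
qed (auto simp: M.a_ac)

lemma kos_module: "module (deg0_ring A) (kos A M a)"
  by (rule moduleI[OF dg.deg0_cring kos_abelian_group])
    (use smult_l_distr smult_assoc1 dg.gr_add dg.deg_mult[of _ 0 _ 0] smult_one dg.deg_one in
      \<open>auto simp: dg.grading_involution_deg0 smult_r_distr\<close>)

lemma kos_a_inv: "x \<in> carrier M \<Longrightarrow> y \<in> carrier M \<Longrightarrow> \<ominus>\<^bsub>kos A M a\<^esub> Node (x, y) = Node (\<ominus> x, \<ominus> y)"
  by (rule abelian_group.minus_equality[OF kos_abelian_group]) (simp_all add: M.l_neg)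

text \<open>The homotopy on e \<otimes> M \<oplus> M is (-h, h): the sign matches that of the
  differential on the first summand, and the cross terms -a h(x) and h(a x) cancel by
  linearity.\<close>

lemma kos_nullhomotopy:
  assumes a: "a \<in> deg_part A 0" and h: "nullhomotopy A M c h" and c: "c \<in> deg_part A 0"
  shows "nullhomotopy A (kos A M a) c
    (\<lambda>z. case z of Node (x, y) \<Rightarrow> Node (\<ominus> h x, h y) | Leaf l \<Rightarrow> Leaf l)"
proof -
  have hc: "\<And>x. x \<in> carrier M \<Longrightarrow> h x \<in> carrier M"
    and ha: "\<And>x y. x \<in> carrier M \<Longrightarrow> y \<in> carrier M \<Longrightarrow> h (x \<oplus> y) = h x \<oplus> h y"
    and hs: "\<And>b x. b \<in> deg_part A 0 \<Longrightarrow> x \<in> carrier M \<Longrightarrow> h (b \<odot> x) = b \<odot> h x"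
    and hg: "\<And>n x. x \<in> mdeg_part M n \<Longrightarrow> h x \<in> mdeg_part M (n - 1)"
    and hd: "\<And>x. x \<in> carrier M \<Longrightarrow> mdifferential M (h x) \<oplus> h (mdifferential M x) = c \<odot> x"
    using h unfolding nullhomotopy_def by blast+
  have hn: "h (\<ominus> x) = \<ominus> h x" if x: "x \<in> carrier M" for x
  proof -
    have "h \<zero> = \<zero>" using ha[of \<zero> \<zero>] hc[of \<zero>] by (metis M.zero_closed M.l_zero M.add.r_cancel_one')
    then have "h (\<ominus> x) \<oplus> h x = \<zero>" using ha[of "\<ominus> x" x] x by (simp add: M.l_neg)
    then show ?thesis using M.minus_equality hc x by simp
  qed
  have key: "(a \<odot> (\<ominus> h x) \<oplus> mdifferential M (h y)) \<oplus> h (a \<odot> x \<oplus> mdifferential M y) = c \<odot> y"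
    if x: "x \<in> carrier M" and y: "y \<in> carrier M" for x y
  proof -
    have "(a \<odot> (\<ominus> h x) \<oplus> mdifferential M (h y)) \<oplus> h (a \<odot> x \<oplus> mdifferential M y)
      = (\<ominus> (a \<odot> h x) \<oplus> a \<odot> h x) \<oplus> (mdifferential M (h y) \<oplus> h (mdifferential M y))"
      using x y a hc d_closed smult_r_minus[of a "h x"] by (simp add: ha hs M.a_ac)
    also have "\<dots> = c \<odot> y" using x y a hc hd c by (simp add: M.l_neg)
    finally show ?thesis .
  qed
  have key1: "\<ominus> mdifferential M (\<ominus> h x) \<oplus> \<ominus> h (\<ominus> mdifferential M x) = c \<odot> x" if x: "x \<in> carrier M" for x
    using x hc d_closed hd by (simp add: d_neg hn)
  show ?thesis
    unfolding nullhomotopy_def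
  proof (intro conjI ballI allI)
    fix n x assume "x \<in> mdeg_part (kos A M a) n"
    then obtain p q where "x = Node (p, q)" "p \<in> mdeg_part M (n + 1)" "q \<in> mdeg_part M n" by auto
    then show "(case x of Node (x, y) \<Rightarrow> Node (\<ominus> h x, h y) | Leaf l \<Rightarrow> Leaf l) \<in> mdeg_part (kos A M a) (n - 1)"
      using gr_neg hg[of p "n + 1"] hg[of q n] by simp
  qed (use a c hc d_closed key key1 in \<open>auto simp: ha hs dg.grading_involution_deg0 M.minus_add M.a_comm smult_r_minus\<close>)
qed

lemma kos_cplx:
  assumes a: "a \<in> deg_part A 0"
  shows "nest_cplx A (kos A M a)"
proof (intro nest_cplx.intro cplx.intro cplx_axioms.intro)
  interpret K: module "deg0_ring A" "kos A M a" by (rule kos_module)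
  show "dg_ring A" by (rule dg.dg_ring_axioms)
  show "module (deg0_ring A) (kos A M a)" by (rule kos_module)
  show "submodule (mdeg_part (kos A M a) n) (deg0_ring A) (kos A M a)" for n
    by (rule K.submodule_intro)
      (auto simp: gr_closed gr_zero gr_add gr_smult dg.grading_involution_deg0)
  show "mdifferential (kos A M a) x \<in> carrier (kos A M a)" if "x \<in> carrier (kos A M a)" for x
    using that a by (auto simp: d_closed)
  show "mdifferential (kos A M a) (x \<oplus>\<^bsub>kos A M a\<^esub> y) =
      mdifferential (kos A M a) x \<oplus>\<^bsub>kos A M a\<^esub> mdifferential (kos A M a) y"
    if "x \<in> carrier (kos A M a)" "y \<in> carrier (kos A M a)" for x y
    using that a by (auto simp: d_closed d_add smult_r_distr M.minus_add M.a_ac)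
  show "mdifferential (kos A M a) (b \<odot>\<^bsub>kos A M a\<^esub> x) = b \<odot>\<^bsub>kos A M a\<^esub> mdifferential (kos A M a) x"
    if b: "b \<in> deg_part A 0" and xc: "x \<in> carrier (kos A M a)" for b x
  proof -
    obtain p q where x: "x = Node (p, q)" "p \<in> carrier M" "q \<in> carrier M" using xc by auto
    have "a \<odot> (b \<odot> p) = b \<odot> (a \<odot> p)"
      using a b x smult_assoc1[of a b p] smult_assoc1[of b a p] R.m_comm[of a b] by simp
    then show ?thesis
      using x a b smult_r_minus[of b "mdifferential M p"]
      by (simp add: dg.grading_involution_deg0 d_smult smult_r_distr d_closed)
  qed
  show "mdifferential (kos A M a) x \<in> mdeg_part (kos A M a) (n + 1)" if "x \<in> mdeg_part (kos A M a) n" for x n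
    using that a d_degree[of _ "n + 1"] d_degree[of _ n] by (auto simp: gr_neg gr_add gr_smult)
  show "mdifferential (kos A M a) (mdifferential (kos A M a) x) = \<zero>\<^bsub>kos A M a\<^esub>" if "x \<in> carrier (kos A M a)" for x
    using that a smult_r_minus[of a]
    by (auto simp: d_closed d_add d_neg d_d d_smult M.l_neg)
  show "\<exists>h. nullhomotopy A (kos A M a) c h" if "c \<in> boundary_ideal A" for c
    using kos_nullhomotopy[OF a _ dg.boundary_ideal_deg0[OF that]] ex_nullhomotopy[OF that] by blast
qed

section \<open>The long exact sequence of a Koszul complex on one element\<close>

lemma kos_cocycle:
  "Node (u, v) \<in> cocycles (kos A M a) n \<longleftrightarrow>
    u \<in> cocycles M (n + 1) \<and> v \<in> mdeg_part M n \<and> a \<odot> u \<oplus> mdifferential M v = \<zero>"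
proof -
  have "\<ominus> mdifferential M u = \<zero> \<longleftrightarrow> mdifferential M u = \<zero>" if "u \<in> mdeg_part M (n + 1)"
    using neg_zero_iff d_closed[OF gr_closed[OF that]] by simp
  then show ?thesis by (auto simp: cocycles_def)
qed

lemma kos_coboundary:
  "Node (u, v) \<in> coboundaries (kos A M a) n \<longleftrightarrow>
    (\<exists>p\<in>mdeg_part M n. \<exists>q\<in>mdeg_part M (n - 1). u = \<ominus> mdifferential M p \<and> v = a \<odot> p \<oplus> mdifferential M q)"
  unfolding coboundaries_def by (auto simp: image_iff)

lemma kos_cocycleE:
  assumes "z \<in> cocycles (kos A M a) n"
  obtains u v where "z = Node (u, v)" "u \<in> cocycles M (n + 1)" "v \<in> mdeg_part M n"
    "a \<odot> u \<oplus> mdifferential M v = \<zero>"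
proof -
  obtain u v where "z = Node (u, v)" using assms by (auto simp: cocycles_def)
  then show ?thesis using that assms kos_cocycle by simp
qed

text \<open>The stretch H^n(M) \<rightarrow> H^n(K(M; a)) \<rightarrow> H^(n+1)(M) of the long exact
  sequence, whose second map lands in the kernel of a: both ends contribute nothing.\<close>

lemma kos_exact:
  assumes a: "a \<in> deg_part A 0" and n: "cocycles M n \<subseteq> coboundaries M n"
    and inj: "\<And>u. u \<in> cocycles M (n + 1) \<Longrightarrow> a \<odot> u \<in> coboundaries M (n + 1) \<Longrightarrow> u \<in> coboundaries M (n + 1)"
  shows "cocycles (kos A M a) n \<subseteq> coboundaries (kos A M a) n"
proof
  fix z assume "z \<in> cocycles (kos A M a) n"
  then obtain u v where z: "z = Node (u, v)" and u: "u \<in> cocycles M (n + 1)" and v: "v \<in> mdeg_part M n"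
    and e: "a \<odot> u \<oplus> mdifferential M v = \<zero>" by (rule kos_cocycleE)
  note uc = cocycle_closed[OF u] and vc = gr_closed[OF v]
  have "a \<odot> u = mdifferential M (\<ominus> v)"
    using M.minus_equality[OF e] uc vc a by (simp add: d_neg d_closed)
  then have "a \<odot> u \<in> coboundaries M (n + 1)" unfolding coboundaries_def using gr_neg[OF v] by simp
  then have "u \<in> coboundaries M (n + 1)" by (rule inj[OF u])
  then obtain p where p: "p \<in> mdeg_part M n" "u = mdifferential M p" unfolding coboundaries_def by auto
  note pc = gr_closed[OF p(1)]
  \<comment> \<open>Subtracting the boundary of (-p, 0) from (u, v) clears the first component and
    leaves the cocycle v + ap in the second.\<close>
  let ?w = "v \<oplus> a \<odot> p"
  have "?w \<in> cocycles M n"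
    using e p v a pc vc M.a_comm by (simp add: cocycles_def gr_add gr_smult d_add d_smult d_closed)
  then obtain q where q: "q \<in> mdeg_part M (n - 1)" "?w = mdifferential M q"
    using n unfolding coboundaries_def by blast
  have "v = a \<odot> (\<ominus> p) \<oplus> ?w"
    using a pc vc by (simp add: smult_r_minus M.a_comm[of v] M.r_neg1)
  moreover have "u = \<ominus> mdifferential M (\<ominus> p)" using p pc by (simp add: d_neg d_closed)
  ultimately show "z \<in> coboundaries (kos A M a) n"
    unfolding z kos_coboundary using gr_neg[OF p(1)] q by metis
qed

lemma kos_incl_cocycle:
  "a \<in> deg_part A 0 \<Longrightarrow> u \<in> cocycles M n \<Longrightarrow> Node (\<zero>, u) \<in> cocycles (kos A M a) n"
  unfolding kos_cocycle using submodule_zero[OF cocycle_submodule] smult_r_null[of a] by (simp add: cocycles_def)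

text \<open>Injectivity of H^n(M)/a H^n(M) \<rightarrow> H^n(K(M; a)): if (0, u) is the boundary of
  (p, q), then dp = 0 and u - ap = dq.\<close>

lemma kos_incl_coboundary:
  assumes a: "a \<in> deg_part A 0" and u: "u \<in> cocycles M n"
    and "Node (\<zero>, u) \<in> coboundaries (kos A M a) n"
  shows "\<exists>p\<in>cocycles M n. u \<ominus> a \<odot> p \<in> coboundaries M n"
proof -
  obtain p q where p: "p \<in> mdeg_part M n" and q: "q \<in> mdeg_part M (n - 1)"
    and e: "\<zero> = \<ominus> mdifferential M p" "u = a \<odot> p \<oplus> mdifferential M q"
    using assms(3) unfolding kos_coboundary by blast
  note pc = gr_closed[OF p] and qc = gr_closed[OF q]
  have "mdifferential M p = \<zero>"
    using e(1) neg_zero_iff[OF d_closed[OF pc]] by simp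
  then have "p \<in> cocycles M n" using p by (simp add: cocycles_def)
  moreover have "u \<ominus> a \<odot> p = mdifferential M q"
    unfolding e(2) using a pc qc d_closed
    by (simp add: a_minus_def M.a_comm[of "a \<odot> p"] M.a_assoc M.r_neg)
  then have "u \<ominus> a \<odot> p \<in> coboundaries M n" unfolding coboundaries_def using q by blast
  ultimately show ?thesis by blast
qed

lemma kos_incl_coboundaryI:
  assumes a: "a \<in> deg_part A 0" and u: "u \<in> coboundaries M n"
  shows "Node (\<zero>, u) \<in> coboundaries (kos A M a) n"
proof -
  obtain q where "q \<in> mdeg_part M (n - 1)" "u = mdifferential M q" using u unfolding coboundaries_def by blast
  moreover have "\<zero> = \<ominus> mdifferential M \<zero>" "u = a \<odot> \<zero> \<oplus> u"
    using smult_r_null[of a] a coboundary_closed[OF u] by simp_all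
  ultimately show ?thesis unfolding kos_coboundary using gr_zero by metis
qed

text \<open>The pair (0, au) is the boundary of (u, 0), as u is a cocycle; so a acts as zero on the
  image of H^n(M) in H^n(K(M; a)).\<close>

lemma kos_smult_incl_coboundary:
  assumes a: "a \<in> deg_part A 0" and u: "u \<in> cocycles M n"
  shows "Node (\<zero>, a \<odot> u) \<in> coboundaries (kos A M a) n"
proof -
  have "u \<in> mdeg_part M n" "\<zero> = \<ominus> mdifferential M u" "a \<odot> u = a \<odot> u \<oplus> mdifferential M \<zero>"
    using u a cocycle_closed[OF u] by (simp_all add: cocycles_def)
  then show ?thesis unfolding kos_coboundary using gr_zero by metis
qed

text \<open>The part of the long exact sequence that identifies the kernel of \<open>a\<close> on \<open>H\<^sup>n\<^sup>+\<^sup>1(M)\<close> with \<open>H\<^sup>n(K(M; a))\<close>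
  when \<open>H\<^sup>n(M) = 0\<close>.\<close>

lemma kos_kernel_lift:
  assumes a: "a \<in> deg_part A 0" and n: "cocycles M n \<subseteq> coboundaries M n"
    and u: "u \<in> cocycles M (n + 1)" and au: "a \<odot> u \<in> coboundaries M (n + 1)" and nu: "u \<notin> coboundaries M (n + 1)"
  shows "\<exists>z\<in>cocycles (kos A M a) n. z \<notin> coboundaries (kos A M a) n \<and>
    (\<forall>b\<in>deg_part A 0. b \<odot> u \<in> coboundaries M (n + 1) \<longrightarrow> b \<odot>\<^bsub>kos A M a\<^esub> z \<in> coboundaries (kos A M a) n)"
proof -
  obtain w where w: "w \<in> mdeg_part M n" "a \<odot> u = mdifferential M w"
    using au unfolding coboundaries_def by auto
  note uc = cocycle_closed[OF u] and wc = gr_closed[OF w(1)]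
  \<comment> \<open>Since au = dw, the pair (u, -w) is a cocycle over u.\<close>
  let ?z = "Node (u, \<ominus> w)"
  have z: "?z \<in> cocycles (kos A M a) n"
    unfolding kos_cocycle using u w wc by (simp add: gr_neg d_neg d_closed M.r_neg)
  have nz: "?z \<notin> coboundaries (kos A M a) n"
  proof
    assume "?z \<in> coboundaries (kos A M a) n"
    then obtain p where p: "p \<in> mdeg_part M n" "u = \<ominus> mdifferential M p" unfolding kos_coboundary by blast
    then have "u = mdifferential M (\<ominus> p)" using gr_closed by (simp add: d_neg)
    then have "u \<in> coboundaries M (n + 1)" unfolding coboundaries_def using gr_neg[OF p(1)] by simp
    then show False using nu by simp
  qed
  have "b \<odot>\<^bsub>kos A M a\<^esub> ?z \<in> coboundaries (kos A M a) n"
    if b: "b \<in> deg_part A 0" and bu: "b \<odot> u \<in> coboundaries M (n + 1)" for b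
  proof -
    interpret K: nest_cplx A "kos A M a" by (rule kos_cplx[OF a])
    obtain p where p: "p \<in> mdeg_part M n" "b \<odot> u = mdifferential M p"
      using bu unfolding coboundaries_def by auto
    note pc = gr_closed[OF p(1)]
    have bz: "b \<odot>\<^bsub>kos A M a\<^esub> ?z = Node (b \<odot> u, b \<odot> (\<ominus> w))" using b by (simp add: dg.grading_involution_deg0)
    have "Node (b \<odot> u, b \<odot> (\<ominus> w)) \<in> cocycles (kos A M a) n" using K.cocycle_smult[OF b z] bz by simp
    then have e: "a \<odot> (b \<odot> u) \<oplus> mdifferential M (b \<odot> (\<ominus> w)) = \<zero>" unfolding kos_cocycle by blast
    \<comment> \<open>Subtracting the boundary of (-p, 0) from bz leaves (0, y) with y a cocycle of
      degree n, and every such cocycle is a coboundary by assumption.\<close>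
    let ?y = "b \<odot> (\<ominus> w) \<oplus> a \<odot> p"
    have bw: "b \<odot> (\<ominus> w) \<in> mdeg_part M n" using b w gr_neg gr_smult by blast
    have "?y \<in> cocycles M n"
      using e p a b pc wc bw gr_closed[OF bw] M.a_comm[of "a \<odot> (b \<odot> u)"] uc
      by (simp add: cocycles_def gr_add gr_smult d_add d_smult d_closed d_neg)
    then obtain q where q: "q \<in> mdeg_part M (n - 1)" "?y = mdifferential M q"
      using n unfolding coboundaries_def by blast
    have "b \<odot> (\<ominus> w) = a \<odot> (\<ominus> p) \<oplus> ?y"
      using a b pc wc smult_r_minus[of a p] M.a_comm[of "b \<odot> (\<ominus> w)" "a \<odot> p"] M.r_neg1[of "a \<odot> p" "b \<odot> (\<ominus> w)"] by simp
    moreover have "b \<odot> u = \<ominus> mdifferential M (\<ominus> p)" using p pc by (simp add: d_neg d_closed)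
    ultimately show ?thesis unfolding bz kos_coboundary using gr_neg[OF p(1)] q by metis
  qed
  then show ?thesis using z nz by blast
qed

text \<open>Extension along H^n(M) \<rightarrow> H^n(K(M; a)) \<rightarrow> H^(n+1)(M), induced by u
  \<mapsto> (0, u) and (u, v) \<mapsto> u.\<close>

lemma kos_cohomology_noeth:
  assumes a: "a \<in> deg_part A 0"
    and n: "noeth_module (H0 A) (cohomology M n)" and n1: "noeth_module (H0 A) (cohomology M (n + 1))"
  shows "noeth_module (H0 A) (cohomology (kos A M a) n)"
proof -
  interpret K: nest_cplx A "kos A M a" by (rule kos_cplx[OF a])
  let ?i = "coh_map M n (kos A M a) n (\<lambda>u. Node (\<zero>, u))"
  \<comment> \<open>This projection anticommutes with the differentials, so the boundary of (p, q)
    goes to d(-p) rather than d(p); it still induces a map on cohomology.\<close>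
  let ?\<pi> = "\<lambda>z. case z of Node (u, v) \<Rightarrow> u | Leaf l \<Rightarrow> Leaf l"
  let ?p = "coh_map (kos A M a) n M (n + 1) ?\<pi>"
  have i: "?i (coh_class M n u) = coh_class (kos A M a) n (Node (\<zero>, u))" if "u \<in> cocycles M n" for u
    by (rule coh_map_class[OF cplx_axioms K.cplx_axioms])
      (use that kos_incl_cocycle[OF a] kos_incl_coboundaryI[OF a] in auto)
  have \<pi>: "?\<pi> z \<in> cocycles M (n + 1)" if "z \<in> cocycles (kos A M a) n" for z
    using that by (rule kos_cocycleE) simp
  have p: "?p (coh_class (kos A M a) n z) = coh_class M (n + 1) (?\<pi> z)" if "z \<in> cocycles (kos A M a) n" for z
  proof (rule coh_map_class[OF K.cplx_axioms cplx_axioms \<pi> _ _ that])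
    fix x assume "x \<in> coboundaries (kos A M a) n"
    then obtain p q where "x = mdifferential (kos A M a) (Node (p, q))" "p \<in> mdeg_part M n"
      unfolding coboundaries_def by auto
    then have "?\<pi> x = mdifferential M (\<ominus> p)" "\<ominus> p \<in> mdeg_part M n" using gr_closed gr_neg by (simp_all add: d_neg)
    then show "?\<pi> x \<in> coboundaries M (n + 1)" unfolding coboundaries_def by simp
  next
    fix x y assume "x \<in> cocycles (kos A M a) n" "y \<in> cocycles (kos A M a) n"
    then show "?\<pi> (x \<oplus>\<^bsub>kos A M a\<^esub> y) = ?\<pi> x \<oplus> ?\<pi> y" by (elim kos_cocycleE) simp
  qed
  show ?thesis
  proof (rule noeth_module_extension[OF n K.cohomology_module n1])
    show "module_hom (H0 A) (cohomology M n) (cohomology (kos A M a) n) ?i"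
      unfolding module_hom_def
    proof (intro conjI ballI)
      fix x X assume x: "x \<in> carrier (H0 A)" and "X \<in> carrier (cohomology M n)"
      then obtain u where u: "u \<in> cocycles M n" "X = coh_class M n u" using cohomologyE by blast
      note l = dg.H0_lift_closed[OF x]
      show "?i (x \<odot>\<^bsub>cohomology M n\<^esub> X) = x \<odot>\<^bsub>cohomology (kos A M a) n\<^esub> ?i X"
        unfolding u(2) smult_cohomology_lift[OF x u(1)] i[OF u(1)] i[OF cocycle_smult[OF l u(1)]]
          K.smult_cohomology_lift[OF x kos_incl_cocycle[OF a u(1)]]
        using l smult_r_null[of "H0_lift A x"] by (simp add: dg.grading_involution_deg0)
    next
      fix X Y assume "X \<in> carrier (cohomology M n)" "Y \<in> carrier (cohomology M n)"
      then obtain u v where u: "u \<in> cocycles M n" "X = coh_class M n u" and v: "v \<in> cocycles M n" "Y = coh_class M n v"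
        using cohomologyE by metis
      show "?i (X \<oplus>\<^bsub>cohomology M n\<^esub> Y) = ?i X \<oplus>\<^bsub>cohomology (kos A M a) n\<^esub> ?i Y"
        unfolding u(2) v(2) i[OF u(1)] i[OF v(1)]
          add_cohomology[OF cocycle_closed[OF u(1)] cocycle_closed[OF v(1)]] i[OF cocycle_add[OF u(1) v(1)]]
          K.add_cohomology[OF K.cocycle_closed[OF kos_incl_cocycle[OF a u(1)]] K.cocycle_closed[OF kos_incl_cocycle[OF a v(1)]]]
        by simp
    next
      fix X assume "X \<in> carrier (cohomology M n)"
      then show "?i X \<in> carrier (cohomology (kos A M a) n)"
        using i kos_incl_cocycle[OF a] K.coh_class_closed by (metis cohomologyE)
    qed
    show "module_hom (H0 A) (cohomology (kos A M a) n) (cohomology M (n + 1)) ?p"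
      unfolding module_hom_def
    proof (intro conjI ballI)
      fix x X assume x: "x \<in> carrier (H0 A)" and "X \<in> carrier (cohomology (kos A M a) n)"
      then obtain z where z: "z \<in> cocycles (kos A M a) n" "X = coh_class (kos A M a) n z" using K.cohomologyE by blast
      note l = dg.H0_lift_closed[OF x]
      have "?\<pi> (H0_lift A x \<odot>\<^bsub>kos A M a\<^esub> z) = H0_lift A x \<odot> ?\<pi> z"
        using z(1) by (rule kos_cocycleE) (use l in \<open>simp add: dg.grading_involution_deg0\<close>)
      then show "?p (x \<odot>\<^bsub>cohomology (kos A M a) n\<^esub> X) = x \<odot>\<^bsub>cohomology M (n + 1)\<^esub> ?p X"
        unfolding z(2) K.smult_cohomology_lift[OF x z(1)] p[OF z(1)] p[OF K.cocycle_smult[OF l z(1)]]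
          smult_cohomology_lift[OF x \<pi>[OF z(1)]] by simp
    next
      fix X Y assume "X \<in> carrier (cohomology (kos A M a) n)" "Y \<in> carrier (cohomology (kos A M a) n)"
      then obtain u v where u: "u \<in> cocycles (kos A M a) n" "X = coh_class (kos A M a) n u"
        and v: "v \<in> cocycles (kos A M a) n" "Y = coh_class (kos A M a) n v"
        using K.cohomologyE by metis
      have "?\<pi> (u \<oplus>\<^bsub>kos A M a\<^esub> v) = ?\<pi> u \<oplus> ?\<pi> v" using u(1) v(1) by (elim kos_cocycleE) simp
      then show "?p (X \<oplus>\<^bsub>cohomology (kos A M a) n\<^esub> Y) = ?p X \<oplus>\<^bsub>cohomology M (n + 1)\<^esub> ?p Y"
        unfolding u(2) v(2) K.add_cohomology[OF K.cocycle_closed[OF u(1)] K.cocycle_closed[OF v(1)]]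
          p[OF u(1)] p[OF v(1)] p[OF K.cocycle_add[OF u(1) v(1)]]
        using add_cohomology[OF cocycle_closed[OF \<pi>[OF u(1)]] cocycle_closed[OF \<pi>[OF v(1)]]] by simp
    next
      fix X assume "X \<in> carrier (cohomology (kos A M a) n)"
      then show "?p X \<in> carrier (cohomology M (n + 1))" using p \<pi> coh_class_closed by (metis K.cohomologyE)
    qed
    fix X assume "X \<in> carrier (cohomology (kos A M a) n)" and pX: "?p X = \<zero>\<^bsub>cohomology M (n + 1)\<^esub>"
    then obtain z where z: "z \<in> cocycles (kos A M a) n" "X = coh_class (kos A M a) n z" using K.cohomologyE by blast
    obtain u v where uv: "z = Node (u, v)" "u \<in> cocycles M (n + 1)" "v \<in> mdeg_part M n"
      "a \<odot> u \<oplus> mdifferential M v = \<zero>" using z(1) by (rule kos_cocycleE)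
    note uc = cocycle_closed[OF uv(2)] and vc = gr_closed[OF uv(3)]
    have "u \<in> coboundaries M (n + 1)"
      using pX p[OF z(1)] coh_class_zero_iff[OF uc] unfolding z(2) uv(1) by simp
    then obtain q where q: "q \<in> mdeg_part M n" "u = mdifferential M q" unfolding coboundaries_def by auto
    note qc = gr_closed[OF q(1)]
    \<comment> \<open>Exactness in the middle: u = dq is removed by the boundary of (-q, 0), so the
      class comes from the cocycle v + aq of M.\<close>
    let ?w = "v \<oplus> a \<odot> q"
    have w: "?w \<in> cocycles M n"
      using uv(4) q a uc vc qc M.a_comm uv(3) by (simp add: cocycles_def gr_add gr_smult d_add d_smult d_closed)
    have "Node (u, v) \<ominus>\<^bsub>kos A M a\<^esub> Node (\<zero>, ?w) = Node (u, \<ominus> (a \<odot> q))"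
      using uc vc qc a
      by (simp add: a_minus_def kos_a_inv M.minus_add M.r_neg1 M.a_assoc[symmetric] M.r_neg)
    moreover have "Node (u, \<ominus> (a \<odot> q)) \<in> coboundaries (kos A M a) n"
    proof -
      have "u = \<ominus> mdifferential M (\<ominus> q)" "\<ominus> (a \<odot> q) = a \<odot> (\<ominus> q) \<oplus> mdifferential M \<zero>"
        using q(2) qc a by (simp_all add: d_neg d_closed smult_r_minus)
      then show ?thesis unfolding kos_coboundary using gr_neg[OF q(1)] gr_zero by metis
    qed
    ultimately have "X = coh_class (kos A M a) n (Node (\<zero>, ?w))"
      unfolding z(2) uv(1) using K.coh_class_eq_iff[of "Node (u, v)" "Node (\<zero>, ?w)" n] uc vc cocycle_closed[OF w] by simp
    then show "X \<in> ?i ` carrier (cohomology M n)" using i[OF w] coh_class_closed[OF w] by (metis imageI)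
  qed
qed

end

section \<open>Localization maps of complexes\<close>

text \<open>With \<open>S = {1}\<close> these are isomorphisms in each degree.\<close>

locale loc_map = M: cplx A M + L: cplx A' L
  for A :: "'a dg_ring" and M :: "('a, 'm) dg_module" and A' :: "'b dg_ring" and L :: "('b, 'n) dg_module" +
  fixes \<phi> :: "'a \<Rightarrow> 'b" and S :: "'a set" and \<psi> :: "'m \<Rightarrow> 'n"
  assumes phi_closed: "a \<in> deg_part A 0 \<Longrightarrow> \<phi> a \<in> deg_part A' 0"
    and phi_mult: "a \<in> deg_part A 0 \<Longrightarrow> b \<in> deg_part A 0 \<Longrightarrow> \<phi> (a \<otimes>\<^bsub>A\<^esub> b) = \<phi> a \<otimes>\<^bsub>A'\<^esub> \<phi> b"
    and S_deg0: "s \<in> S \<Longrightarrow> s \<in> deg_part A 0"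
    and S_mult: "s \<in> S \<Longrightarrow> t \<in> S \<Longrightarrow> s \<otimes>\<^bsub>A\<^esub> t \<in> S"
    and psi_closed: "x \<in> carrier M \<Longrightarrow> \<psi> x \<in> carrier L"
    and psi_add: "x \<in> carrier M \<Longrightarrow> y \<in> carrier M \<Longrightarrow> \<psi> (x \<oplus>\<^bsub>M\<^esub> y) = \<psi> x \<oplus>\<^bsub>L\<^esub> \<psi> y"
    and psi_smult: "a \<in> deg_part A 0 \<Longrightarrow> x \<in> carrier M \<Longrightarrow> \<psi> (a \<odot>\<^bsub>M\<^esub> x) = \<phi> a \<odot>\<^bsub>L\<^esub> \<psi> x"
    and psi_d: "x \<in> carrier M \<Longrightarrow> \<psi> (mdifferential M x) = mdifferential L (\<psi> x)"
    and psi_gr: "x \<in> mdeg_part M n \<Longrightarrow> \<psi> x \<in> mdeg_part L n"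
    and psi_fraction: "l \<in> mdeg_part L n \<Longrightarrow> \<exists>s\<in>S. \<exists>x\<in>mdeg_part M n. \<phi> s \<odot>\<^bsub>L\<^esub> l = \<psi> x"
    and psi_kernel: "x \<in> mdeg_part M n \<Longrightarrow> \<psi> x = \<zero>\<^bsub>L\<^esub> \<Longrightarrow> \<exists>s\<in>S. s \<odot>\<^bsub>M\<^esub> x = \<zero>\<^bsub>M\<^esub>"
    and S_inj: "s \<in> S \<Longrightarrow> l \<in> mdeg_part L n \<Longrightarrow> \<phi> s \<odot>\<^bsub>L\<^esub> l = \<zero>\<^bsub>L\<^esub> \<Longrightarrow> l = \<zero>\<^bsub>L\<^esub>"
    and S_div: "s \<in> S \<Longrightarrow> l \<in> mdeg_part L n \<Longrightarrow> \<exists>l'\<in>mdeg_part L n. \<phi> s \<odot>\<^bsub>L\<^esub> l' = l"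
begin

lemma psi_zero: "\<psi> \<zero>\<^bsub>M\<^esub> = \<zero>\<^bsub>L\<^esub>"
  using psi_add[of "\<zero>\<^bsub>M\<^esub>" "\<zero>\<^bsub>M\<^esub>"] psi_closed[of "\<zero>\<^bsub>M\<^esub>"] by simp

lemma psi_neg: "x \<in> carrier M \<Longrightarrow> \<psi> (\<ominus>\<^bsub>M\<^esub> x) = \<ominus>\<^bsub>L\<^esub> \<psi> x"
  using psi_add[of "\<ominus>\<^bsub>M\<^esub> x" x] psi_zero psi_closed
  by (simp add: M.M.l_neg L.M.minus_equality)

lemma S_phi: "s \<in> S \<Longrightarrow> \<phi> s \<in> deg_part A' 0"
  using phi_closed S_deg0 by blast

lemma phi_smult_mult:
  "s \<in> S \<Longrightarrow> t \<in> S \<Longrightarrow> l \<in> carrier L \<Longrightarrow> \<phi> (s \<otimes>\<^bsub>A\<^esub> t) \<odot>\<^bsub>L\<^esub> l = \<phi> s \<odot>\<^bsub>L\<^esub> (\<phi> t \<odot>\<^bsub>L\<^esub> l)"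
  using phi_mult[of s t] S_deg0 S_phi L.smult_assoc1[of "\<phi> s" "\<phi> t" l] by simp

lemma phi_smult_comm:
  "a \<in> deg_part A 0 \<Longrightarrow> b \<in> deg_part A 0 \<Longrightarrow> l \<in> carrier L \<Longrightarrow>
    \<phi> a \<odot>\<^bsub>L\<^esub> (\<phi> b \<odot>\<^bsub>L\<^esub> l) = \<phi> b \<odot>\<^bsub>L\<^esub> (\<phi> a \<odot>\<^bsub>L\<^esub> l)"
  using phi_closed[of a] phi_closed[of b] L.smult_assoc1[of "\<phi> a" "\<phi> b" l] L.smult_assoc1[of "\<phi> b" "\<phi> a" l]
    L.R.m_comm[of "\<phi> a" "\<phi> b"] by simp

lemma psi_cocycle:
  assumes "u \<in> cocycles M n"
  shows "\<psi> u \<in> cocycles L n"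
proof -
  have u: "u \<in> mdeg_part M n" "mdifferential M u = \<zero>\<^bsub>M\<^esub>" using assms by (simp_all add: cocycles_def)
  then have "mdifferential L (\<psi> u) = \<zero>\<^bsub>L\<^esub>" using psi_d[OF M.gr_closed[OF u(1)]] psi_zero by simp
  then show ?thesis using psi_gr[OF u(1)] by (simp add: cocycles_def)
qed

lemma psi_coboundary:
  assumes "u \<in> coboundaries M n"
  shows "\<psi> u \<in> coboundaries L n"
proof -
  obtain p where p: "p \<in> mdeg_part M (n - 1)" "u = mdifferential M p" using assms unfolding coboundaries_def by blast
  then have "\<psi> u = mdifferential L (\<psi> p)" using psi_d[OF M.gr_closed] by simp
  then show ?thesis using psi_gr[OF p(1)] unfolding coboundaries_def by blast
qed

text \<open>S acts injectively and surjectively on each degree of L: if s z = d l and l = s l', then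
  s (z - d l') = 0, hence z = d l'.\<close>

lemma divide_coboundary:
  assumes s: "s \<in> S" and z: "z \<in> mdeg_part L n" and b: "\<phi> s \<odot>\<^bsub>L\<^esub> z \<in> coboundaries L n"
  shows "z \<in> coboundaries L n"
proof -
  obtain l where l: "l \<in> mdeg_part L (n - 1)" "\<phi> s \<odot>\<^bsub>L\<^esub> z = mdifferential L l"
    using b unfolding coboundaries_def by blast
  obtain l' where l': "l' \<in> mdeg_part L (n - 1)" "\<phi> s \<odot>\<^bsub>L\<^esub> l' = l" using S_div[OF s l(1)] by blast
  note zc = L.gr_closed[OF z] and lc = L.gr_closed[OF l'(1)] and sp = S_phi[OF s]
  have dl: "mdifferential L l' \<in> mdeg_part L n" using L.d_degree[OF l'(1)] by simp
  have "\<phi> s \<odot>\<^bsub>L\<^esub> (z \<ominus>\<^bsub>L\<^esub> mdifferential L l') = \<phi> s \<odot>\<^bsub>L\<^esub> z \<ominus>\<^bsub>L\<^esub> mdifferential L (\<phi> s \<odot>\<^bsub>L\<^esub> l')"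
    using zc lc sp by (simp add: a_minus_def L.smult_r_distr L.smult_r_minus L.d_closed L.d_smult)
  also have "\<dots> = \<zero>\<^bsub>L\<^esub>" using l(2) l'(2) zc sp L.d_closed[OF L.gr_closed[OF l(1)]] by (simp add: a_minus_def L.M.r_neg)
  finally have "z \<ominus>\<^bsub>L\<^esub> mdifferential L l' = \<zero>\<^bsub>L\<^esub>" using S_inj[OF s L.gr_diff[OF z dl]] by blast
  then have "z = mdifferential L l'"
    using zc L.gr_closed[OF dl] L.M.minus_equality[of z "\<ominus>\<^bsub>L\<^esub> mdifferential L l'"] by (simp add: a_minus_def)
  then show ?thesis using l'(1) unfolding coboundaries_def by blast
qed

text \<open>Exactness of localization: the kernel of H^n(M) \<rightarrow> H^n(L) is the S-torsion. A
  primitive of \<psi> u is a fraction; clearing its denominator costs one element of S, and lifting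
  the resulting identity from L to M costs another.\<close>

lemma psi_coboundary_iff:
  assumes u: "u \<in> cocycles M n"
  shows "\<psi> u \<in> coboundaries L n \<longleftrightarrow> (\<exists>s\<in>S. s \<odot>\<^bsub>M\<^esub> u \<in> coboundaries M n)"
proof
  note uc = M.cocycle_closed[OF u]
  have ug: "u \<in> mdeg_part M n" using u by (simp add: cocycles_def)
  assume "\<exists>s\<in>S. s \<odot>\<^bsub>M\<^esub> u \<in> coboundaries M n"
  then obtain s where s: "s \<in> S" "s \<odot>\<^bsub>M\<^esub> u \<in> coboundaries M n" by blast
  have "\<phi> s \<odot>\<^bsub>L\<^esub> \<psi> u \<in> coboundaries L n"
    using psi_coboundary[OF s(2)] psi_smult[OF S_deg0[OF s(1)] uc] by simp
  then show "\<psi> u \<in> coboundaries L n" by (rule divide_coboundary[OF s(1) psi_gr[OF ug]])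
next
  note uc = M.cocycle_closed[OF u]
  have ug: "u \<in> mdeg_part M n" using u by (simp add: cocycles_def)
  assume "\<psi> u \<in> coboundaries L n"
  then obtain l where l: "l \<in> mdeg_part L (n - 1)" "\<psi> u = mdifferential L l" unfolding coboundaries_def by blast
  obtain s x where s: "s \<in> S" and x: "x \<in> mdeg_part M (n - 1)" "\<phi> s \<odot>\<^bsub>L\<^esub> l = \<psi> x"
    using psi_fraction[OF l(1)] by blast
  note s0 = S_deg0[OF s] and xc = M.gr_closed[OF x(1)] and lc = L.gr_closed[OF l(1)]
  have dx: "mdifferential M x \<in> mdeg_part M n" using M.d_degree[OF x(1)] by simp
  have e: "\<psi> (s \<odot>\<^bsub>M\<^esub> u) = \<psi> (mdifferential M x)"
    using psi_smult[OF s0 uc] psi_d[OF xc] L.d_smult[OF S_phi[OF s] lc] l(2) x(2) by simp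
  have "\<psi> (s \<odot>\<^bsub>M\<^esub> u \<ominus>\<^bsub>M\<^esub> mdifferential M x) = \<zero>\<^bsub>L\<^esub>"
    using e uc xc s0 psi_closed by (simp add: a_minus_def psi_add psi_neg M.d_closed L.M.r_neg)
  then obtain t where t: "t \<in> S" "t \<odot>\<^bsub>M\<^esub> (s \<odot>\<^bsub>M\<^esub> u \<ominus>\<^bsub>M\<^esub> mdifferential M x) = \<zero>\<^bsub>M\<^esub>"
    using psi_kernel[OF M.gr_diff[OF M.gr_smult[OF s0 ug] dx]] by blast
  note t0 = S_deg0[OF t(1)]
  have "t \<odot>\<^bsub>M\<^esub> (s \<odot>\<^bsub>M\<^esub> u) \<oplus>\<^bsub>M\<^esub> \<ominus>\<^bsub>M\<^esub> (t \<odot>\<^bsub>M\<^esub> mdifferential M x) = \<zero>\<^bsub>M\<^esub>"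
    using t(2) t0 s0 uc M.d_closed[OF xc] by (simp add: a_minus_def M.smult_r_distr M.smult_r_minus)
  then have "t \<odot>\<^bsub>M\<^esub> (s \<odot>\<^bsub>M\<^esub> u) = mdifferential M (t \<odot>\<^bsub>M\<^esub> x)"
    using M.M.minus_equality[of "t \<odot>\<^bsub>M\<^esub> (s \<odot>\<^bsub>M\<^esub> u)" "\<ominus>\<^bsub>M\<^esub> (t \<odot>\<^bsub>M\<^esub> mdifferential M x)"]
      t0 s0 uc xc M.d_closed[OF xc] by (simp add: M.d_smult)
  then have "(t \<otimes>\<^bsub>A\<^esub> s) \<odot>\<^bsub>M\<^esub> u = mdifferential M (t \<odot>\<^bsub>M\<^esub> x)"
    using M.smult_assoc1[of t s u] t0 s0 uc by simp
  then have "(t \<otimes>\<^bsub>A\<^esub> s) \<odot>\<^bsub>M\<^esub> u \<in> coboundaries M n"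
    unfolding coboundaries_def using M.gr_smult[OF t0 x(1)] by blast
  then show "\<exists>s\<in>S. s \<odot>\<^bsub>M\<^esub> u \<in> coboundaries M n" using S_mult[OF t(1) s] by blast
qed

text \<open>Clearing the denominator of z gives some x whose differential vanishes only in L. A
  further t \<in> S kills dx, and tx is the cocycle sought.\<close>

lemma cocycle_fraction:
  assumes z: "z \<in> cocycles L n"
  shows "\<exists>s\<in>S. \<exists>u\<in>cocycles M n. \<phi> s \<odot>\<^bsub>L\<^esub> z = \<psi> u"
proof -
  have zg: "z \<in> mdeg_part L n" "mdifferential L z = \<zero>\<^bsub>L\<^esub>" using z by (simp_all add: cocycles_def)
  note zc = L.gr_closed[OF zg(1)]
  obtain s x where s: "s \<in> S" and x: "x \<in> mdeg_part M n" "\<phi> s \<odot>\<^bsub>L\<^esub> z = \<psi> x"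
    using psi_fraction[OF zg(1)] by blast
  note xc = M.gr_closed[OF x(1)]
  have "\<psi> (mdifferential M x) = \<zero>\<^bsub>L\<^esub>"
    using psi_d[OF xc] x(2) L.d_smult[OF S_phi[OF s] zc] zg(2) L.smult_r_null[of "\<phi> s"] S_phi[OF s] by simp
  then obtain t where t: "t \<in> S" "t \<odot>\<^bsub>M\<^esub> mdifferential M x = \<zero>\<^bsub>M\<^esub>"
    using psi_kernel[OF M.d_degree[OF x(1)]] by blast
  have "t \<odot>\<^bsub>M\<^esub> x \<in> cocycles M n"
    using t S_deg0[OF t(1)] x(1) xc by (simp add: cocycles_def M.gr_smult M.d_smult)
  moreover have "\<phi> (t \<otimes>\<^bsub>A\<^esub> s) \<odot>\<^bsub>L\<^esub> z = \<psi> (t \<odot>\<^bsub>M\<^esub> x)"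
    using phi_smult_mult[OF t(1) s zc] x(2) psi_smult[OF S_deg0[OF t(1)] xc] by simp
  ultimately show ?thesis using S_mult[OF t(1) s] by blast
qed

text \<open>This direction serves the boundedness and the starting degree of localized cohomology,
  and, for S = {1}, the independence from the order of Koszul factors.\<close>

lemma exact_localize:
  assumes "cocycles M n \<subseteq> coboundaries M n"
  shows "cocycles L n \<subseteq> coboundaries L n"
proof
  fix z assume z: "z \<in> cocycles L n"
  obtain s u where s: "s \<in> S" and u: "u \<in> cocycles M n" "\<phi> s \<odot>\<^bsub>L\<^esub> z = \<psi> u" using cocycle_fraction[OF z] by blast
  have "\<psi> u \<in> coboundaries L n" using psi_coboundary u(1) assms by blast
  then show "z \<in> coboundaries L n" using divide_coboundary[OF s, of z n] u(2) z by (simp add: cocycles_def)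
qed

end

text \<open>The lifts \<open>a'\<close> and \<open>\<phi> a\<close> may differ by a boundary, which acts null-homotopically through some \<open>h\<close>;
  the map \<open>(x, y) \<mapsto> (\<psi> x, \<psi> y - h (\<psi> x))\<close> absorbs the difference.\<close>

theorem loc_map_kos:
  fixes M :: "('a, 'm nest) dg_module" and L :: "('b, 'n nest) dg_module"
  assumes "loc_map A M A' L \<phi> S \<psi>" and a: "a \<in> deg_part A 0" and a': "a' \<in> deg_part A' 0"
    and aa: "a' \<ominus>\<^bsub>A'\<^esub> \<phi> a \<in> boundary_ideal A'"
  shows "\<exists>\<psi>'. loc_map A (kos A M a) A' (kos A' L a') \<phi> S \<psi>'"
proof -
  interpret loc_map A M A' L \<phi> S \<psi> by fact
  interpret M: nest_cplx A M by unfold_locales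
  interpret L: nest_cplx A' L by unfold_locales
  interpret KM: nest_cplx A "kos A M a" by (rule M.kos_cplx[OF a])
  interpret KL: nest_cplx A' "kos A' L a'" by (rule L.kos_cplx[OF a'])
  let ?c = "a' \<ominus>\<^bsub>A'\<^esub> \<phi> a"
  obtain h where h: "nullhomotopy A' L ?c h" using L.ex_nullhomotopy[OF aa] by blast
  have hc: "\<And>x. x \<in> carrier L \<Longrightarrow> h x \<in> carrier L"
    and ha: "\<And>x y. x \<in> carrier L \<Longrightarrow> y \<in> carrier L \<Longrightarrow> h (x \<oplus>\<^bsub>L\<^esub> y) = h x \<oplus>\<^bsub>L\<^esub> h y"
    and hs: "\<And>b x. b \<in> deg_part A' 0 \<Longrightarrow> x \<in> carrier L \<Longrightarrow> h (b \<odot>\<^bsub>L\<^esub> x) = b \<odot>\<^bsub>L\<^esub> h x"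
    and hg: "\<And>n x. x \<in> mdeg_part L n \<Longrightarrow> h x \<in> mdeg_part L (n - 1)"
    and hd: "\<And>x. x \<in> carrier L \<Longrightarrow> mdifferential L (h x) \<oplus>\<^bsub>L\<^esub> h (mdifferential L x) = ?c \<odot>\<^bsub>L\<^esub> x"
    using h unfolding nullhomotopy_def by blast+
  have h0: "h \<zero>\<^bsub>L\<^esub> = \<zero>\<^bsub>L\<^esub>" using ha[of "\<zero>\<^bsub>L\<^esub>" "\<zero>\<^bsub>L\<^esub>"] hc[of "\<zero>\<^bsub>L\<^esub>"] by simp
  have hn: "h (\<ominus>\<^bsub>L\<^esub> x) = \<ominus>\<^bsub>L\<^esub> h x" if x: "x \<in> carrier L" for x
    using ha[of "\<ominus>\<^bsub>L\<^esub> x" x] x hc h0 by (simp add: L.M.l_neg L.M.minus_equality)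
  have hg': "\<And>n x. x \<in> mdeg_part L (n + 1) \<Longrightarrow> h x \<in> mdeg_part L n" using hg by fastforce
  note c0 = L.dg.boundary_ideal_deg0[OF aa] and pa = phi_closed[OF a]
  have a'_eq: "a' = \<phi> a \<oplus>\<^bsub>A'\<^esub> ?c"
    using L.dg.gr_closed[OF a'] L.dg.gr_closed[OF pa] by (simp add: a_minus_def L.dg.a_comm[of a'] L.dg.r_neg1 L.dg.r_neg2)
  \<comment> \<open>The actions of a' and of \<phi> a differ by dh + hd. In the differential of
    (\<psi> x, \<psi> y - h(\<psi> x)) the summand dh is cancelled by the twist; the summand hd is
    what the twist contributes when applied to the first component of the differential of (x,
    y).\<close>
  have a'x: "a' \<odot>\<^bsub>L\<^esub> x = \<phi> a \<odot>\<^bsub>L\<^esub> x \<oplus>\<^bsub>L\<^esub> (mdifferential L (h x) \<oplus>\<^bsub>L\<^esub> h (mdifferential L x))"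
    if x: "x \<in> carrier L" for x
    using L.smult_l_distr[of "\<phi> a" ?c x] pa c0 x hd[OF x] a'_eq by simp
  define \<psi>' where "\<psi>' = (\<lambda>z. case z of Node (x, y) \<Rightarrow> Node (\<psi> x, \<psi> y \<ominus>\<^bsub>L\<^esub> h (\<psi> x)) | Leaf l \<Rightarrow> Node (\<zero>\<^bsub>L\<^esub>, \<zero>\<^bsub>L\<^esub>))"
  have psi': "\<psi>' (Node (x, y)) = Node (\<psi> x, \<psi> y \<ominus>\<^bsub>L\<^esub> h (\<psi> x))" for x y by (simp add: \<psi>'_def)
  note cl = psi_closed hc L.d_closed M.d_closed
  show ?thesis
  proof (intro exI loc_map.intro loc_map_axioms.intro)
    show "cplx A (kos A M a)" by (rule KM.cplx_axioms)
    show "cplx A' (kos A' L a')" by (rule KL.cplx_axioms)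
    show "b \<in> deg_part A 0 \<Longrightarrow> \<phi> b \<in> deg_part A' 0" for b by (rule phi_closed)
    show "b \<in> deg_part A 0 \<Longrightarrow> c \<in> deg_part A 0 \<Longrightarrow> \<phi> (b \<otimes>\<^bsub>A\<^esub> c) = \<phi> b \<otimes>\<^bsub>A'\<^esub> \<phi> c" for b c by (rule phi_mult)
    show "s \<in> S \<Longrightarrow> s \<in> deg_part A 0" for s by (rule S_deg0)
    show "s \<in> S \<Longrightarrow> t \<in> S \<Longrightarrow> s \<otimes>\<^bsub>A\<^esub> t \<in> S" for s t by (rule S_mult)
    show "\<psi>' x \<in> carrier (kos A' L a')" if "x \<in> carrier (kos A M a)" for x
      using that by (auto simp: psi' cl)
    show "\<psi>' (x \<oplus>\<^bsub>kos A M a\<^esub> y) = \<psi>' x \<oplus>\<^bsub>kos A' L a'\<^esub> \<psi>' y"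
      if "x \<in> carrier (kos A M a)" "y \<in> carrier (kos A M a)" for x y
      using that by (auto simp: psi' cl psi_add ha a_minus_def L.M.minus_add L.M.a_ac)
    show "\<psi>' (b \<odot>\<^bsub>kos A M a\<^esub> x) = \<phi> b \<odot>\<^bsub>kos A' L a'\<^esub> \<psi>' x"
      if b: "b \<in> deg_part A 0" and "x \<in> carrier (kos A M a)" for b x
      using that phi_closed[OF b] by (auto simp: psi' cl psi_smult hs a_minus_def L.smult_r_distr L.smult_r_minus
          M.dg.grading_involution_deg0 L.dg.grading_involution_deg0)
    show "\<psi>' (mdifferential (kos A M a) x) = mdifferential (kos A' L a') (\<psi>' x)"
      if xc: "x \<in> carrier (kos A M a)" for x
    proof -
      obtain p q where x: "x = Node (p, q)" "p \<in> carrier M" "q \<in> carrier M" using xc by auto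
      let ?P = "\<psi> p" and ?Q = "\<psi> q"
      have P: "?P \<in> carrier L" "?Q \<in> carrier L" using x psi_closed by simp_all
      note dc = L.d_closed[OF P(1)] L.d_closed[OF P(2)] hc[OF P(1)] hc[OF L.d_closed[OF P(1)]] L.d_closed[OF hc[OF P(1)]]
      have sc: "\<phi> a \<odot>\<^bsub>L\<^esub> ?P \<in> carrier L" using pa P by simp
      have "a' \<odot>\<^bsub>L\<^esub> ?P \<oplus>\<^bsub>L\<^esub> mdifferential L (?Q \<ominus>\<^bsub>L\<^esub> h ?P)
          = (mdifferential L (h ?P) \<oplus>\<^bsub>L\<^esub> \<ominus>\<^bsub>L\<^esub> mdifferential L (h ?P)) \<oplus>\<^bsub>L\<^esub>
            (\<phi> a \<odot>\<^bsub>L\<^esub> ?P \<oplus>\<^bsub>L\<^esub> (mdifferential L ?Q \<oplus>\<^bsub>L\<^esub> h (mdifferential L ?P)))"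
        unfolding a'x[OF P(1)] using P dc sc by (simp add: a_minus_def L.d_add L.d_neg L.M.a_ac)
      also have "\<dots> = \<phi> a \<odot>\<^bsub>L\<^esub> ?P \<oplus>\<^bsub>L\<^esub> (mdifferential L ?Q \<oplus>\<^bsub>L\<^esub> h (mdifferential L ?P))"
        using P dc sc by (simp add: L.M.r_neg)
      finally have k: "a' \<odot>\<^bsub>L\<^esub> ?P \<oplus>\<^bsub>L\<^esub> mdifferential L (?Q \<ominus>\<^bsub>L\<^esub> h ?P) =
          \<phi> a \<odot>\<^bsub>L\<^esub> ?P \<oplus>\<^bsub>L\<^esub> (mdifferential L ?Q \<oplus>\<^bsub>L\<^esub> h (mdifferential L ?P))" .
      show ?thesis
        using x a P dc sc k by (simp add: psi' psi_neg psi_d M.d_closed psi_add psi_smult hn a_minus_def L.M.a_assoc)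
    qed
    show "\<psi>' x \<in> mdeg_part (kos A' L a') n" if "x \<in> mdeg_part (kos A M a) n" for x n
      using that by (auto simp: psi' psi_gr L.gr_diff hg')
    show "\<exists>s\<in>S. \<exists>x\<in>mdeg_part (kos A M a) n. \<phi> s \<odot>\<^bsub>kos A' L a'\<^esub> l = \<psi>' x"
      if lg: "l \<in> mdeg_part (kos A' L a') n" for l n
    proof -
      obtain p q where l: "l = Node (p, q)" "p \<in> mdeg_part L (n + 1)" "q \<in> mdeg_part L n" using lg by auto
      note pc = L.gr_closed[OF l(2)] and qc = L.gr_closed[OF l(3)]
      obtain s x where s: "s \<in> S" and x: "x \<in> mdeg_part M (n + 1)" "\<phi> s \<odot>\<^bsub>L\<^esub> p = \<psi> x"
        using psi_fraction[OF l(2)] by blast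
      \<comment> \<open>Since \<open>\<psi>'\<close> subtracts h of the first component, the
        fraction to be cleared in the second component is q + hp. The product st serves as common
        denominator.\<close>
      have "q \<oplus>\<^bsub>L\<^esub> h p \<in> mdeg_part L n" by (rule L.gr_add[OF l(3) hg'[OF l(2)]])
      from psi_fraction[OF this] obtain t y where t: "t \<in> S" and y: "y \<in> mdeg_part M n" "\<phi> t \<odot>\<^bsub>L\<^esub> (q \<oplus>\<^bsub>L\<^esub> h p) = \<psi> y"
        by blast
      note s0 = S_deg0[OF s] and t0 = S_deg0[OF t] and sp = S_phi[OF s] and tp = S_phi[OF t]
      have stp: "\<phi> (s \<otimes>\<^bsub>A\<^esub> t) \<in> deg_part A' 0" by (rule S_phi[OF S_mult[OF s t]])
      have 1: "\<phi> (s \<otimes>\<^bsub>A\<^esub> t) \<odot>\<^bsub>L\<^esub> p = \<psi> (t \<odot>\<^bsub>M\<^esub> x)"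
        using phi_smult_mult[OF s t pc] phi_smult_comm[OF s0 t0 pc] x(2) psi_smult[OF t0 M.gr_closed[OF x(1)]] by simp
      have 2: "\<phi> (s \<otimes>\<^bsub>A\<^esub> t) \<odot>\<^bsub>L\<^esub> (q \<oplus>\<^bsub>L\<^esub> h p) = \<psi> (s \<odot>\<^bsub>M\<^esub> y)"
        using phi_smult_mult[OF s t, of "q \<oplus>\<^bsub>L\<^esub> h p"] y(2) psi_smult[OF s0 M.gr_closed[OF y(1)]] qc hc[OF pc] by simp
      have "\<psi> (s \<odot>\<^bsub>M\<^esub> y) \<ominus>\<^bsub>L\<^esub> h (\<psi> (t \<odot>\<^bsub>M\<^esub> x)) = \<phi> (s \<otimes>\<^bsub>A\<^esub> t) \<odot>\<^bsub>L\<^esub> q"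
        unfolding 1[symmetric] 2[symmetric] using stp pc qc hc[OF pc]
        by (simp add: hs L.smult_r_distr a_minus_def L.M.a_assoc L.M.r_neg)
      then have "\<phi> (s \<otimes>\<^bsub>A\<^esub> t) \<odot>\<^bsub>kos A' L a'\<^esub> l = \<psi>' (Node (t \<odot>\<^bsub>M\<^esub> x, s \<odot>\<^bsub>M\<^esub> y))"
        using 1 l(1) stp by (simp add: psi' L.dg.grading_involution_deg0)
      moreover have "Node (t \<odot>\<^bsub>M\<^esub> x, s \<odot>\<^bsub>M\<^esub> y) \<in> mdeg_part (kos A M a) n"
        using x(1) y(1) s0 t0 by (simp add: M.gr_smult)
      ultimately show ?thesis using S_mult[OF s t] by blast
    qed
    show "\<exists>s\<in>S. s \<odot>\<^bsub>kos A M a\<^esub> x = \<zero>\<^bsub>kos A M a\<^esub>"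
      if xg: "x \<in> mdeg_part (kos A M a) n" and z: "\<psi>' x = \<zero>\<^bsub>kos A' L a'\<^esub>" for x n
    proof -
      obtain p q where x: "x = Node (p, q)" "p \<in> mdeg_part M (n + 1)" "q \<in> mdeg_part M n" using xg by auto
      note pc = M.gr_closed[OF x(2)] and qc = M.gr_closed[OF x(3)]
      have pq: "\<psi> p = \<zero>\<^bsub>L\<^esub> \<and> \<psi> q \<ominus>\<^bsub>L\<^esub> h (\<psi> p) = \<zero>\<^bsub>L\<^esub>" using z x(1) by (auto simp: psi' h0)
      then have p0: "\<psi> p = \<zero>\<^bsub>L\<^esub>" by blast
      with pq have q0: "\<psi> q = \<zero>\<^bsub>L\<^esub>" using h0 psi_closed[OF qc] L.minus_zero by (simp add: a_minus_def)
      obtain s where s: "s \<in> S" "s \<odot>\<^bsub>M\<^esub> p = \<zero>\<^bsub>M\<^esub>" using psi_kernel[OF x(2) p0] by blast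
      obtain t where t: "t \<in> S" "t \<odot>\<^bsub>M\<^esub> q = \<zero>\<^bsub>M\<^esub>" using psi_kernel[OF x(3) q0] by blast
      note s0 = S_deg0[OF s(1)] and t0 = S_deg0[OF t(1)]
      have "(s \<otimes>\<^bsub>A\<^esub> t) \<odot>\<^bsub>M\<^esub> p = \<zero>\<^bsub>M\<^esub>" "(s \<otimes>\<^bsub>A\<^esub> t) \<odot>\<^bsub>M\<^esub> q = \<zero>\<^bsub>M\<^esub>"
        using M.smult_assoc1[of t s p] M.smult_assoc1[of s t q] M.R.m_comm[of s t] s t s0 t0 pc qc
          M.smult_r_null[of s] M.smult_r_null[of t] by simp_all
      then have "(s \<otimes>\<^bsub>A\<^esub> t) \<odot>\<^bsub>kos A M a\<^esub> x = \<zero>\<^bsub>kos A M a\<^esub>"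
        using x(1) S_deg0[OF S_mult[OF s(1) t(1)]] by (simp add: M.dg.grading_involution_deg0)
      then show ?thesis using S_mult[OF s(1) t(1)] by blast
    qed
    show "l = \<zero>\<^bsub>kos A' L a'\<^esub>"
      if s: "s \<in> S" and lg: "l \<in> mdeg_part (kos A' L a') n" and z: "\<phi> s \<odot>\<^bsub>kos A' L a'\<^esub> l = \<zero>\<^bsub>kos A' L a'\<^esub>" for s l n
    proof -
      obtain p q where l: "l = Node (p, q)" "p \<in> mdeg_part L (n + 1)" "q \<in> mdeg_part L n" using lg by auto
      have "\<phi> s \<odot>\<^bsub>L\<^esub> p = \<zero>\<^bsub>L\<^esub>" "\<phi> s \<odot>\<^bsub>L\<^esub> q = \<zero>\<^bsub>L\<^esub>"
        using z l(1) S_phi[OF s] by (simp_all add: L.dg.grading_involution_deg0)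
      then show ?thesis using S_inj[OF s l(2)] S_inj[OF s l(3)] l(1) by simp
    qed
    show "\<exists>l'\<in>mdeg_part (kos A' L a') n. \<phi> s \<odot>\<^bsub>kos A' L a'\<^esub> l' = l"
      if s: "s \<in> S" and lg: "l \<in> mdeg_part (kos A' L a') n" for s l n
    proof -
      obtain p q where l: "l = Node (p, q)" "p \<in> mdeg_part L (n + 1)" "q \<in> mdeg_part L n" using lg by auto
      obtain p' where p': "p' \<in> mdeg_part L (n + 1)" "\<phi> s \<odot>\<^bsub>L\<^esub> p' = p" using S_div[OF s l(2)] by blast
      obtain q' where q': "q' \<in> mdeg_part L n" "\<phi> s \<odot>\<^bsub>L\<^esub> q' = q" using S_div[OF s l(3)] by blast
      show ?thesis
        by (rule bexI[of _ "Node (p', q')"]) (use p' q' l S_phi[OF s] in \<open>simp_all add: L.dg.grading_involution_deg0\<close>)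
    qed
  qed
qed

text \<open>The isomorphism exchanges the two Koszul generators; they anticommute, whence the sign.\<close>

lemma (in nest_cplx) kos_swap:
  assumes a: "a \<in> deg_part A 0" and b: "b \<in> deg_part A 0"
  shows "\<exists>\<sigma>. loc_map A (kos A (kos A M a) b) A (kos A (kos A M b) a) id {\<one>\<^bsub>A\<^esub>} \<sigma>"
proof -
  interpret Ka: nest_cplx A "kos A M a" by (rule kos_cplx[OF a])
  interpret Kb: nest_cplx A "kos A M b" by (rule kos_cplx[OF b])
  interpret Kab: nest_cplx A "kos A (kos A M a) b" by (rule Ka.kos_cplx[OF b])
  interpret Kba: nest_cplx A "kos A (kos A M b) a" by (rule Kb.kos_cplx[OF a])
  define \<sigma> where "\<sigma> = (\<lambda>z. case z of Node (Node (p, q), Node (r, s)) \<Rightarrow> Node (Node (\<ominus> p, r), Node (q, s)) | _ \<Rightarrow> z)"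
  have sg: "\<sigma> (Node (Node (p, q), Node (r, s))) = Node (Node (\<ominus> p, r), Node (q, s))" for p q r s
    by (simp add: \<sigma>_def)
  note one = dg.deg_one and i1 = dg.grading_involution_deg0[OF dg.deg_one]
  show ?thesis
  proof (intro exI loc_map.intro loc_map_axioms.intro)
    show "cplx A (kos A (kos A M a) b)" by (rule Kab.cplx_axioms)
    show "cplx A (kos A (kos A M b) a)" by (rule Kba.cplx_axioms)
    show "\<sigma> x \<in> carrier (kos A (kos A M b) a)" if "x \<in> carrier (kos A (kos A M a) b)" for x
      using that by (auto simp: sg)
    show "\<sigma> (x \<oplus>\<^bsub>kos A (kos A M a) b\<^esub> y) = \<sigma> x \<oplus>\<^bsub>kos A (kos A M b) a\<^esub> \<sigma> y"
      if "x \<in> carrier (kos A (kos A M a) b)" "y \<in> carrier (kos A (kos A M a) b)" for x y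
      using that by (auto simp: sg M.minus_add)
    show "\<sigma> (c \<odot>\<^bsub>kos A (kos A M a) b\<^esub> x) = id c \<odot>\<^bsub>kos A (kos A M b) a\<^esub> \<sigma> x"
      if "c \<in> deg_part A 0" "x \<in> carrier (kos A (kos A M a) b)" for c x
      using that by (auto simp: sg dg.grading_involution_deg0 smult_r_minus)
    show "\<sigma> (mdifferential (kos A (kos A M a) b) x) = mdifferential (kos A (kos A M b) a) (\<sigma> x)"
      if "x \<in> carrier (kos A (kos A M a) b)" for x
      using that a b by (auto simp: sg dg.grading_involution_deg0 smult_r_minus kos_a_inv d_closed d_neg
          M.minus_add M.a_ac)
    show "\<sigma> x \<in> mdeg_part (kos A (kos A M b) a) n" if "x \<in> mdeg_part (kos A (kos A M a) b) n" for x n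
      using that by (auto simp: sg gr_neg)
    show "\<exists>s\<in>{\<one>\<^bsub>A\<^esub>}. \<exists>x\<in>mdeg_part (kos A (kos A M a) b) n. id s \<odot>\<^bsub>kos A (kos A M b) a\<^esub> l = \<sigma> x"
      if lg: "l \<in> mdeg_part (kos A (kos A M b) a) n" for l n
    proof -
      obtain p q r s where l: "l = Node (Node (p, r), Node (q, s))" "p \<in> mdeg_part M (n + 1 + 1)" "r \<in> mdeg_part M (n + 1)"
        "q \<in> mdeg_part M (n + 1)" "s \<in> mdeg_part M n" using lg by auto
      have "id \<one>\<^bsub>A\<^esub> \<odot>\<^bsub>kos A (kos A M b) a\<^esub> l = \<sigma> (Node (Node (\<ominus> p, q), Node (r, s)))"
        using l gr_closed smult_one by (simp add: sg i1)
      moreover have "Node (Node (\<ominus> p, q), Node (r, s)) \<in> mdeg_part (kos A (kos A M a) b) n"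
        using l gr_neg by simp
      ultimately show ?thesis by blast
    qed
    show "\<exists>s\<in>{\<one>\<^bsub>A\<^esub>}. s \<odot>\<^bsub>kos A (kos A M a) b\<^esub> x = \<zero>\<^bsub>kos A (kos A M a) b\<^esub>"
      if "x \<in> mdeg_part (kos A (kos A M a) b) n" "\<sigma> x = \<zero>\<^bsub>kos A (kos A M b) a\<^esub>" for x n
      using that gr_closed smult_one neg_zero_iff by (auto simp: sg i1)
    show "l = \<zero>\<^bsub>kos A (kos A M b) a\<^esub>"
      if "s \<in> {\<one>\<^bsub>A\<^esub>}" "l \<in> mdeg_part (kos A (kos A M b) a) n" "id s \<odot>\<^bsub>kos A (kos A M b) a\<^esub> l = \<zero>\<^bsub>kos A (kos A M b) a\<^esub>" for s l n
      using that gr_closed smult_one by (auto simp: i1)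
    show "\<exists>l'\<in>mdeg_part (kos A (kos A M b) a) n. id s \<odot>\<^bsub>kos A (kos A M b) a\<^esub> l' = l"
      if "s \<in> {\<one>\<^bsub>A\<^esub>}" "l \<in> mdeg_part (kos A (kos A M b) a) n" for s l n
      using that gr_closed smult_one by (intro bexI[of _ l]) (auto simp: i1)
  qed (use one dg.gr_closed in auto)
qed

section \<open>Regular sequences\<close>

definition exact_at :: "('a, 'm) dg_module \<Rightarrow> int \<Rightarrow> bool" where
  "exact_at M n \<longleftrightarrow> cocycles M n \<subseteq> coboundaries M n"

text \<open>Asserts that the least degree with nonzero cohomology exists and is i; the number
  \<open>dg_inf M\<close> alone would not say so.\<close>

definition inf_at :: "('a, 'm) dg_module \<Rightarrow> int \<Rightarrow> bool" where
  "inf_at M i \<longleftrightarrow> (\<forall>j<i. exact_at M j) \<and> \<not> exact_at M i"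

text \<open>The class in which the recursion for regular sequences stays: it is closed under
  \<open>kos\<close> for lifts of elements of H^0(A), and its cohomology is noetherian, as
  Nakayama's lemma and the arguments with associated primes require.\<close>

definition fin_cplx :: "'a dg_ring \<Rightarrow> ('a, 'm nest) dg_module \<Rightarrow> bool" where
  "fin_cplx A M \<longleftrightarrow> nest_cplx A M \<and> (\<forall>n. noeth_module (H0 A) (cohomology M n))"

definition koszul_seq :: "'a dg_ring \<Rightarrow> ('a, 'm nest) dg_module \<Rightarrow> 'a set list \<Rightarrow> ('a, 'm nest) dg_module" where
  "koszul_seq A M xs = foldl (\<lambda>N x. kos A N (H0_lift A x)) M xs"

lemma koszul_seq_simps [simp]:
  "koszul_seq A M [] = M"
  "koszul_seq A M (x # xs) = koszul_seq A (kos A M (H0_lift A x)) xs"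
  "koszul_seq A M (xs @ ys) = koszul_seq A (koszul_seq A M xs) ys"
  by (simp_all add: koszul_seq_def)

lemma regular_seq_nest_Cons:
  "regular_seq_nest A m M (x # xs) \<longleftrightarrow> regular_elem A m M x \<and> regular_seq_nest A m (kos A M (H0_lift A x)) xs"
  by (simp add: kos_def)

lemma regular_seq_nest_append:
  "regular_seq_nest A m M (xs @ ys) \<longleftrightarrow>
    regular_seq_nest A m M xs \<and> regular_seq_nest A m (koszul_seq A M xs) ys"
  by (induction xs arbitrary: M) (simp_all add: regular_seq_nest_Cons del: regular_seq_nest.simps(2))

text \<open>The head of \<open>qs\<close> is dropped because it may coincide with the last prime of
  \<open>ps\<close>; strictness at the junction then comes from the first inclusion in
  \<open>qs\<close>.\<close>

lemma prime_chain_append: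
  assumes ps: "prime_chain R ps" and qs: "prime_chain R qs" and le: "last ps \<subseteq> hd qs"
  shows "prime_chain R (ps @ tl qs)"
proof -
  have nps: "ps \<noteq> []" and sps: "sorted_wrt (\<subset>) ps" using ps by (auto simp: prime_chain_def)
  obtain q qs' where q: "qs = q # qs'" using qs by (cases qs) (auto simp: prime_chain_def)
  obtain b l where bl: "ps = b @ [l]" using nps by (cases ps rule: rev_cases) auto
  have pl: "x \<subseteq> q" if "x \<in> set ps" for x
  proof -
    have "x \<subseteq> l" using that sps unfolding bl by (auto simp: sorted_wrt_append)
    then show ?thesis using le unfolding bl q by simp
  qed
  have "\<forall>y\<in>set qs'. q \<subset> y" using qs unfolding q prime_chain_def by simp
  with pl have "\<forall>x\<in>set ps. \<forall>y\<in>set qs'. x \<subset> y" by (meson subset_psubset_trans)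
  then show ?thesis using ps qs unfolding q prime_chain_def by (auto simp: sorted_wrt_append)
qed

lemma prime_chain_le_krull_dim:
  "prime_chain R ps \<Longrightarrow> enat (length ps - 1) \<le> krull_dim R"
  unfolding krull_dim_def by (rule Sup_upper) blast

lemma dg_inf_inf_at:
  assumes "cplx A M" "inf_at M i"
  shows "dg_inf M = i"
proof -
  interpret cplx A M by fact
  have "i \<in> nonzero_degrees M" using assms(2) by (simp add: nonzero_degrees_iff inf_at_def exact_at_def)
  moreover have "i \<le> j" if "j \<in> nonzero_degrees M" for j
    using that assms(2) unfolding nonzero_degrees_iff inf_at_def exact_at_def by (meson not_less)
  ultimately show ?thesis unfolding dg_inf_def by (rule cInf_eq_minimum)
qed

lemma (in module) smult_inj_on_iff:
  assumes "x \<in> carrier R"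
  shows "inj_on (\<lambda>u. x \<odot>\<^bsub>M\<^esub> u) (carrier M) \<longleftrightarrow> (\<forall>u\<in>carrier M. x \<odot>\<^bsub>M\<^esub> u = \<zero>\<^bsub>M\<^esub> \<longrightarrow> u = \<zero>\<^bsub>M\<^esub>)"
proof
  assume "inj_on (\<lambda>u. x \<odot>\<^bsub>M\<^esub> u) (carrier M)"
  then show "\<forall>u\<in>carrier M. x \<odot>\<^bsub>M\<^esub> u = \<zero>\<^bsub>M\<^esub> \<longrightarrow> u = \<zero>\<^bsub>M\<^esub>"
    using smult_r_null[OF assms] M.zero_closed unfolding inj_on_def by metis
next
  assume h: "\<forall>u\<in>carrier M. x \<odot>\<^bsub>M\<^esub> u = \<zero>\<^bsub>M\<^esub> \<longrightarrow> u = \<zero>\<^bsub>M\<^esub>"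
  show "inj_on (\<lambda>u. x \<odot>\<^bsub>M\<^esub> u) (carrier M)"
  proof (rule inj_onI)
    fix u v assume uv: "u \<in> carrier M" "v \<in> carrier M" "x \<odot>\<^bsub>M\<^esub> u = x \<odot>\<^bsub>M\<^esub> v"
    have "x \<odot>\<^bsub>M\<^esub> (u \<oplus>\<^bsub>M\<^esub> \<ominus>\<^bsub>M\<^esub> v) = \<zero>\<^bsub>M\<^esub>"
      using uv assms by (simp add: smult_r_distr smult_r_minus M.r_neg)
    then have "u \<oplus>\<^bsub>M\<^esub> \<ominus>\<^bsub>M\<^esub> v = \<zero>\<^bsub>M\<^esub>" using h uv by simp
    then show "u = v" using uv M.minus_equality[of u "\<ominus>\<^bsub>M\<^esub> v"] by simp
  qed
qed

section \<open>Koszul complexes on sequences: order of the factors and starting degree\<close>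

context dg_ring
begin

lemma koszul_seq_cplx:
  assumes "nest_cplx A M" "set xs \<subseteq> carrier (H0 A)"
  shows "nest_cplx A (koszul_seq A M xs)"
  using assms
proof (induction xs arbitrary: M)
  case (Cons x xs)
  have "nest_cplx A (kos A M (H0_lift A x))"
    by (rule nest_cplx.kos_cplx[OF Cons.prems(1)]) (use Cons.prems(2) H0_lift_closed in simp)
  then show ?case using Cons.IH Cons.prems(2) by simp
qed simp

text \<open>An isomorphism of complexes extends through further Koszul factors: the lifts are the
  same on both sides, so their difference is the zero boundary.\<close>

lemma loc_map_koszul_seq:
  assumes "loc_map A M A N id {\<one>} \<sigma>" "set xs \<subseteq> carrier (H0 A)"
  shows "\<exists>\<sigma>. loc_map A (koszul_seq A M xs) A (koszul_seq A N xs) id {\<one>} \<sigma>"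
  using assms
proof (induction xs arbitrary: M N \<sigma>)
  case (Cons x xs)
  have l: "H0_lift A x \<in> deg_part A 0" using Cons.prems(2) H0_lift_closed by simp
  have "H0_lift A x \<ominus> id (H0_lift A x) \<in> boundary_ideal A"
    using gr_closed[OF l] additive_subgroup.zero_closed[OF ideal.axioms(1)[OF boundary_ideal]]
    by (simp add: a_minus_def r_neg)
  then obtain \<tau> where "loc_map A (kos A M (H0_lift A x)) A (kos A N (H0_lift A x)) id {\<one>} \<tau>"
    using loc_map_kos[OF Cons.prems(1) l l] by blast
  from Cons.IH[OF this] Cons.prems(2) show ?case unfolding koszul_seq_simps by simp
qed auto

text \<open>The isomorphism exchanging the two innermost factors is carried through the remaining
  factors \<open>vs\<close> and then transfers exactness in degree j.\<close>

lemma koszul_seq_swap: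
  assumes M: "nest_cplx A M" and c: "x \<in> carrier (H0 A)" "z \<in> carrier (H0 A)" "set vs \<subseteq> carrier (H0 A)"
    and ex: "exact_at (koszul_seq A M (x # z # vs)) j"
  shows "exact_at (koszul_seq A M (z # x # vs)) j"
proof -
  obtain \<sigma> where "loc_map A (kos A (kos A M (H0_lift A x)) (H0_lift A z)) A
      (kos A (kos A M (H0_lift A z)) (H0_lift A x)) id {\<one>} \<sigma>"
    using nest_cplx.kos_swap[OF M H0_lift_closed[OF c(1)] H0_lift_closed[OF c(2)]] by blast
  from loc_map_koszul_seq[OF this c(3)] obtain \<tau> where
    "loc_map A (koszul_seq A M (x # z # vs)) A (koszul_seq A M (z # x # vs)) id {\<one>} \<tau>" by auto
  from loc_map.exact_localize[OF this] ex show ?thesis unfolding exact_at_def by blast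
qed

text \<open>Adjacent exchanges carry x past \<open>zs\<close>. The complex M is generalized, since
  after each exchange one more factor belongs to it.\<close>

lemma koszul_seq_move:
  assumes "nest_cplx A M" "x \<in> carrier (H0 A)" "set zs \<subseteq> carrier (H0 A)" "set vs \<subseteq> carrier (H0 A)"
    and "exact_at (koszul_seq A M (x # zs @ vs)) j"
  shows "exact_at (koszul_seq A M (zs @ x # vs)) j"
  using assms
proof (induction zs arbitrary: M)
  case (Cons z zs)
  have z: "z \<in> carrier (H0 A)" "set (zs @ vs) \<subseteq> carrier (H0 A)" using Cons.prems by auto
  have "exact_at (koszul_seq A M (z # x # zs @ vs)) j"
    using koszul_seq_swap[OF Cons.prems(1,2) z] Cons.prems(5) by simp
  moreover have "nest_cplx A (kos A M (H0_lift A z))"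
    by (rule nest_cplx.kos_cplx[OF Cons.prems(1) H0_lift_closed[OF z(1)]])
  ultimately show ?case using Cons.IH[of "kos A M (H0_lift A z)"] Cons.prems by simp
qed simp

lemma koszul_seq_commute:
  assumes "nest_cplx A M" "set xs \<subseteq> carrier (H0 A)" "set zs \<subseteq> carrier (H0 A)"
    and "exact_at (koszul_seq A M (xs @ zs)) j"
  shows "exact_at (koszul_seq A M (zs @ xs)) j"
  using assms
proof (induction xs arbitrary: M)
  case (Cons x xs)
  have x: "x \<in> carrier (H0 A)" "set xs \<subseteq> carrier (H0 A)" using Cons.prems by auto
  have "nest_cplx A (kos A M (H0_lift A x))"
    by (rule nest_cplx.kos_cplx[OF Cons.prems(1) H0_lift_closed[OF x(1)]])
  then have "exact_at (koszul_seq A M (x # zs @ xs)) j"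
    using Cons.IH[of "kos A M (H0_lift A x)"] Cons.prems by simp
  then show ?case by (rule koszul_seq_move[OF Cons.prems(1) x(1) Cons.prems(3) x(2)])
qed simp

text \<open>A Koszul factor lowers the starting degree by at most one, because H^j(K(M; a)) is built
  from H^j(M) and H^(j+1)(M).\<close>

lemma kos_exact_below:
  assumes M: "nest_cplx A M" and a: "a \<in> deg_part A 0" and ex: "\<And>j. j < i \<Longrightarrow> exact_at M j" and j: "j < i - 1"
  shows "exact_at (kos A M a) j"
  unfolding exact_at_def
  by (rule nest_cplx.kos_exact[OF M a]) (use ex[of j] ex[of "j + 1"] j in \<open>auto simp: exact_at_def\<close>)

lemma koszul_seq_exact_below:
  assumes "nest_cplx A M" "set xs \<subseteq> carrier (H0 A)" "\<And>j. j < i \<Longrightarrow> exact_at M j" "j < i - int (length xs)"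
  shows "exact_at (koszul_seq A M xs) j"
  using assms
proof (induction xs arbitrary: M i)
  case (Cons x xs)
  have l: "H0_lift A x \<in> deg_part A 0" using Cons.prems(2) H0_lift_closed by simp
  show ?case
    unfolding koszul_seq_simps
  proof (rule Cons.IH[where i = "i - 1"])
    show "nest_cplx A (kos A M (H0_lift A x))" by (rule nest_cplx.kos_cplx[OF Cons.prems(1) l])
    show "exact_at (kos A M (H0_lift A x)) k" if "k < i - 1" for k
      by (rule kos_exact_below[OF Cons.prems(1) l Cons.prems(3) that])
  qed (use Cons.prems in auto)
qed simp

text \<open>If all of \<open>m\<close> kills a nonzero class of degree i, then
  \<open>kos_kernel_lift\<close> gives a nonzero class in degree i - 1 of K(M; x), again killed by
  all of \<open>m\<close>. So the bound of one degree per factor is attained and the argument can be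
  repeated.\<close>

lemma koszul_seq_drop:
  assumes "nest_cplx A M" "set zs \<subseteq> m" "m \<subseteq> carrier (H0 A)" "\<And>j. j < i \<Longrightarrow> exact_at M j"
    and "u \<in> cocycles M i" "u \<notin> coboundaries M i"
    and "\<And>b. b \<in> m \<Longrightarrow> H0_lift A b \<odot>\<^bsub>M\<^esub> u \<in> coboundaries M i"
  shows "\<not> exact_at (koszul_seq A M zs) (i - int (length zs))"
  using assms
proof (induction zs arbitrary: M i u)
  case Nil
  then show ?case by (auto simp: exact_at_def)
next
  case (Cons x zs)
  interpret nest_cplx A M by (rule Cons.prems(1))
  have l: "\<And>b. b \<in> m \<Longrightarrow> H0_lift A b \<in> deg_part A 0" using Cons.prems(3) H0_lift_closed by blast
  have x: "x \<in> m" using Cons.prems(2) by simp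
  have "cocycles M (i - 1) \<subseteq> coboundaries M (i - 1)" using Cons.prems(4)[of "i - 1"] by (simp add: exact_at_def)
  from kos_kernel_lift[OF l[OF x] this, of u] Cons.prems(5,6) Cons.prems(7)[OF x] obtain z where
    z: "z \<in> cocycles (kos A M (H0_lift A x)) (i - 1)" "z \<notin> coboundaries (kos A M (H0_lift A x)) (i - 1)"
    "\<And>b. b \<in> deg_part A 0 \<Longrightarrow> b \<odot>\<^bsub>M\<^esub> u \<in> coboundaries M i \<Longrightarrow>
      b \<odot>\<^bsub>kos A M (H0_lift A x)\<^esub> z \<in> coboundaries (kos A M (H0_lift A x)) (i - 1)"
    by auto
  have "\<not> exact_at (koszul_seq A (kos A M (H0_lift A x)) zs) ((i - 1) - int (length zs))"
  proof (rule Cons.IH[OF kos_cplx[OF l[OF x]] _ Cons.prems(3) _ z(1,2)])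
    show "exact_at (kos A M (H0_lift A x)) j" if "j < i - 1" for j
      by (rule kos_exact_below[OF Cons.prems(1) l[OF x] Cons.prems(4) that])
  qed (use Cons.prems z(3) l in auto)
  then show ?case by (simp add: algebra_simps)
qed

end

section \<open>Regular sequences and associated primes over a local DG-ring\<close>

locale local_dg = dg: dg_ring A + HR: noeth_local_ring "H0 A" m
  for A :: "'a dg_ring" and m :: "'a set set"
begin

lemma lift_m: "x \<in> m \<Longrightarrow> H0_lift A x \<in> deg_part A 0"
  using HR.m_carrier dg.H0_lift_closed by blast

lemma fin_cplx_kos:
  "fin_cplx A M \<Longrightarrow> x \<in> carrier (H0 A) \<Longrightarrow> fin_cplx A (kos A M (H0_lift A x))"
  unfolding fin_cplx_def
  using nest_cplx.kos_cplx[of A M "H0_lift A x"] nest_cplx.kos_cohomology_noeth[of A M "H0_lift A x"]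
    dg.H0_lift_closed[of x] by simp

lemma fin_cplxD:
  assumes "fin_cplx A M"
  shows "nest_cplx A M" "cplx A M" "noeth_module (H0 A) (cohomology M n)"
  using assms by (simp_all add: fin_cplx_def nest_cplx_def)

text \<open>Replaces injectivity in degree \<open>dg_inf M\<close> by the absence of classes killed
  by x in the known degree i.\<close>

lemma regular_elem_iff:
  assumes M: "fin_cplx A M" and i: "inf_at M i"
  shows "regular_elem A m M x \<longleftrightarrow> x \<in> m \<and>
    (\<forall>X\<in>carrier (cohomology M i). x \<odot>\<^bsub>cohomology M i\<^esub> X = \<zero>\<^bsub>cohomology M i\<^esub> \<longrightarrow> X = \<zero>\<^bsub>cohomology M i\<^esub>)"
proof -
  interpret noeth_module "H0 A" "cohomology M i" by (rule fin_cplxD(3)[OF M])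
  show ?thesis
    unfolding regular_elem_def dg_inf_inf_at[OF fin_cplxD(2)[OF M] i]
    using smult_inj_on_iff HR.m_carrier by blast
qed

lemma not_exact_class:
  assumes "cplx A M" "\<not> exact_at M i"
  shows "\<exists>X\<in>carrier (cohomology M i). X \<noteq> \<zero>\<^bsub>cohomology M i\<^esub>"
proof -
  interpret cplx A M by fact
  obtain u where u: "u \<in> cocycles M i" "u \<notin> coboundaries M i" using assms(2) unfolding exact_at_def by blast
  have "coh_class M i u \<noteq> \<zero>\<^bsub>cohomology M i\<^esub>" using coh_class_zero_iff[OF cocycle_closed[OF u(1)]] u(2) by simp
  then show ?thesis using coh_class_closed[OF u(1)] by blast
qed

text \<open>Exactness below i follows from the long exact sequence. Nonvanishing in degree i is
  Nakayama's lemma: if H^i(K(M; x)) were zero, then H^i(M) = x H^i(M), although H^i(M) is finitely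
  generated and nonzero.\<close>

lemma inf_at_kos:
  assumes M: "fin_cplx A M" and i: "inf_at M i" and x: "regular_elem A m M x"
  shows "inf_at (kos A M (H0_lift A x)) i"
proof -
  interpret nest_cplx A M by (rule fin_cplxD(1)[OF M])
  interpret H: noeth_module "H0 A" "cohomology M i" by (rule fin_cplxD(3)[OF M])
  let ?a = "H0_lift A x"
  have xm: "x \<in> m" and reg: "\<And>X. X \<in> carrier (cohomology M i) \<Longrightarrow>
      x \<odot>\<^bsub>cohomology M i\<^esub> X = \<zero>\<^bsub>cohomology M i\<^esub> \<Longrightarrow> X = \<zero>\<^bsub>cohomology M i\<^esub>"
    using x regular_elem_iff[OF M i] by blast+
  note xc = HR.m_carrier[OF xm] and a = lift_m[OF xm]
  have ex: "\<And>j. j < i \<Longrightarrow> exact_at M j" using i by (simp add: inf_at_def)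
  have "exact_at (kos A M ?a) j" if j: "j < i" for j
    unfolding exact_at_def
  proof (rule kos_exact[OF a])
    show "cocycles M j \<subseteq> coboundaries M j" using ex[OF j] by (simp add: exact_at_def)
    fix u assume u: "u \<in> cocycles M (j + 1)" "?a \<odot>\<^bsub>M\<^esub> u \<in> coboundaries M (j + 1)"
    show "u \<in> coboundaries M (j + 1)"
    proof (cases "j + 1 < i")
      case True
      then show ?thesis using ex u(1) unfolding exact_at_def by blast
    next
      case False
      \<comment> \<open>Degree i - 1 is the only place where regularity enters: there a kernel of x
        on H^i(M) would produce cohomology.\<close>
      then have ji: "j + 1 = i" using j by simp
      have "x \<odot>\<^bsub>cohomology M i\<^esub> coh_class M i u = \<zero>\<^bsub>cohomology M i\<^esub>"
        using u a smult_cohomology_lift[OF xc, of u i] coh_class_zero_iff[of "?a \<odot>\<^bsub>M\<^esub> u" i] cocycle_closed[of u i]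
        unfolding ji by simp
      then have "coh_class M i u = \<zero>\<^bsub>cohomology M i\<^esub>" using reg[OF coh_class_closed] u(1) unfolding ji by blast
      then show ?thesis using coh_class_zero_iff[of u i] u(1) cocycle_closed[of u i] unfolding ji by simp
    qed
  qed
  moreover have "\<not> exact_at (kos A M ?a) i"
  proof
    assume e: "exact_at (kos A M ?a) i"
    obtain F where F: "finite F" "F \<subseteq> carrier (cohomology M i)" "carrier (cohomology M i) = mod_span (H0 A) (cohomology M i) F"
      using H.submodule_fin_gen[OF H.carrier_is_submodule] by (elim exE conjE) (rule that)
    have "mod_span (H0 A) (cohomology M i) F = {\<zero>\<^bsub>cohomology M i\<^esub>}"
    proof (rule H.nakayama[OF HR.noeth_local_ring_axioms xm F(1,2)])
      fix X assume "X \<in> mod_span (H0 A) (cohomology M i) F"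
      then have "X \<in> carrier (cohomology M i)" unfolding F(3)[symmetric] .
      then obtain u where u: "u \<in> cocycles M i" "X = coh_class M i u" by (rule cohomologyE)
      have "Node (\<zero>\<^bsub>M\<^esub>, u) \<in> coboundaries (kos A M ?a) i"
        using kos_incl_cocycle[OF a u(1)] e unfolding exact_at_def by blast
      then obtain p where p: "p \<in> cocycles M i" "u \<ominus>\<^bsub>M\<^esub> ?a \<odot>\<^bsub>M\<^esub> p \<in> coboundaries M i"
        using kos_incl_coboundary[OF a u(1)] by blast
      have "X = x \<odot>\<^bsub>cohomology M i\<^esub> coh_class M i p"
        unfolding u(2) smult_cohomology_lift[OF xc p(1)]
        using coh_class_eq_iff[of u "?a \<odot>\<^bsub>M\<^esub> p" i] p u(1) a cocycle_closed by simp
      then show "\<exists>Y\<in>mod_span (H0 A) (cohomology M i) F. X = x \<odot>\<^bsub>cohomology M i\<^esub> Y"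
        unfolding F(3)[symmetric] using coh_class_closed[OF p(1)] by blast
    qed
    then have "carrier (cohomology M i) = {\<zero>\<^bsub>cohomology M i\<^esub>}" unfolding F(3)[symmetric] .
    then show False using not_exact_class[OF cplx_axioms] i unfolding inf_at_def by blast
  qed
  ultimately show ?thesis by (simp add: inf_at_def)
qed

lemma koszul_seq_regular:
  assumes "fin_cplx A M" "inf_at M i" "regular_seq_nest A m M xs"
  shows "fin_cplx A (koszul_seq A M xs) \<and> inf_at (koszul_seq A M xs) i \<and> set xs \<subseteq> m"
  using assms
proof (induction xs arbitrary: M)
  case (Cons x xs)
  have x: "regular_elem A m M x" "regular_seq_nest A m (kos A M (H0_lift A x)) xs"
    using Cons.prems(3) by (simp_all add: regular_seq_nest_Cons del: regular_seq_nest.simps(2))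
  have "x \<in> m" using x(1) by (simp add: regular_elem_def)
  then show ?case
    using Cons.IH[OF fin_cplx_kos[OF Cons.prems(1) HR.m_carrier] inf_at_kos[OF Cons.prems(1,2) x(1)] x(2)] by simp
qed simp

text \<open>For \<open>N' = {X. q X = 0}\<close>, the quotient \<open>N'/xN'\<close> is nonzero by Nakayama and embeds into the
  bottom cohomology of the Koszul complex, where it is annihilated by \<open>q\<close> and \<open>x\<close>.\<close>

lemma ass_prime_kos:
  assumes M: "fin_cplx A M" and i: "inf_at M i" and x: "regular_elem A m M x"
    and q: "q \<in> ass_primes (H0 A) (cohomology M i)"
  shows "\<exists>q'\<in>ass_primes (H0 A) (cohomology (kos A M (H0_lift A x)) i). q \<subset> q'"
proof -
  interpret nest_cplx A M by (rule fin_cplxD(1)[OF M])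
  interpret H: noeth_module "H0 A" "cohomology M i" by (rule fin_cplxD(3)[OF M])
  let ?a = "H0_lift A x" and ?H = "cohomology M i"
  have xm: "x \<in> m" and reg: "\<And>X. X \<in> carrier ?H \<Longrightarrow> x \<odot>\<^bsub>?H\<^esub> X = \<zero>\<^bsub>?H\<^esub> \<Longrightarrow> X = \<zero>\<^bsub>?H\<^esub>"
    using x regular_elem_iff[OF M i] by blast+
  note xc = HR.m_carrier[OF xm] and a = lift_m[OF xm]
  interpret K: nest_cplx A "kos A M ?a" by (rule kos_cplx[OF a])
  interpret KH: module "H0 A" "cohomology (kos A M ?a) i" by (rule K.cohomology_module)
  obtain v where v: "v \<in> carrier ?H" "v \<noteq> \<zero>\<^bsub>?H\<^esub>" "q = annihilator (H0 A) ?H v" "q \<in> spec (H0 A)"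
    using q by (rule H.ass_primeD)
  have qc: "\<And>r. r \<in> q \<Longrightarrow> r \<in> carrier (H0 A)" using spec_carrier[OF v(4)] .
  define N where "N = {X \<in> carrier ?H. \<forall>r\<in>q. r \<odot>\<^bsub>?H\<^esub> X = \<zero>\<^bsub>?H\<^esub>}"
  have comm: "r \<odot>\<^bsub>?H\<^esub> (s \<odot>\<^bsub>?H\<^esub> X) = s \<odot>\<^bsub>?H\<^esub> (r \<odot>\<^bsub>?H\<^esub> X)"
    if "r \<in> carrier (H0 A)" "s \<in> carrier (H0 A)" "X \<in> carrier ?H" for r s X
    using that H.smult_assoc1[of r s X] H.smult_assoc1[of s r X] HR.m_comm[of r s] by simp
  have N: "submodule N (H0 A) ?H"
  proof (rule H.submodule_intro)
    show "N \<subseteq> carrier ?H" unfolding N_def by (rule Collect_restrict)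
    show "\<zero>\<^bsub>?H\<^esub> \<in> N" unfolding N_def using qc by simp
    show "X \<oplus>\<^bsub>?H\<^esub> Y \<in> N" if "X \<in> N" "Y \<in> N" for X Y
      using that qc unfolding N_def by (simp add: H.smult_r_distr)
    show "r \<odot>\<^bsub>?H\<^esub> X \<in> N" if r: "r \<in> carrier (H0 A)" and X: "X \<in> N" for r X
    proof -
      have "s \<odot>\<^bsub>?H\<^esub> (r \<odot>\<^bsub>?H\<^esub> X) = \<zero>\<^bsub>?H\<^esub>" if s: "s \<in> q" for s
        using comm[OF qc[OF s] r, of X] X s r unfolding N_def by simp
      then show ?thesis using X r unfolding N_def by simp
    qed
  qed
  have Nc: "\<And>X. X \<in> N \<Longrightarrow> X \<in> carrier ?H" unfolding N_def by blast
  have vN: "v \<in> N" using v by (simp add: N_def annihilator_def)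
  obtain F where F: "finite F" "F \<subseteq> N" "N = mod_span (H0 A) ?H F"
    using H.submodule_fin_gen[OF N] by (elim exE conjE) (rule that)
  \<comment> \<open>Nakayama's lemma for N, which is nonzero because it contains v, gives an element
    of N outside xN.\<close>
  have "\<exists>X\<in>N. \<forall>Y\<in>N. X \<noteq> x \<odot>\<^bsub>?H\<^esub> Y"
  proof (rule ccontr)
    assume n: "\<not> ?thesis"
    have "mod_span (H0 A) ?H F = {\<zero>\<^bsub>?H\<^esub>}"
    proof (rule H.nakayama[OF HR.noeth_local_ring_axioms xm F(1)])
      show "F \<subseteq> carrier ?H" using F(2) Nc by blast
    next
      fix X assume "X \<in> mod_span (H0 A) ?H F"
      then show "\<exists>Y\<in>mod_span (H0 A) ?H F. X = x \<odot>\<^bsub>?H\<^esub> Y" unfolding F(3)[symmetric] using n by blast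
    qed
    then have "N = {\<zero>\<^bsub>?H\<^esub>}" unfolding F(3)[symmetric] .
    then show False using vN v(2) by blast
  qed
  then obtain X where X: "X \<in> N" "\<And>Y. Y \<in> N \<Longrightarrow> X \<noteq> x \<odot>\<^bsub>?H\<^esub> Y" by blast
  obtain u where u: "u \<in> cocycles M i" "X = coh_class M i u" using Nc[OF X(1)] by (rule cohomologyE)
  let ?z = "Node (\<zero>\<^bsub>M\<^esub>, u)"
  have z: "?z \<in> cocycles (kos A M ?a) i" by (rule kos_incl_cocycle[OF a u(1)])
  let ?Z = "coh_class (kos A M ?a) i ?z"
  have sz: "r \<odot>\<^bsub>cohomology (kos A M ?a) i\<^esub> ?Z = coh_class (kos A M ?a) i (Node (\<zero>\<^bsub>M\<^esub>, H0_lift A r \<odot>\<^bsub>M\<^esub> u))"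
    if r: "r \<in> carrier (H0 A)" for r
    using K.smult_cohomology_lift[OF r z] dg.H0_lift_closed[OF r] smult_r_null[of "H0_lift A r"]
    by (simp add: dg.grading_involution_deg0)
  have nz: "?Z \<noteq> \<zero>\<^bsub>cohomology (kos A M ?a) i\<^esub>"
  proof
    assume "?Z = \<zero>\<^bsub>cohomology (kos A M ?a) i\<^esub>"
    then have "?z \<in> coboundaries (kos A M ?a) i" using K.coh_class_zero_iff[OF K.cocycle_closed[OF z]] by simp
    then obtain p where p: "p \<in> cocycles M i" "u \<ominus>\<^bsub>M\<^esub> ?a \<odot>\<^bsub>M\<^esub> p \<in> coboundaries M i"
      using kos_incl_coboundary[OF a u(1)] by blast
    let ?P = "coh_class M i p"
    have P: "?P \<in> carrier ?H" by (rule coh_class_closed[OF p(1)])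
    have XP: "X = x \<odot>\<^bsub>?H\<^esub> ?P"
      unfolding u(2) smult_cohomology_lift[OF xc p(1)]
      using coh_class_eq_iff[of u "?a \<odot>\<^bsub>M\<^esub> p" i] p u(1) a cocycle_closed by simp
    \<comment> \<open>Since x is regular, xP \<in> N forces P \<in> N; so an element of N outside xN
      stays nonzero modulo x in all of H^i(M).\<close>
    have "r \<odot>\<^bsub>?H\<^esub> ?P = \<zero>\<^bsub>?H\<^esub>" if r: "r \<in> q" for r
    proof -
      have "x \<odot>\<^bsub>?H\<^esub> (r \<odot>\<^bsub>?H\<^esub> ?P) = \<zero>\<^bsub>?H\<^esub>"
        using comm[OF xc qc[OF r] P] X(1) r unfolding N_def XP by simp
      then show ?thesis using reg[of "r \<odot>\<^bsub>?H\<^esub> ?P"] P qc[OF r] by simp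
    qed
    then have "?P \<in> N" using P by (simp add: N_def)
    then show False using X(2) XP by blast
  qed
  have qZ: "q \<subseteq> annihilator (H0 A) (cohomology (kos A M ?a) i) ?Z"
  proof
    fix r assume r: "r \<in> q"
    have "H0_lift A r \<odot>\<^bsub>M\<^esub> u \<in> coboundaries M i"
      using X(1) r smult_cohomology_lift[OF qc[OF r] u(1)] coh_class_zero_iff[of "H0_lift A r \<odot>\<^bsub>M\<^esub> u" i]
        dg.H0_lift_closed[OF qc[OF r]] cocycle_closed[OF u(1)] unfolding N_def u(2) by simp
    then have "r \<odot>\<^bsub>cohomology (kos A M ?a) i\<^esub> ?Z = \<zero>\<^bsub>cohomology (kos A M ?a) i\<^esub>"
      unfolding sz[OF qc[OF r]] using K.coh_class_zero_iff[OF K.coboundary_closed] kos_incl_coboundaryI[OF a] by blast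
    then show "r \<in> annihilator (H0 A) (cohomology (kos A M ?a) i) ?Z"
      using qc[OF r] by (simp add: annihilator_def)
  qed
  have xZ: "x \<in> annihilator (H0 A) (cohomology (kos A M ?a) i) ?Z"
    using sz[OF xc] kos_smult_incl_coboundary[OF a u(1)] K.coh_class_zero_iff[OF K.coboundary_closed] xc
    by (simp add: annihilator_def)
  obtain q' where q': "q' \<in> ass_primes (H0 A) (cohomology (kos A M ?a) i)"
    "annihilator (H0 A) (cohomology (kos A M ?a) i) ?Z \<subseteq> q'"
    using KH.ex_ass_prime_above[OF HR.noetherian_ring_axioms K.coh_class_closed[OF z] nz] by blast
  \<comment> \<open>This makes the inclusion strict: x kills the new class but, being regular, does
    not kill v.\<close>
  have "x \<notin> q" using v reg[of v] by (auto simp: annihilator_def)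
  then show ?thesis using q' qZ xZ by blast
qed

lemma ex_ass_prime:
  assumes M: "fin_cplx A M" and i: "inf_at M i"
  shows "\<exists>q. q \<in> ass_primes (H0 A) (cohomology M i)"
proof -
  interpret noeth_module "H0 A" "cohomology M i" by (rule fin_cplxD(3)[OF M])
  show ?thesis
    using not_exact_class[OF fin_cplxD(2)[OF M]] i ex_ass_prime_above[OF HR.noetherian_ring_axioms]
    unfolding inf_at_def by blast
qed

text \<open>Each regular element replaces the current associated prime by a strictly larger one of
  the next Koszul complex; every element thus adds one strict inclusion to the chain.\<close>

lemma regular_seq_chain:
  assumes "fin_cplx A M" "inf_at M i" "regular_seq_nest A m M xs" "q \<in> ass_primes (H0 A) (cohomology M i)"
  shows "\<exists>ps. prime_chain (H0 A) ps \<and> hd ps = q \<and> length ps = Suc (length xs)"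
  using assms
proof (induction xs arbitrary: M q)
  case Nil
  then have "prime_chain (H0 A) [q]" by (simp add: prime_chain_def ass_primes_def)
  then show ?case by force
next
  case (Cons x xs)
  have x: "regular_elem A m M x" "regular_seq_nest A m (kos A M (H0_lift A x)) xs"
    using Cons.prems(3) by (simp_all add: regular_seq_nest_Cons del: regular_seq_nest.simps(2))
  have xm: "x \<in> m" using x(1) by (simp add: regular_elem_def)
  obtain q' where q': "q' \<in> ass_primes (H0 A) (cohomology (kos A M (H0_lift A x)) i)" "q \<subset> q'"
    using ass_prime_kos[OF Cons.prems(1,2) x(1) Cons.prems(4)] by blast
  obtain ps where ps: "prime_chain (H0 A) ps" "hd ps = q'" "length ps = Suc (length xs)"
    using Cons.IH[OF fin_cplx_kos[OF Cons.prems(1) HR.m_carrier[OF xm]] inf_at_kos[OF Cons.prems(1,2) x(1)] x(2) q'(1)]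
    by blast
  obtain ps' where ps': "ps = q' # ps'" using ps by (cases ps) auto
  have "q \<in> spec (H0 A)" using Cons.prems(4) by (simp add: ass_primes_def)
  then have "prime_chain (H0 A) (q # ps)" using ps(1) q'(2) unfolding ps' prime_chain_def by auto
  then show ?case using ps(3) by (intro exI[of _ "q # ps"]) simp
qed

text \<open>Any associated prime can start the chain, and one exists because H^i(M) is
  nonzero.\<close>

lemma regular_seq_le_krull_dim:
  assumes "fin_cplx A M" "inf_at M i" "regular_seq_nest A m M xs"
  shows "enat (length xs) \<le> krull_dim (H0 A)"
  using regular_seq_chain[OF assms] ex_ass_prime[OF assms(1,2)] prime_chain_le_krull_dim
  by (metis diff_Suc_1)

lemma zero_divisors_le_ass_prime:
  assumes M: "fin_cplx A M" and i: "inf_at M i" and p: "ideal p (H0 A)" "p \<subseteq> m"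
    and zd: "\<And>x. x \<in> p \<Longrightarrow> \<not> regular_elem A m M x"
  shows "\<exists>q\<in>ass_primes (H0 A) (cohomology M i). p \<subseteq> q"
proof -
  interpret noeth_module "H0 A" "cohomology M i" by (rule fin_cplxD(3)[OF M])
  show ?thesis
  proof (rule zero_divisor_ideal_le_ass_prime[OF HR.noetherian_ring_axioms p(1)])
    fix a assume a: "a \<in> p"
    then have "a \<in> m" using p(2) by blast
    then show "\<exists>v\<in>carrier (cohomology M i). v \<noteq> \<zero>\<^bsub>cohomology M i\<^esub> \<and> a \<odot>\<^bsub>cohomology M i\<^esub> v = \<zero>\<^bsub>cohomology M i\<^esub>"
      using zd[OF a] unfolding regular_elem_iff[OF M i] by blast
  qed
qed

text \<open>Hence all maximal regular sequences have the same length. If no such \<open>w\<close> existed, the Koszul complex on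
  \<open>xs @ zs\<close> would not be exact in degree \<open>i - length zs\<close>, but that on \<open>zs @ xs\<close> is exact below \<open>i - length xs\<close>.\<close>

lemma regular_seq_extend:
  assumes M: "fin_cplx A M" and i: "inf_at M i" and zs: "regular_seq_nest A m M zs"
    and xs: "regular_seq_nest A m M xs" and len: "length xs < length zs"
  shows "\<exists>w. regular_elem A m (koszul_seq A M xs) w"
proof (rule ccontr)
  assume n: "\<not> ?thesis"
  let ?N = "koszul_seq A M xs"
  have N: "fin_cplx A ?N" "inf_at ?N i" "set xs \<subseteq> m" using koszul_seq_regular[OF M i xs] by blast+
  have Z: "inf_at (koszul_seq A M zs) i" "set zs \<subseteq> m" using koszul_seq_regular[OF M i zs] by blast+
  have mc: "m \<subseteq> carrier (H0 A)" using HR.m_carrier by blast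
  interpret N: nest_cplx A ?N by (rule fin_cplxD(1)[OF N(1)])
  interpret H: noeth_module "H0 A" "cohomology ?N i" by (rule fin_cplxD(3)[OF N(1)])
  \<comment> \<open>No element of m is regular, so m lies in a single associated prime, and one
    class X is killed by all of m at once.\<close>
  obtain q where q: "q \<in> ass_primes (H0 A) (cohomology ?N i)" "m \<subseteq> q"
    using zero_divisors_le_ass_prime[OF N(1,2) HR.m_ideal] n by blast
  obtain X where X: "X \<in> carrier (cohomology ?N i)" "X \<noteq> \<zero>\<^bsub>cohomology ?N i\<^esub>"
    "q = annihilator (H0 A) (cohomology ?N i) X"
    using q(1) by (rule H.ass_primeD)
  obtain u where u: "u \<in> cocycles ?N i" "X = coh_class ?N i u" using X(1) by (rule N.cohomologyE)
  have "\<not> exact_at (koszul_seq A ?N zs) (i - int (length zs))"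
  proof (rule dg.koszul_seq_drop[OF N.nest_cplx_axioms Z(2) mc _ u(1)])
    show "exact_at ?N j" if "j < i" for j using N(2) that by (simp add: inf_at_def)
    show "u \<notin> coboundaries ?N i" using X(2) N.coh_class_zero_iff[OF N.cocycle_closed[OF u(1)]] u(2) by simp
    fix b assume b: "b \<in> m"
    then have "b \<odot>\<^bsub>cohomology ?N i\<^esub> X = \<zero>\<^bsub>cohomology ?N i\<^esub>" using q(2) unfolding X(3) annihilator_def by blast
    then show "H0_lift A b \<odot>\<^bsub>?N\<^esub> u \<in> coboundaries ?N i"
      using N.smult_cohomology_lift[OF HR.m_carrier[OF b] u(1)] N.coh_class_zero_iff[of "H0_lift A b \<odot>\<^bsub>?N\<^esub> u" i]
        lift_m[OF b] N.cocycle_closed[OF u(1)] unfolding u(2) by simp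
  qed
  moreover have "exact_at (koszul_seq A M (zs @ xs)) (i - int (length zs))"
    unfolding koszul_seq_simps(3)
  proof (rule dg.koszul_seq_exact_below[where i = i])
    show "nest_cplx A (koszul_seq A M zs)"
      using dg.koszul_seq_cplx[OF fin_cplxD(1)[OF M]] Z(2) mc by blast
    show "set xs \<subseteq> carrier (H0 A)" using N(3) mc by blast
    show "exact_at (koszul_seq A M zs) j" if "j < i" for j using Z(1) that by (simp add: inf_at_def)
  qed (use len in simp)
  then have "exact_at (koszul_seq A M (xs @ zs)) (i - int (length zs))"
    using dg.koszul_seq_commute[OF fin_cplxD(1)[OF M]] N(3) Z(2) mc by blast
  ultimately show False by simp
qed

text \<open>Induction on the number of missing elements; each is appended at the end by
  \<open>regular_seq_extend\<close>, so \<open>xs\<close> stays a prefix.\<close>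

lemma regular_seq_extend_length:
  assumes M: "fin_cplx A M" and i: "inf_at M i" and zs: "regular_seq_nest A m M zs"
    and xs: "regular_seq_nest A m M xs" and len: "length xs \<le> length zs"
  shows "\<exists>ws. regular_seq_nest A m M (xs @ ws) \<and> length (xs @ ws) = length zs"
  using xs len
proof (induction "length zs - length xs" arbitrary: xs)
  case 0
  then show ?case by (intro exI[of _ "[]"]) simp
next
  case (Suc k)
  obtain w where w: "regular_elem A m (koszul_seq A M xs) w"
    using regular_seq_extend[OF M i zs Suc.prems(1)] Suc.hyps(2) by (metis zero_less_Suc zero_less_diff)
  have "regular_seq_nest A m M (xs @ [w])"
    using Suc.prems(1) w by (simp add: regular_seq_nest_append)
  moreover have "k = length zs - length (xs @ [w])" "length (xs @ [w]) \<le> length zs" using Suc.hyps(2) by auto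
  ultimately obtain ws where "regular_seq_nest A m M ((xs @ [w]) @ ws)" "length ((xs @ [w]) @ ws) = length zs"
    using Suc.hyps(1) by blast
  then show ?case by (intro exI[of _ "w # ws"]) simp
qed

text \<open>The sequence grows inside p one element at a time. The assumption \<open>dim\<close>
  says that \<open>zs\<close> is as long as the dimension allows, and \<open>r < length ps\<close>
  reflects that a list of h + 1 primes is a chain of length h.\<close>

theorem regular_seq_in_prime:
  assumes M: "fin_cplx A M" and i: "inf_at M i" and zs: "regular_seq_nest A m M zs"
    and dim: "krull_dim (H0 A) \<le> enat (length zs)"
    and p: "p \<in> spec (H0 A)" and ps: "prime_chain (H0 A) ps" "last ps \<subseteq> p" and r: "r < length ps"
  shows "\<exists>xs. regular_seq_nest A m M xs \<and> set xs \<subseteq> p \<and> length xs = r"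
  using r
proof (induction r)
  case 0
  then show ?case by (intro exI[of _ "[]"]) simp
next
  case (Suc r)
  obtain xs where xs: "regular_seq_nest A m M xs" "set xs \<subseteq> p" "length xs = r" using Suc by auto
  let ?N = "koszul_seq A M xs"
  have N: "fin_cplx A ?N" "inf_at ?N i" using koszul_seq_regular[OF M i xs(1)] by blast+
  show ?case
  proof (cases "\<exists>x\<in>p. regular_elem A m ?N x")
    case True
    then obtain x where "x \<in> p" "regular_elem A m ?N x" by blast
    then show ?thesis
      using xs by (intro exI[of _ "xs @ [x]"]) (simp add: regular_seq_nest_append)
  next
    case False
    then obtain q where q: "q \<in> ass_primes (H0 A) (cohomology ?N i)" "p \<subseteq> q"
      using zero_divisors_le_ass_prime[OF N spec_ideal[OF p] HR.spec_le_m[OF p]] by blast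
    have le: "length ps - 1 \<le> length zs"
      using order_trans[OF prime_chain_le_krull_dim[OF ps(1)] dim] by simp
    \<comment> \<open>The sequence inside p is still shorter than the chain ending in p, hence not
      longer than \<open>zs\<close>, so it can be completed within m to the length of
      \<open>zs\<close>.\<close>
    have rle: "length xs \<le> length zs" using le Suc.prems unfolding xs(3) by linarith
    obtain ws where ws: "regular_seq_nest A m M (xs @ ws)" "length (xs @ ws) = length zs"
      using regular_seq_extend_length[OF M i zs xs(1)] rle by blast
    have "regular_seq_nest A m ?N ws" using ws(1) by (simp add: regular_seq_nest_append)
    then obtain qs where qs: "prime_chain (H0 A) qs" "hd qs = q" "length qs = Suc (length ws)"
      using regular_seq_chain[OF N _ q(1)] by blast
    have "prime_chain (H0 A) (ps @ tl qs)"
      by (rule prime_chain_append[OF ps(1) qs(1)]) (use ps(2) q(2) qs(2) in blast)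
    \<comment> \<open>The lists \<open>ps\<close> and \<open>tl qs\<close> together contain length
      ps + length ws primes. With length zs = r + length ws this gives length ps - 1 \<le> r,
      against Suc r < length ps.\<close>
    from order_trans[OF prime_chain_le_krull_dim[OF this] dim]
    have "length ps + length ws - 1 \<le> length zs" using qs(3) by simp
    then show ?thesis using ws(2) xs(3) Suc.prems by simp
  qed
qed

end

section \<open>Localization of commutative rings\<close>

text \<open>Localization at P by its characteristic properties: the complement of P becomes
  invertible, every element is a fraction, and the kernel is torsion. It will be applied to H^0 of a
  localized DG-ring, which is not literally built from fractions over H^0(A).\<close>

locale ring_localization = R: cring R + R': cring R'
  for R :: "('a, 'c) ring_scheme" and R' :: "('b, 'd) ring_scheme" and \<phi> :: "'a \<Rightarrow> 'b" and P :: "'a set" +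
  assumes hom: "\<phi> \<in> ring_hom R R'" and P_spec: "P \<in> spec R"
    and unit: "s \<in> carrier R \<Longrightarrow> s \<notin> P \<Longrightarrow> \<exists>t\<in>carrier R'. t \<otimes>\<^bsub>R'\<^esub> \<phi> s = \<one>\<^bsub>R'\<^esub>"
    and fraction: "y \<in> carrier R' \<Longrightarrow> \<exists>s\<in>carrier R - P. \<exists>x\<in>carrier R. \<phi> s \<otimes>\<^bsub>R'\<^esub> y = \<phi> x"
    and kernel: "x \<in> carrier R \<Longrightarrow> \<phi> x = \<zero>\<^bsub>R'\<^esub> \<Longrightarrow> \<exists>s\<in>carrier R - P. s \<otimes>\<^bsub>R\<^esub> x = \<zero>\<^bsub>R\<^esub>"
begin

lemma phi_simps:
  "x \<in> carrier R \<Longrightarrow> \<phi> x \<in> carrier R'"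
  "x \<in> carrier R \<Longrightarrow> y \<in> carrier R \<Longrightarrow> \<phi> (x \<otimes>\<^bsub>R\<^esub> y) = \<phi> x \<otimes>\<^bsub>R'\<^esub> \<phi> y"
  "x \<in> carrier R \<Longrightarrow> y \<in> carrier R \<Longrightarrow> \<phi> (x \<oplus>\<^bsub>R\<^esub> y) = \<phi> x \<oplus>\<^bsub>R'\<^esub> \<phi> y"
  "\<phi> \<one>\<^bsub>R\<^esub> = \<one>\<^bsub>R'\<^esub>"
  using ring_hom_closed[OF hom] ring_hom_mult[OF hom] ring_hom_add[OF hom] ring_hom_one[OF hom] by auto

lemma phi_zero: "\<phi> \<zero>\<^bsub>R\<^esub> = \<zero>\<^bsub>R'\<^esub>"
  using phi_simps(3)[of "\<zero>\<^bsub>R\<^esub>" "\<zero>\<^bsub>R\<^esub>"] phi_simps(1)[of "\<zero>\<^bsub>R\<^esub>"] by simp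

lemma P_mult_closed:
  "s \<in> carrier R - P \<Longrightarrow> t \<in> carrier R - P \<Longrightarrow> s \<otimes>\<^bsub>R\<^esub> t \<in> carrier R - P"
  using spec_mult[OF P_spec] by blast

definition contraction :: "'b set \<Rightarrow> 'a set" where
  "contraction I = {x \<in> carrier R. \<phi> x \<in> I}"

lemma contraction_ideal:
  assumes "ideal I R'"
  shows "ideal (contraction I) R"
proof -
  interpret I: ideal I R' by fact
  show ?thesis
    by (rule R.ideal_intro) (auto simp: contraction_def phi_simps phi_zero I.I_l_closed)
qed

lemma unit_notin:
  assumes q: "q \<in> spec R'" and s: "s \<in> carrier R - P"
  shows "\<phi> s \<notin> q"
proof
  assume h: "\<phi> s \<in> q"
  obtain t where t: "t \<in> carrier R'" "t \<otimes>\<^bsub>R'\<^esub> \<phi> s = \<one>\<^bsub>R'\<^esub>" using unit s by blast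
  have "\<one>\<^bsub>R'\<^esub> \<in> q" using ideal.I_l_closed[OF spec_ideal[OF q] h t(1)] t(2) by simp
  then show False using spec_one[OF q] by blast
qed

lemma contraction_spec:
  assumes q: "q \<in> spec R'"
  shows "contraction q \<in> spec R" "contraction q \<subseteq> P"
proof -
  show "contraction q \<in> spec R"
  proof (rule R.spec_intro[OF contraction_ideal[OF spec_ideal[OF q]]])
    show "\<one>\<^bsub>R\<^esub> \<notin> contraction q" using spec_one[OF q] by (simp add: contraction_def phi_simps)
    fix a b assume ab: "a \<in> carrier R" "b \<in> carrier R" "a \<otimes>\<^bsub>R\<^esub> b \<in> contraction q"
    then show "a \<in> contraction q \<or> b \<in> contraction q"
      using spec_mult[OF q, of "\<phi> a" "\<phi> b"] by (simp add: contraction_def phi_simps)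
  qed
  show "contraction q \<subseteq> P"
    using unit_notin[OF q] unfolding contraction_def by blast
qed

text \<open>Some y in q' but not in q is turned into a numerator by a denominator s; since \<phi> s
  lies outside q, the numerator separates the contractions.\<close>

lemma contraction_strict_mono:
  assumes q: "q \<in> spec R'" and q': "q' \<in> spec R'" and less: "q \<subset> q'"
  shows "contraction q \<subset> contraction q'"
proof
  show "contraction q \<subseteq> contraction q'" using less unfolding contraction_def by blast
  obtain y where y: "y \<in> q'" "y \<notin> q" using less by blast
  have yc: "y \<in> carrier R'" by (rule spec_carrier[OF q' y(1)])
  obtain s x where s: "s \<in> carrier R - P" and x: "x \<in> carrier R" "\<phi> s \<otimes>\<^bsub>R'\<^esub> y = \<phi> x" using fraction[OF yc] by blast
  have sc: "\<phi> s \<in> carrier R'" using s phi_simps(1) by blast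
  have "x \<in> contraction q'"
    using ideal.I_l_closed[OF spec_ideal[OF q'] y(1) sc] x by (simp add: contraction_def)
  moreover have "x \<notin> contraction q"
    using spec_mult[OF q sc yc] unit_notin[OF q s] y(2) x(2) by (auto simp: contraction_def)
  ultimately show "contraction q \<noteq> contraction q'" by blast
qed

text \<open>Chains in the localization become chains of the same length below P; this is how the
  dimension of the localization is reached from the original ring.\<close>

lemma contraction_chain:
  assumes qs: "prime_chain R' qs"
  shows "prime_chain R (map contraction qs)" "last (map contraction qs) \<subseteq> P"
proof -
  have sub: "set qs \<subseteq> spec R'" and ne: "qs \<noteq> []" and st: "sorted_wrt (\<subset>) qs"
    using qs by (auto simp: prime_chain_def)
  have "sorted_wrt (\<lambda>x y. contraction x \<subset> contraction y) qs"
    by (rule sorted_wrt_mono_rel[OF _ st]) (use sub contraction_strict_mono in blast)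
  then show "prime_chain R (map contraction qs)"
    using sub ne contraction_spec(1) by (auto simp: prime_chain_def sorted_wrt_map)
  show "last (map contraction qs) \<subseteq> P"
    using sub ne contraction_spec(2)[of "last qs"] last_in_set[OF ne] by (simp add: last_map subset_iff)
qed

text \<open>The extension of P to the localization, described by a single fraction with numerator in
  P.\<close>

definition loc_max_ideal :: "'b set" where
  "loc_max_ideal = {y \<in> carrier R'. \<exists>s\<in>carrier R - P. \<exists>x\<in>P. \<phi> s \<otimes>\<^bsub>R'\<^esub> y = \<phi> x}"

lemma P_carrier: "x \<in> P \<Longrightarrow> x \<in> carrier R"
  by (rule spec_carrier[OF P_spec])

lemma P_ideal: "ideal P R"
  by (rule spec_ideal[OF P_spec])

text \<open>Membership may be tested on any fraction: two fractions for y give s'x and sx' with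
  equal image, their difference is killed by some t outside P, and ts' lies outside P.\<close>

lemma loc_max_ideal_iff:
  assumes y: "y \<in> carrier R'" and s: "s \<in> carrier R - P" and x: "x \<in> carrier R" and e: "\<phi> s \<otimes>\<^bsub>R'\<^esub> y = \<phi> x"
  shows "y \<in> loc_max_ideal \<longleftrightarrow> x \<in> P"
proof
  assume "y \<in> loc_max_ideal"
  then obtain s' x' where s': "s' \<in> carrier R - P" and x': "x' \<in> P" "\<phi> s' \<otimes>\<^bsub>R'\<^esub> y = \<phi> x'"
    unfolding loc_max_ideal_def by blast
  have c: "s \<in> carrier R" "s' \<in> carrier R" "x' \<in> carrier R" using s s' P_carrier[OF x'(1)] by blast+
  note pc = phi_simps(1)[OF c(1)] phi_simps(1)[OF c(2)] phi_simps(1)[OF c(3)] phi_simps(1)[OF x]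
  have "\<phi> (s' \<otimes>\<^bsub>R\<^esub> x) = \<phi> s' \<otimes>\<^bsub>R'\<^esub> (\<phi> s \<otimes>\<^bsub>R'\<^esub> y)" using c x e by (simp add: phi_simps)
  also have "\<dots> = \<phi> s \<otimes>\<^bsub>R'\<^esub> (\<phi> s' \<otimes>\<^bsub>R'\<^esub> y)" using pc y by (simp add: R'.m_lcomm)
  also have "\<dots> = \<phi> (s \<otimes>\<^bsub>R\<^esub> x')" using c x'(2) by (simp add: phi_simps)
  finally have eq: "\<phi> (s' \<otimes>\<^bsub>R\<^esub> x) = \<phi> (s \<otimes>\<^bsub>R\<^esub> x')" .
  let ?D = "s' \<otimes>\<^bsub>R\<^esub> x \<ominus>\<^bsub>R\<^esub> s \<otimes>\<^bsub>R\<^esub> x'"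
  have "\<phi> ?D \<oplus>\<^bsub>R'\<^esub> \<phi> (s \<otimes>\<^bsub>R\<^esub> x') = \<phi> (?D \<oplus>\<^bsub>R\<^esub> s \<otimes>\<^bsub>R\<^esub> x')" using c x by (simp add: phi_simps)
  also have "?D \<oplus>\<^bsub>R\<^esub> s \<otimes>\<^bsub>R\<^esub> x' = s' \<otimes>\<^bsub>R\<^esub> x" using c x by (simp add: a_minus_def R.a_assoc R.l_neg)
  finally have "\<phi> ?D \<oplus>\<^bsub>R'\<^esub> \<phi> (s \<otimes>\<^bsub>R\<^esub> x') = \<phi> (s \<otimes>\<^bsub>R\<^esub> x')" using eq by simp
  then have "\<phi> ?D = \<zero>\<^bsub>R'\<^esub>" using c x phi_simps(1)[of ?D] phi_simps(1)[of "s \<otimes>\<^bsub>R\<^esub> x'"] by simp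
  then obtain t where t: "t \<in> carrier R - P" "t \<otimes>\<^bsub>R\<^esub> ?D = \<zero>\<^bsub>R\<^esub>" using kernel[of ?D] c x by auto
  have tc: "t \<in> carrier R" using t by blast
  have "t \<otimes>\<^bsub>R\<^esub> (s' \<otimes>\<^bsub>R\<^esub> x) \<ominus>\<^bsub>R\<^esub> t \<otimes>\<^bsub>R\<^esub> (s \<otimes>\<^bsub>R\<^esub> x') = \<zero>\<^bsub>R\<^esub>"
    using t(2) tc c x by (simp add: a_minus_def R.r_distr R.r_minus)
  then have "t \<otimes>\<^bsub>R\<^esub> (s' \<otimes>\<^bsub>R\<^esub> x) = t \<otimes>\<^bsub>R\<^esub> (s \<otimes>\<^bsub>R\<^esub> x')" using tc c x by simp
  moreover have "t \<otimes>\<^bsub>R\<^esub> (s \<otimes>\<^bsub>R\<^esub> x') \<in> P"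
    using ideal.I_l_closed[OF P_ideal] x'(1) c(1) tc by blast
  ultimately have "(t \<otimes>\<^bsub>R\<^esub> s') \<otimes>\<^bsub>R\<^esub> x \<in> P" using tc c x by (simp add: R.m_assoc)
  then show "x \<in> P" using spec_mult[OF P_spec, of "t \<otimes>\<^bsub>R\<^esub> s'" x] P_mult_closed[OF t(1) s'] x by blast
next
  assume "x \<in> P"
  then show "y \<in> loc_max_ideal" using y s e unfolding loc_max_ideal_def by blast
qed

lemma phi_loc_max_ideal: "x \<in> carrier R \<Longrightarrow> \<phi> x \<in> loc_max_ideal \<longleftrightarrow> x \<in> P"
  using loc_max_ideal_iff[of "\<phi> x" "\<one>\<^bsub>R\<^esub>" x] phi_simps spec_one[OF P_spec] by simp

lemma loc_max_ideal: "ideal loc_max_ideal R'"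
proof (rule R'.ideal_intro)
  show "loc_max_ideal \<subseteq> carrier R'" unfolding loc_max_ideal_def by (rule Collect_restrict)
  show "\<zero>\<^bsub>R'\<^esub> \<in> loc_max_ideal"
    using phi_loc_max_ideal[of "\<zero>\<^bsub>R\<^esub>"] phi_zero additive_subgroup.zero_closed[OF ideal.axioms(1)[OF P_ideal]] by simp
next
  fix a assume "a \<in> loc_max_ideal"
  then obtain s x where a: "a \<in> carrier R'" "s \<in> carrier R - P" "x \<in> P" "\<phi> s \<otimes>\<^bsub>R'\<^esub> a = \<phi> x"
    unfolding loc_max_ideal_def by blast
  note xc = P_carrier[OF a(3)]
  have sc: "s \<in> carrier R" using a by blast
  {
    fix b assume "b \<in> loc_max_ideal"
    then obtain t z where b: "b \<in> carrier R'" "t \<in> carrier R - P" "z \<in> P" "\<phi> t \<otimes>\<^bsub>R'\<^esub> b = \<phi> z"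
      unfolding loc_max_ideal_def by blast
    note zc = P_carrier[OF b(3)]
    have tc: "t \<in> carrier R" using b by blast
    note pc = phi_simps(1)[OF sc] phi_simps(1)[OF tc]
    have "\<phi> (s \<otimes>\<^bsub>R\<^esub> t) \<otimes>\<^bsub>R'\<^esub> (a \<oplus>\<^bsub>R'\<^esub> b) = \<phi> t \<otimes>\<^bsub>R'\<^esub> (\<phi> s \<otimes>\<^bsub>R'\<^esub> a) \<oplus>\<^bsub>R'\<^esub> \<phi> s \<otimes>\<^bsub>R'\<^esub> (\<phi> t \<otimes>\<^bsub>R'\<^esub> b)"
      using sc tc pc a(1) b(1) by (simp add: phi_simps R'.r_distr R'.m_ac)
    also have "\<dots> = \<phi> (t \<otimes>\<^bsub>R\<^esub> x \<oplus>\<^bsub>R\<^esub> s \<otimes>\<^bsub>R\<^esub> z)" using sc tc xc zc a(4) b(4) by (simp add: phi_simps)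
    finally have e: "\<phi> (s \<otimes>\<^bsub>R\<^esub> t) \<otimes>\<^bsub>R'\<^esub> (a \<oplus>\<^bsub>R'\<^esub> b) = \<phi> (t \<otimes>\<^bsub>R\<^esub> x \<oplus>\<^bsub>R\<^esub> s \<otimes>\<^bsub>R\<^esub> z)" .
    have "t \<otimes>\<^bsub>R\<^esub> x \<oplus>\<^bsub>R\<^esub> s \<otimes>\<^bsub>R\<^esub> z \<in> P"
      using additive_subgroup.a_closed[OF ideal.axioms(1)[OF P_ideal]] ideal.I_l_closed[OF P_ideal] a(3) b(3) sc tc by simp
    then show "a \<oplus>\<^bsub>R'\<^esub> b \<in> loc_max_ideal"
      using loc_max_ideal_iff[OF _ P_mult_closed[OF a(2) b(2)] _ e] a(1) b(1) xc zc sc tc by simp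
  }
  fix r assume r: "r \<in> carrier R'"
  obtain t z where t: "t \<in> carrier R - P" and z: "z \<in> carrier R" "\<phi> t \<otimes>\<^bsub>R'\<^esub> r = \<phi> z" using fraction[OF r] by blast
  have tc: "t \<in> carrier R" using t by blast
  note pc = phi_simps(1)[OF sc] phi_simps(1)[OF tc]
  have "\<phi> (s \<otimes>\<^bsub>R\<^esub> t) \<otimes>\<^bsub>R'\<^esub> (r \<otimes>\<^bsub>R'\<^esub> a) = (\<phi> t \<otimes>\<^bsub>R'\<^esub> r) \<otimes>\<^bsub>R'\<^esub> (\<phi> s \<otimes>\<^bsub>R'\<^esub> a)"
    using sc tc pc a(1) r by (simp add: phi_simps R'.m_ac)
  also have "\<dots> = \<phi> (z \<otimes>\<^bsub>R\<^esub> x)" using z xc a(4) by (simp add: phi_simps)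
  finally have e: "\<phi> (s \<otimes>\<^bsub>R\<^esub> t) \<otimes>\<^bsub>R'\<^esub> (r \<otimes>\<^bsub>R'\<^esub> a) = \<phi> (z \<otimes>\<^bsub>R\<^esub> x)" .
  show "r \<otimes>\<^bsub>R'\<^esub> a \<in> loc_max_ideal"
    using loc_max_ideal_iff[OF _ P_mult_closed[OF a(2) t] _ e] a(1) r xc z(1) ideal.I_l_closed[OF P_ideal a(3) z(1)] by simp
qed

text \<open>An element outside \<open>loc_max_ideal\<close> has a numerator outside P, hence is a
  unit and lies in no proper ideal.\<close>

lemma ideal_le_loc_max_ideal:
  assumes J: "ideal J R'" "J \<noteq> carrier R'"
  shows "J \<subseteq> loc_max_ideal"
proof
  fix y assume y: "y \<in> J"
  note yc = ideal.Icarr[OF J(1) y]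
  show "y \<in> loc_max_ideal"
  proof (rule ccontr)
    assume n: "y \<notin> loc_max_ideal"
    obtain s x where s: "s \<in> carrier R - P" and x: "x \<in> carrier R" "\<phi> s \<otimes>\<^bsub>R'\<^esub> y = \<phi> x" using fraction[OF yc] by blast
    have "x \<notin> P" using n loc_max_ideal_iff[OF yc s x] by blast
    then obtain t where t: "t \<in> carrier R'" "t \<otimes>\<^bsub>R'\<^esub> \<phi> x = \<one>\<^bsub>R'\<^esub>" using unit x(1) by blast
    have sc: "\<phi> s \<in> carrier R'" using s phi_simps(1) by blast
    have "t \<otimes>\<^bsub>R'\<^esub> (\<phi> s \<otimes>\<^bsub>R'\<^esub> y) \<in> J"
      using ideal.I_l_closed[OF J(1) ideal.I_l_closed[OF J(1) y sc] t(1)] .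
    then have "\<one>\<^bsub>R'\<^esub> \<in> J" using t(2) x(2) by simp
    then show False using ideal.one_imp_carrier[OF J(1)] J(2) by blast
  qed
qed

lemma local_ring_loc: "local_ring R' loc_max_ideal"
proof -
  have one: "\<one>\<^bsub>R'\<^esub> \<notin> loc_max_ideal"
    using phi_loc_max_ideal[of "\<one>\<^bsub>R\<^esub>"] spec_one[OF P_spec] phi_simps(4) by simp
  have ne: "loc_max_ideal \<noteq> carrier R'" using one R'.one_closed by blast
  have max: "maximalideal loc_max_ideal R'"
  proof (rule maximalidealI[OF loc_max_ideal])
    show "carrier R' \<noteq> loc_max_ideal" using ne by simp
    fix J assume J: "ideal J R'" "loc_max_ideal \<subseteq> J"
    show "J = loc_max_ideal \<or> J = carrier R'" using ideal_le_loc_max_ideal[OF J(1)] J(2) by blast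
  qed
  have "J = loc_max_ideal" if J: "maximalideal J R'" for J
  proof -
    have id: "ideal J R'" "carrier R' \<noteq> J" using J by (simp_all add: maximalideal_def maximalideal_axioms_def)
    have "J \<subseteq> loc_max_ideal" using ideal_le_loc_max_ideal[OF id(1)] id(2) by simp
    then show ?thesis
      using maximalideal.I_maximal[OF J loc_max_ideal] ideal.Icarr[OF loc_max_ideal] ne by blast
  qed
  then show ?thesis unfolding local_ring_def using max R'.is_cring by blast
qed

text \<open>An ideal of the localization is generated by the image of its contraction, so images of
  finitely many generators of the contraction suffice.\<close>

lemma noetherian_loc:
  assumes "noetherian_ring R"
  shows "noetherian_ring R'"
proof (rule R'.noetherian_ringI)
  fix I assume I: "ideal I R'"
  obtain B where B: "B \<subseteq> carrier R" "finite B" "contraction I = genideal R B"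
    using noetherian_ring.finetely_gen[OF assms contraction_ideal[OF I]] by blast
  have Bc: "\<phi> ` B \<subseteq> carrier R'" using B(1) phi_simps(1) by blast
  note G = R'.genideal_ideal[OF Bc]
  have "B \<subseteq> contraction I" using R.genideal_self[OF B(1)] B(3) by simp
  then have "\<phi> ` B \<subseteq> I" unfolding contraction_def by blast
  then have 1: "genideal R' (\<phi> ` B) \<subseteq> I" by (rule R'.genideal_minimal[OF I])
  have "B \<subseteq> contraction (genideal R' (\<phi> ` B))"
    using R'.genideal_self[OF Bc] B(1) unfolding contraction_def by blast
  then have 2: "contraction I \<subseteq> contraction (genideal R' (\<phi> ` B))"
    unfolding B(3) by (rule R.genideal_minimal[OF contraction_ideal[OF G]])
  have "I \<subseteq> genideal R' (\<phi> ` B)"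
  proof
    fix y assume y: "y \<in> I"
    note yc = ideal.Icarr[OF I y]
    obtain s x where s: "s \<in> carrier R - P" and x: "x \<in> carrier R" "\<phi> s \<otimes>\<^bsub>R'\<^esub> y = \<phi> x" using fraction[OF yc] by blast
    have sc: "\<phi> s \<in> carrier R'" using s phi_simps(1) by blast
    have "x \<in> contraction I" using ideal.I_l_closed[OF I y sc] x by (simp add: contraction_def)
    then have "\<phi> s \<otimes>\<^bsub>R'\<^esub> y \<in> genideal R' (\<phi> ` B)" using 2 x(2) by (auto simp: contraction_def)
    moreover obtain t where t: "t \<in> carrier R'" "t \<otimes>\<^bsub>R'\<^esub> \<phi> s = \<one>\<^bsub>R'\<^esub>" using unit s by blast
    ultimately have "t \<otimes>\<^bsub>R'\<^esub> (\<phi> s \<otimes>\<^bsub>R'\<^esub> y) \<in> genideal R' (\<phi> ` B)" using ideal.I_l_closed[OF G] by blast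
    then show "y \<in> genideal R' (\<phi> ` B)" using t sc yc by (simp add: R'.m_assoc[symmetric])
  qed
  with 1 have "I = genideal R' (\<phi> ` B)" by blast
  then show "\<exists>A\<subseteq>carrier R'. finite A \<and> I = genideal R' A" using B(2) Bc by blast
qed

end

section \<open>Cohomology under localization maps\<close>

text \<open>The images of generators generate: the preimage of a submodule N containing them is an
  \<open>H0 A\<close>-submodule and hence everything, and each class of L comes from M after
  multiplication by some \<phi> s, which is invertible.\<close>

lemma (in loc_map) fin_gen_cohomology:
  assumes unit: "\<And>s. s \<in> S \<Longrightarrow> \<exists>t\<in>deg_part A' 0. t \<otimes>\<^bsub>A'\<^esub> \<phi> s = \<one>\<^bsub>A'\<^esub>"
    and fg: "fin_gen_module (H0 A) (cohomology M n)"
  shows "fin_gen_module (H0 A') (cohomology L n)"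
proof -
  interpret HM: module "H0 A" "cohomology M n" by (rule M.cohomology_module)
  interpret HL: module "H0 A'" "cohomology L n" by (rule L.cohomology_module)
  let ?f = "coh_map M n L n \<psi>"
  have f: "?f (coh_class M n u) = coh_class L n (\<psi> u)" if "u \<in> cocycles M n" for u
    by (rule coh_map_class[OF M.cplx_axioms L.cplx_axioms psi_cocycle psi_coboundary _ that])
      (use psi_add M.cocycle_closed in auto)
  obtain F where F: "finite F" "F \<subseteq> carrier (cohomology M n)"
    "\<And>N. submodule N (H0 A) (cohomology M n) \<Longrightarrow> F \<subseteq> N \<Longrightarrow> N = carrier (cohomology M n)"
    using fg unfolding fin_gen_module_def by blast
  have fc: "?f X \<in> carrier (cohomology L n)" if "X \<in> carrier (cohomology M n)" for X
    using that f psi_cocycle L.coh_class_closed by (metis M.cohomologyE)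
  have "N = carrier (cohomology L n)" if N: "submodule N (H0 A') (cohomology L n)" and FN: "?f ` F \<subseteq> N" for N
  proof
    show "N \<subseteq> carrier (cohomology L n)" by (rule HL.submoduleE(1)[OF N])
    let ?N = "{X \<in> carrier (cohomology M n). ?f X \<in> N}"
    have "submodule ?N (H0 A) (cohomology M n)"
    proof (rule HM.submodule_intro)
      have z: "\<zero>\<^bsub>M\<^esub> \<in> cocycles M n" by (rule M.submodule_zero[OF M.cocycle_submodule])
      have zz: "\<zero>\<^bsub>cohomology M n\<^esub> = coh_class M n \<zero>\<^bsub>M\<^esub>"
        using M.coh_class_zero_iff[of "\<zero>\<^bsub>M\<^esub>" n] M.submodule_zero[OF M.coboundary_submodule] by simp
      have "coh_class L n \<zero>\<^bsub>L\<^esub> = \<zero>\<^bsub>cohomology L n\<^esub>"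
        using L.coh_class_zero_iff[of "\<zero>\<^bsub>L\<^esub>" n] L.submodule_zero[OF L.coboundary_submodule] by simp
      then show "\<zero>\<^bsub>cohomology M n\<^esub> \<in> ?N"
        using HL.submodule_zero[OF N] M.coh_class_closed[OF z] f[OF z] psi_zero unfolding zz by simp
    next
      fix X Y assume XY: "X \<in> ?N" "Y \<in> ?N"
      then obtain u v where u: "u \<in> cocycles M n" "X = coh_class M n u" and v: "v \<in> cocycles M n" "Y = coh_class M n v"
        using M.cohomologyE by (metis (no_types, lifting) mem_Collect_eq)
      have "?f (X \<oplus>\<^bsub>cohomology M n\<^esub> Y) = ?f X \<oplus>\<^bsub>cohomology L n\<^esub> ?f Y"
        unfolding u(2) v(2) M.add_cohomology[OF M.cocycle_closed[OF u(1)] M.cocycle_closed[OF v(1)]]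
          f[OF u(1)] f[OF v(1)] f[OF M.cocycle_add[OF u(1) v(1)]]
          L.add_cohomology[OF L.cocycle_closed[OF psi_cocycle[OF u(1)]] L.cocycle_closed[OF psi_cocycle[OF v(1)]]]
        using psi_add M.cocycle_closed u(1) v(1) by simp
      then show "X \<oplus>\<^bsub>cohomology M n\<^esub> Y \<in> ?N" using XY HL.submoduleE(5)[OF N] by simp
    next
      fix x X assume x: "x \<in> carrier (H0 A)" and X: "X \<in> ?N"
      then obtain u where u: "u \<in> cocycles M n" "X = coh_class M n u"
        using M.cohomologyE by (metis (no_types, lifting) mem_Collect_eq)
      note l = M.dg.H0_lift_closed[OF x]
      have "?f (x \<odot>\<^bsub>cohomology M n\<^esub> X) = H0_proj A' (\<phi> (H0_lift A x)) \<odot>\<^bsub>cohomology L n\<^esub> ?f X"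
        unfolding u(2) M.smult_cohomology_lift[OF x u(1)] f[OF u(1)] f[OF M.cocycle_smult[OF l u(1)]]
          L.smult_cohomology[OF phi_closed[OF l] psi_cocycle[OF u(1)]]
        using psi_smult[OF l M.cocycle_closed[OF u(1)]] by simp
      then show "x \<odot>\<^bsub>cohomology M n\<^esub> X \<in> ?N"
        using X x HL.submoduleE(4)[OF N L.dg.H0_proj_closed[OF phi_closed[OF l]]] by simp
    qed (rule Collect_restrict)
    moreover have "F \<subseteq> ?N" using F(2) FN by blast
    ultimately have all: "?N = carrier (cohomology M n)" by (rule F(3))
    show "carrier (cohomology L n) \<subseteq> N"
    proof
      fix Z assume "Z \<in> carrier (cohomology L n)"
      then obtain z where z: "z \<in> cocycles L n" "Z = coh_class L n z" by (rule L.cohomologyE)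
      obtain s u where s: "s \<in> S" and u: "u \<in> cocycles M n" "\<phi> s \<odot>\<^bsub>L\<^esub> z = \<psi> u" using cocycle_fraction[OF z(1)] by blast
      obtain t where t: "t \<in> deg_part A' 0" "t \<otimes>\<^bsub>A'\<^esub> \<phi> s = \<one>\<^bsub>A'\<^esub>" using unit[OF s] by blast
      have "coh_class M n u \<in> ?N" using all M.coh_class_closed[OF u(1)] by simp
      then have "coh_class L n (\<psi> u) \<in> N" using f[OF u(1)] by simp
      then have "H0_proj A' t \<odot>\<^bsub>cohomology L n\<^esub> coh_class L n (\<psi> u) \<in> N"
        by (rule HL.submoduleE(4)[OF N L.dg.H0_proj_closed[OF t(1)]])
      moreover have "t \<odot>\<^bsub>L\<^esub> \<psi> u = z"
        using L.smult_assoc1[of t "\<phi> s" z] L.smult_one[of z] t S_phi[OF s] L.cocycle_closed[OF z(1)] u(2) by simp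
      ultimately show "Z \<in> N" using L.smult_cohomology[OF t(1) psi_cocycle[OF u(1)]] z(2) by simp
    qed
  qed
  moreover have "finite (?f ` F)" "?f ` F \<subseteq> carrier (cohomology L n)" using F(1,2) fc by blast+
  ultimately show ?thesis unfolding fin_gen_module_def by blast
qed

text \<open>For S = {1} the torsion that may die in L is trivial, so exactness is reflected as well
  as preserved.\<close>

lemma exact_at_iso:
  assumes "loc_map A M A' L \<phi> {\<one>\<^bsub>A\<^esub>} \<psi>"
  shows "exact_at M n \<longleftrightarrow> exact_at L n"
proof
  interpret loc_map A M A' L \<phi> "{\<one>\<^bsub>A\<^esub>}" \<psi> by fact
  show "exact_at M n \<Longrightarrow> exact_at L n" using exact_localize unfolding exact_at_def .
  assume L: "exact_at L n"
  show "exact_at M n"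
    unfolding exact_at_def
  proof
    fix u assume u: "u \<in> cocycles M n"
    then have "\<psi> u \<in> coboundaries L n" using L psi_cocycle unfolding exact_at_def by blast
    then have "\<one>\<^bsub>A\<^esub> \<odot>\<^bsub>M\<^esub> u \<in> coboundaries M n" using psi_coboundary_iff[OF u] by simp
    then show "u \<in> coboundaries M n" using M.smult_one[OF M.cocycle_closed[OF u]] by simp
  qed
qed

section \<open>Relabelling a complex by \<open>Leaf\<close>\<close>

lemma the_inv_Leaf [simp]: "the_inv Leaf (Leaf x) = x"
  by (rule the_inv_f_f) (simp add: inj_def)

lemma Leaf_image [simp]: "Leaf x \<in> Leaf ` S \<longleftrightarrow> x \<in> S"
  by (auto simp: image_iff)

lemma transport_Leaf_simps [simp]:
  "carrier (transport Leaf M) = Leaf ` carrier M"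
  "\<zero>\<^bsub>transport Leaf M\<^esub> = Leaf \<zero>\<^bsub>M\<^esub>"
  "Leaf x \<oplus>\<^bsub>transport Leaf M\<^esub> Leaf y = Leaf (x \<oplus>\<^bsub>M\<^esub> y)"
  "a \<odot>\<^bsub>transport Leaf M\<^esub> Leaf x = Leaf (a \<odot>\<^bsub>M\<^esub> x)"
  "mdeg_part (transport Leaf M) n = Leaf ` mdeg_part M n"
  "mdifferential (transport Leaf M) (Leaf x) = Leaf (mdifferential M x)"
  by (simp_all add: transport_def)

context cplx
begin

lemma transport_Leaf_cplx: "nest_cplx A (transport Leaf M)"
proof (intro nest_cplx.intro cplx.intro cplx_axioms.intro)
  have ab: "abelian_group (transport Leaf M)"
  proof (rule abelian_groupI)
    fix x assume "x \<in> carrier (transport Leaf M)"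
    then obtain p where "x = Leaf p" "p \<in> carrier M" by auto
    then show "\<exists>y\<in>carrier (transport Leaf M). y \<oplus>\<^bsub>transport Leaf M\<^esub> x = \<zero>\<^bsub>transport Leaf M\<^esub>"
      by (intro bexI[of _ "Leaf (\<ominus> p)"]) (simp_all add: M.l_neg)
  qed (auto simp: M.a_ac)
  show T: "module (deg0_ring A) (transport Leaf M)"
    by (rule moduleI[OF dg.deg0_cring ab])
      (use smult_l_distr smult_assoc1 smult_one in \<open>auto simp: smult_r_distr\<close>)
  show "dg_ring A" by (rule dg.dg_ring_axioms)
  show "submodule (mdeg_part (transport Leaf M) n) (deg0_ring A) (transport Leaf M)" for n
    by (rule module.submodule_intro[OF T]) (auto simp: gr_closed gr_zero gr_add gr_smult)
  show "\<exists>h. nullhomotopy A (transport Leaf M) c h" if c: "c \<in> boundary_ideal A" for c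
  proof -
    obtain h where "nullhomotopy A M c h" using ex_nullhomotopy[OF c] by blast
    then have "nullhomotopy A (transport Leaf M) c (\<lambda>z. case z of Leaf x \<Rightarrow> Leaf (h x) | Node p \<Rightarrow> Node p)"
      unfolding nullhomotopy_def by auto
    then show ?thesis by blast
  qed
qed (auto simp: d_closed d_add d_smult d_degree d_d)

text \<open>The relabelling is viewed as a localization at {1}, so that finite generation and
  exactness transfer along it.\<close>

lemma loc_map_Leaf: "loc_map A M A (transport Leaf M) id {\<one>\<^bsub>A\<^esub>} Leaf"
proof (intro loc_map.intro loc_map_axioms.intro)
  show "cplx A (transport Leaf M)" by (rule nest_cplx.axioms[OF transport_Leaf_cplx])
  show "\<exists>s\<in>{\<one>\<^bsub>A\<^esub>}. \<exists>x\<in>mdeg_part M n. id s \<odot>\<^bsub>transport Leaf M\<^esub> l = Leaf x"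
    if "l \<in> mdeg_part (transport Leaf M) n" for l n
    using that gr_closed smult_one by auto
  show "\<exists>l'\<in>mdeg_part (transport Leaf M) n. id s \<odot>\<^bsub>transport Leaf M\<^esub> l' = l"
    if "s \<in> {\<one>\<^bsub>A\<^esub>}" "l \<in> mdeg_part (transport Leaf M) n" for s l n
    using that gr_closed smult_one by (intro bexI[of _ l]) auto
qed (use gr_closed smult_one dg.deg_one dg.gr_closed cplx_axioms in auto)

end

lemma loc_map_transport_Leaf:
  assumes "loc_map A M A' L \<phi> S \<psi>"
  shows "\<exists>\<psi>'. loc_map A (transport Leaf M) A' (transport Leaf L) \<phi> S \<psi>'"
proof -
  interpret loc_map A M A' L \<phi> S \<psi> by fact
  define \<psi>' where "\<psi>' = (\<lambda>z. case z of Leaf x \<Rightarrow> Leaf (\<psi> x) | Node p \<Rightarrow> Leaf \<zero>\<^bsub>L\<^esub>)"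
  have psi' [simp]: "\<psi>' (Leaf x) = Leaf (\<psi> x)" for x by (simp add: \<psi>'_def)
  show ?thesis
  proof (intro exI loc_map.intro loc_map_axioms.intro)
    show "cplx A (transport Leaf M)" by (rule nest_cplx.axioms[OF M.transport_Leaf_cplx])
    show "cplx A' (transport Leaf L)" by (rule nest_cplx.axioms[OF L.transport_Leaf_cplx])
    show "\<psi>' x \<in> carrier (transport Leaf L)" if "x \<in> carrier (transport Leaf M)" for x
      using that psi_closed by auto
    show "\<exists>s\<in>S. \<exists>x\<in>mdeg_part (transport Leaf M) n. \<phi> s \<odot>\<^bsub>transport Leaf L\<^esub> l = \<psi>' x"
      if lg: "l \<in> mdeg_part (transport Leaf L) n" for l n
    proof -
      obtain p where p: "l = Leaf p" "p \<in> mdeg_part L n" using lg by auto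
      obtain s x where "s \<in> S" "x \<in> mdeg_part M n" "\<phi> s \<odot>\<^bsub>L\<^esub> p = \<psi> x" using psi_fraction[OF p(2)] by blast
      then show ?thesis using p(1) by (intro bexI[of _ s] bexI[of _ "Leaf x"]) simp_all
    qed
    show "\<exists>l'\<in>mdeg_part (transport Leaf L) n. \<phi> s \<odot>\<^bsub>transport Leaf L\<^esub> l' = l"
      if s: "s \<in> S" and lg: "l \<in> mdeg_part (transport Leaf L) n" for s l n
    proof -
      obtain p where p: "l = Leaf p" "p \<in> mdeg_part L n" using lg by auto
      obtain p' where "p' \<in> mdeg_part L n" "\<phi> s \<odot>\<^bsub>L\<^esub> p' = p" using S_div[OF s p(2)] by blast
      then show ?thesis using p(1) by (intro bexI[of _ "Leaf p'"]) simp_all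
    qed
    show "l = \<zero>\<^bsub>transport Leaf L\<^esub>"
      if "s \<in> S" "l \<in> mdeg_part (transport Leaf L) n" "\<phi> s \<odot>\<^bsub>transport Leaf L\<^esub> l = \<zero>\<^bsub>transport Leaf L\<^esub>" for s l n
      using that S_inj by auto
    show "\<exists>s\<in>S. s \<odot>\<^bsub>transport Leaf M\<^esub> x = \<zero>\<^bsub>transport Leaf M\<^esub>"
      if "x \<in> mdeg_part (transport Leaf M) n" "\<psi>' x = \<zero>\<^bsub>transport Leaf L\<^esub>" for x n
      using that psi_kernel by auto
  qed (use phi_closed phi_mult S_deg0 S_mult psi_add psi_smult psi_d psi_gr in auto)
qed

section \<open>A DG-ring as a module over itself\<close>

text \<open>The noetherian condition speaks of negative degrees only. In degree zero the class of
  \<one> generates, and positive degrees vanish.\<close>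

lemma (in dg_ring) self_cohomology_fin_gen:
  assumes "noetherian_dg_ring A"
  shows "fin_gen_module (H0 A) (cohomology (self_module A) n)"
proof -
  interpret C: cplx A "self_module A" by (rule self_cplx)
  interpret H: module "H0 A" "cohomology (self_module A) n" by (rule C.cohomology_module)
  consider "n < 0" | "n = 0" | "n > 0" by linarith
  then show ?thesis
  proof cases
    case 1
    then show ?thesis using assms by (simp add: noetherian_dg_ring_def)
  next
    case 2
    have one: "\<one> \<in> cocycles (self_module A) n" using 2 deg_one d_deg0 by (simp add: cocycles_def)
    have "N = carrier (cohomology (self_module A) n)"
      if N: "submodule N (H0 A) (cohomology (self_module A) n)" and F: "{coh_class (self_module A) n \<one>} \<subseteq> N" for N
    proof
      show "N \<subseteq> carrier (cohomology (self_module A) n)" by (rule H.submoduleE(1)[OF N])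
      show "carrier (cohomology (self_module A) n) \<subseteq> N"
      proof
        fix X assume "X \<in> carrier (cohomology (self_module A) n)"
        then obtain u where u: "u \<in> cocycles (self_module A) n" "X = coh_class (self_module A) n u" by (rule C.cohomologyE)
        have u0: "u \<in> deg_part A 0" using u(1) 2 by (simp add: cocycles_def)
        have "H0_proj A u \<odot>\<^bsub>cohomology (self_module A) n\<^esub> coh_class (self_module A) n \<one> \<in> N"
          using H.submoduleE(4)[OF N H0_proj_closed[OF u0]] F by blast
        then show "X \<in> N" using C.smult_cohomology[OF u0 one] u(2) gr_closed[OF u0] by simp
      qed
    qed
    then show ?thesis
      unfolding fin_gen_module_def using C.coh_class_closed[OF one]
      by (intro exI[of _ "{coh_class (self_module A) n \<one>}"]) blast
  next
    case 3
    have E: "carrier (cohomology (self_module A) n) = {\<zero>\<^bsub>cohomology (self_module A) n\<^esub>}"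
    proof -
      have u0: "u = \<zero>" if "u \<in> cocycles (self_module A) n" for u
        using that non_positive[OF 3] by (simp add: cocycles_def)
      have X0: "X = coh_class (self_module A) n \<zero>" if X: "X \<in> carrier (cohomology (self_module A) n)" for X
        by (rule C.cohomologyE[OF X]) (frule u0, simp)
      have Z: "coh_class (self_module A) n \<zero> = \<zero>\<^bsub>cohomology (self_module A) n\<^esub>"
        using C.coh_class_zero_iff[of \<zero> n] C.submodule_zero[OF C.coboundary_submodule] by simp
      show ?thesis
      proof (rule equalityI)
        show "carrier (cohomology (self_module A) n) \<subseteq> {\<zero>\<^bsub>cohomology (self_module A) n\<^esub>}"
          unfolding Z[symmetric] by (rule subsetI, drule X0, simp)
      qed (use H.zero_closed in simp)
    qed
    have "N = carrier (cohomology (self_module A) n)"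
      if N: "submodule N (H0 A) (cohomology (self_module A) n)" for N
    proof (rule equalityI)
      show "carrier (cohomology (self_module A) n) \<subseteq> N" unfolding E using H.submodule_zero[OF N] by simp
    qed (rule H.submoduleE(1)[OF N])
    then show ?thesis
      unfolding fin_gen_module_def by (intro exI[of _ "{}"]) simp
  qed
qed

lemma (in dg_ring) self_fin_cplx:
  assumes "noetherian_dg_ring A"
  shows "fin_cplx A (transport Leaf (self_module A))"
proof -
  interpret C: cplx A "self_module A" by (rule self_cplx)
  interpret T: nest_cplx A "transport Leaf (self_module A)" by (rule C.transport_Leaf_cplx)
  have "fin_gen_module (H0 A) (cohomology (transport Leaf (self_module A)) n)" for n
    by (rule loc_map.fin_gen_cohomology[OF C.loc_map_Leaf _ self_cohomology_fin_gen[OF assms]])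
      (use deg_one in \<open>auto intro!: bexI[of _ \<one>]\<close>)
  then have "noeth_module (H0 A) (cohomology (transport Leaf (self_module A)) n)" for n
    using module.noeth_moduleI[OF T.cohomology_module] assms by (simp add: noetherian_dg_ring_def)
  then show ?thesis unfolding fin_cplx_def using T.nest_cplx_axioms by blast
qed

text \<open>The nonzero degrees are bounded below and contain 0, where \<one> gives a nonzero class.
  The shift by N moves the search for the least one to the natural numbers.\<close>

lemma (in dg_ring) self_inf_at:
  assumes "bounded_cohomology A" "\<one>\<^bsub>H0 A\<^esub> \<noteq> \<zero>\<^bsub>H0 A\<^esub>"
  shows "inf_at (self_module A) (dg_inf (self_module A))"
proof -
  interpret C: cplx A "self_module A" by (rule self_cplx)
  obtain N where N: "\<And>i. i < N \<Longrightarrow> i \<notin> nonzero_degrees (self_module A)" using assms(1) unfolding bounded_cohomology_def by blast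
  have "\<one> \<notin> boundary_ideal A" using assms(2) H0_proj_zero_iff[OF deg_one] H0_proj_one by simp
  then have z: "0 \<in> nonzero_degrees (self_module A)"
    unfolding C.nonzero_degrees_iff using deg_one d_deg0[OF deg_one] by (auto simp: cocycles_def)
  let ?P = "\<lambda>k::nat. N + int k \<in> nonzero_degrees (self_module A)"
  have "N \<le> 0" using N z by force
  then have "?P (nat (- N))" using z by simp
  then have L: "?P (LEAST k. ?P k)" by (rule LeastI)
  let ?i = "N + int (LEAST k. ?P k)"
  have "j \<notin> nonzero_degrees (self_module A)" if "j < ?i" for j
  proof (cases "j < N")
    case False
    then have "\<not> ?P (nat (j - N))" using that by (intro not_less_Least) simp
    then show ?thesis using False by simp
  qed (use N in blast)
  then have "inf_at (self_module A) ?i"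
    using L unfolding inf_at_def exact_at_def C.nonzero_degrees_iff by blast
  then show ?thesis using dg_inf_inf_at[OF self_cplx] by simp
qed

section \<open>Localization of DG-rings\<close>

text \<open>\<open>decomposes\<close> sums over the support only; padding with zeros makes its
  uniqueness available over a common finite index set.\<close>

lemma (in graded_complex) finsum_homogeneous_unique:
  assumes K: "finite K" and f: "\<And>n. n \<in> K \<Longrightarrow> f n \<in> gr n" and g: "\<And>n. n \<in> K \<Longrightarrow> g n \<in> gr n"
    and eq: "(\<Oplus>n\<in>K. f n) = (\<Oplus>n\<in>K. g n)" and n: "n \<in> K"
  shows "f n = g n"
proof -
  have dec: "decomposes G gr (\<Oplus>n\<in>K. h n) (\<lambda>n. if n \<in> K then h n else \<zero>)"
    if h: "\<And>n. n \<in> K \<Longrightarrow> h n \<in> gr n" for h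
  proof -
    let ?h = "\<lambda>n. if n \<in> K then h n else \<zero>"
    have sub: "{n. ?h n \<noteq> \<zero>} \<subseteq> K" by auto
    have "(\<Oplus>n\<in>{n. ?h n \<noteq> \<zero>}. ?h n) = (\<Oplus>n\<in>K. h n)"
      by (rule add.finprod_mono_neutral_cong_left[OF K sub]) (use h gr_closed in auto)
    then show ?thesis
      unfolding decomposes_def using h gr_zero finite_subset[OF sub K] by auto
  qed
  have "(\<Oplus>n\<in>K. f n) \<in> carrier G" using f gr_closed by (intro finsum_closed) blast
  then have "(\<lambda>n. if n \<in> K then f n else \<zero>) = (\<lambda>n. if n \<in> K then g n else \<zero>)"
    using decomposes_unique dec[OF f] dec[OF g] eq by metis
  then show ?thesis using n by (meson fun_cong)
qed

text \<open>Graded commutativity concerns homogeneous elements; a general x is decomposed, and each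
  component commutes with s.\<close>

lemma (in dg_ring) deg0_central_carrier:
  assumes s: "s \<in> deg_part A 0" and x: "x \<in> carrier A"
  shows "x \<otimes> s = s \<otimes> x"
proof -
  obtain f where "decomposes A (deg_part A) x f" using gr_direct_sum[OF x] by blast
  then have f: "\<And>n. f n \<in> deg_part A n" "finite {n. f n \<noteq> \<zero>}" "x = (\<Oplus>n\<in>{n. f n \<noteq> \<zero>}. f n)"
    by (auto simp: decomposes_def)
  note sc = gr_closed[OF s]
  have fc: "f \<in> {n. f n \<noteq> \<zero>} \<rightarrow> carrier A" using f(1) gr_closed by blast
  have "x \<otimes> s = (\<Oplus>n\<in>{n. f n \<noteq> \<zero>}. f n \<otimes> s)" unfolding f(3) by (rule finsum_ldistr[OF f(2) sc fc])
  also have "\<dots> = (\<Oplus>n\<in>{n. f n \<noteq> \<zero>}. s \<otimes> f n)"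
    using deg0_central[OF s f(1)] fc sc by (intro finsum_cong') auto
  also have "\<dots> = s \<otimes> x" unfolding f(3) by (rule finsum_rdistr[OF f(2) sc fc, symmetric])
  finally show ?thesis .
qed

section \<open>The DG-ring of fractions\<close>

locale dg_loc = dg_ring A for A :: "'a dg_ring" (structure) +
  fixes P :: "'a set set"
  assumes P_spec: "P \<in> spec (H0 A)"
begin

abbreviation S where "S \<equiv> lift_compl A P"

abbreviation L where "L \<equiv> dg_localization A P"

definition fr :: "'a \<Rightarrow> 'a \<Rightarrow> ('a \<times> 'a) set" where
  "fr a s = loc_frac (self_module A) S a s"

lemma S_deg0: "s \<in> S \<Longrightarrow> s \<in> deg_part A 0"
  by (simp add: lift_compl_def)

lemma S_carrier [simp]: "s \<in> S \<Longrightarrow> s \<in> carrier A"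
  using S_deg0 gr_closed by blast

lemma S_one [simp]: "\<one> \<in> S"
  using spec_one[OF P_spec] deg_one by (simp add: lift_compl_def H0_proj_one)

lemma S_mult [simp]: "s \<in> S \<Longrightarrow> t \<in> S \<Longrightarrow> s \<otimes> t \<in> S"
  using spec_mult[OF P_spec, of "H0_proj A s" "H0_proj A t"] deg_mult[of s 0 t 0]
  by (auto simp: lift_compl_def H0_proj_simps H0_proj_closed)

lemma S_comm: "s \<in> S \<Longrightarrow> x \<in> carrier A \<Longrightarrow> x \<otimes> s = s \<otimes> x"
  using deg0_central_carrier S_deg0 by blast

lemma S_lcomm: "s \<in> S \<Longrightarrow> x \<in> carrier A \<Longrightarrow> y \<in> carrier A \<Longrightarrow> x \<otimes> (s \<otimes> y) = s \<otimes> (x \<otimes> y)"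
  using m_assoc[of x s y] m_assoc[of s x y] S_comm[of s x] by simp

lemma mem_fr:
  "(b, t) \<in> fr a s \<longleftrightarrow> b \<in> carrier A \<and> t \<in> S \<and> (\<exists>u\<in>S. u \<otimes> (t \<otimes> a) = u \<otimes> (s \<otimes> b))"
  by (simp add: fr_def loc_frac_def)

text \<open>The sets in \<open>loc_frac\<close> are the classes of the usual relation on pairs; one
  inclusion between classes is transitivity, the other follows by symmetry.\<close>

lemma fr_eq_iff:
  assumes a: "a \<in> carrier A" and s: "s \<in> S" and b: "b \<in> carrier A" and t: "t \<in> S"
  shows "fr a s = fr b t \<longleftrightarrow> (\<exists>u\<in>S. u \<otimes> (t \<otimes> a) = u \<otimes> (s \<otimes> b))"
proof
  assume "fr a s = fr b t"
  moreover have "(b, t) \<in> fr b t" using b t S_one mem_fr by blast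
  ultimately show "\<exists>u\<in>S. u \<otimes> (t \<otimes> a) = u \<otimes> (s \<otimes> b)" using mem_fr by blast
next
  have half: "fr a s \<subseteq> fr b t"
    if a: "a \<in> carrier A" and s: "s \<in> S" and b: "b \<in> carrier A" and t: "t \<in> S"
      and ex: "\<exists>u\<in>S. u \<otimes> (t \<otimes> a) = u \<otimes> (s \<otimes> b)" for a s b t
  proof
    fix p assume p: "p \<in> fr a s"
    obtain c r where cr: "p = (c, r)" by (cases p)
    obtain v where v: "c \<in> carrier A" "r \<in> S" "v \<in> S" "v \<otimes> (r \<otimes> a) = v \<otimes> (s \<otimes> c)"
      using p unfolding cr mem_fr by blast
    obtain u where u: "u \<in> S" "u \<otimes> (t \<otimes> a) = u \<otimes> (s \<otimes> b)" using ex by blast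
    \<comment> \<open>The witness for transitivity is the product of the two given witnesses and the
      middle denominator s.\<close>
    have "(u \<otimes> (v \<otimes> s)) \<otimes> (r \<otimes> b) = (v \<otimes> r) \<otimes> (u \<otimes> (s \<otimes> b))"
      using u v a s b t by (simp add: m_assoc S_lcomm)
    also have "\<dots> = (u \<otimes> t) \<otimes> (v \<otimes> (r \<otimes> a))"
      unfolding u(2)[symmetric] using u(1) v(1-3) a s b t by (simp add: m_assoc S_lcomm)
    also have "\<dots> = (u \<otimes> (v \<otimes> s)) \<otimes> (t \<otimes> c)"
      unfolding v(4) using u(1) v(1-3) a s b t by (simp add: m_assoc S_lcomm)
    finally show "p \<in> fr b t" unfolding cr mem_fr using u(1) v(1-3) s by (meson S_mult)
  qed
  assume ex: "\<exists>u\<in>S. u \<otimes> (t \<otimes> a) = u \<otimes> (s \<otimes> b)"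
  then have "\<exists>u\<in>S. u \<otimes> (s \<otimes> b) = u \<otimes> (t \<otimes> a)" by metis
  then show "fr a s = fr b t" using half[OF a s b t ex] half[OF b t a s] by blast
qed

lemma fr_eqI:
  assumes "a \<in> carrier A" "s \<in> S" "b \<in> carrier A" "t \<in> S" "t \<otimes> a = s \<otimes> b"
  shows "fr a s = fr b t"
  unfolding fr_eq_iff[OF assms(1-4)] using assms(5) S_one by metis

lemma fr_cancel: "a \<in> carrier A \<Longrightarrow> s \<in> S \<Longrightarrow> t \<in> S \<Longrightarrow> fr (t \<otimes> a) (t \<otimes> s) = fr a s"
  by (rule fr_eqI) (simp_all add: m_assoc S_lcomm)

text \<open>Collapses a union over representatives once all its members agree; the operations on
  fractions are evaluated in this way.\<close>

lemma UN_const: "x \<in> X \<Longrightarrow> (\<And>y. y \<in> X \<Longrightarrow> f y = c) \<Longrightarrow> (\<Union>y\<in>X. f y) = c"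
  by auto

lemma self_mem_fr: "a \<in> carrier A \<Longrightarrow> s \<in> S \<Longrightarrow> (a, s) \<in> fr a s"
  unfolding mem_fr using S_one by blast

lemma mem_fr_eq: "a \<in> carrier A \<Longrightarrow> s \<in> S \<Longrightarrow> (b, t) \<in> fr a s \<Longrightarrow> b \<in> carrier A \<and> t \<in> S \<and> fr b t = fr a s"
  using fr_eq_iff[of a s b t] unfolding mem_fr by blast

lemma L_carrier: "carrier L = {fr a s | a s. a \<in> carrier A \<and> s \<in> S}"
  by (simp add: dg_localization_def loc_module_def Let_def fr_def)

lemma L_deg_part: "deg_part L n = {fr a s | a s. a \<in> deg_part A n \<and> s \<in> S}"
  by (simp add: dg_localization_def Let_def fr_def)

lemma L_zero: "\<zero>\<^bsub>L\<^esub> = fr \<zero> \<one>"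
  by (simp add: dg_localization_def loc_module_def Let_def fr_def)

lemma L_one: "\<one>\<^bsub>L\<^esub> = fr \<one> \<one>"
  by (simp add: dg_localization_def Let_def fr_def)

text \<open>Independence of representatives in both arguments at once, because the defining unions
  range over pairs of representatives. The product uv of the given witnesses works for sum and
  product alike.\<close>

lemma fr_congruence:
  assumes a: "a \<in> carrier A" "s \<in> S" and a': "a' \<in> carrier A" "s' \<in> S" "fr a' s' = fr a s"
    and b: "b \<in> carrier A" "t \<in> S" and b': "b' \<in> carrier A" "t' \<in> S" "fr b' t' = fr b t"
  shows "fr (t' \<otimes> a' \<oplus> s' \<otimes> b') (s' \<otimes> t') = fr (t \<otimes> a \<oplus> s \<otimes> b) (s \<otimes> t)"
    and "fr (a' \<otimes> b') (s' \<otimes> t') = fr (a \<otimes> b) (s \<otimes> t)"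
proof -
  obtain u where u: "u \<in> S" "u \<otimes> (s \<otimes> a') = u \<otimes> (s' \<otimes> a)"
    using a'(3) unfolding fr_eq_iff[OF a'(1,2) a] by blast
  obtain v where v: "v \<in> S" "v \<otimes> (t \<otimes> b') = v \<otimes> (t' \<otimes> b)"
    using b'(3) unfolding fr_eq_iff[OF b'(1,2) b] by blast
  note c = a a'(1,2) b b'(1,2) u(1) v(1)
  have 1: "(u \<otimes> v) \<otimes> ((s \<otimes> t) \<otimes> (t' \<otimes> a')) = (u \<otimes> v) \<otimes> ((s' \<otimes> t') \<otimes> (t \<otimes> a))"
  proof -
    have "(u \<otimes> v) \<otimes> ((s \<otimes> t) \<otimes> (t' \<otimes> a')) = (v \<otimes> (t \<otimes> t')) \<otimes> (u \<otimes> (s \<otimes> a'))"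
      using c by (simp add: m_assoc S_lcomm)
    also have "\<dots> = (u \<otimes> v) \<otimes> ((s' \<otimes> t') \<otimes> (t \<otimes> a))" unfolding u(2) using c by (simp add: m_assoc S_lcomm)
    finally show ?thesis .
  qed
  have 2: "(u \<otimes> v) \<otimes> ((s \<otimes> t) \<otimes> (s' \<otimes> b')) = (u \<otimes> v) \<otimes> ((s' \<otimes> t') \<otimes> (s \<otimes> b))"
  proof -
    have "(u \<otimes> v) \<otimes> ((s \<otimes> t) \<otimes> (s' \<otimes> b')) = (u \<otimes> (s \<otimes> s')) \<otimes> (v \<otimes> (t \<otimes> b'))"
      using c by (simp add: m_assoc S_lcomm)
    also have "\<dots> = (u \<otimes> v) \<otimes> ((s' \<otimes> t') \<otimes> (s \<otimes> b))" unfolding v(2) using c by (simp add: m_assoc S_lcomm)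
    finally show ?thesis .
  qed
  have "(u \<otimes> v) \<otimes> ((s \<otimes> t) \<otimes> (t' \<otimes> a' \<oplus> s' \<otimes> b')) = (u \<otimes> v) \<otimes> ((s' \<otimes> t') \<otimes> (t \<otimes> a \<oplus> s \<otimes> b))"
    using c 1 2 by (simp add: r_distr)
  moreover have uv: "u \<otimes> v \<in> S" using c by simp
  ultimately show "fr (t' \<otimes> a' \<oplus> s' \<otimes> b') (s' \<otimes> t') = fr (t \<otimes> a \<oplus> s \<otimes> b) (s \<otimes> t)"
    using c by (subst fr_eq_iff) auto
  have "(u \<otimes> v) \<otimes> ((s \<otimes> t) \<otimes> (a' \<otimes> b')) = (u \<otimes> (s \<otimes> a')) \<otimes> (v \<otimes> (t \<otimes> b'))"
    using c by (simp add: m_assoc S_lcomm)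
  also have "\<dots> = (u \<otimes> v) \<otimes> ((s' \<otimes> t') \<otimes> (a \<otimes> b))" unfolding u(2) v(2) using c by (simp add: m_assoc S_lcomm)
  finally show "fr (a' \<otimes> b') (s' \<otimes> t') = fr (a \<otimes> b) (s \<otimes> t)"
    using c uv by (subst fr_eq_iff) auto
qed

lemma L_add:
  assumes a: "a \<in> carrier A" "s \<in> S" and b: "b \<in> carrier A" "t \<in> S"
  shows "fr a s \<oplus>\<^bsub>L\<^esub> fr b t = fr (t \<otimes> a \<oplus> s \<otimes> b) (s \<otimes> t)"
proof -
  have "fr a s \<oplus>\<^bsub>L\<^esub> fr b t = (\<Union>(m, s) \<in> fr a s. \<Union>(n, t) \<in> fr b t. fr (t \<otimes> m \<oplus> s \<otimes> n) (s \<otimes> t))"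
    by (simp add: dg_localization_def loc_module_def Let_def fr_def)
  also have "\<dots> = fr (t \<otimes> a \<oplus> s \<otimes> b) (s \<otimes> t)"
  proof (rule UN_const[OF self_mem_fr[OF a]])
    fix p assume "p \<in> fr a s"
    then obtain m r where m: "p = (m, r)" "m \<in> carrier A" "r \<in> S" "fr m r = fr a s" using mem_fr_eq[OF a] by (cases p) blast
    have "(\<Union>(n, t) \<in> fr b t. fr (t \<otimes> m \<oplus> r \<otimes> n) (r \<otimes> t)) = fr (t \<otimes> a \<oplus> s \<otimes> b) (s \<otimes> t)"
    proof (rule UN_const[OF self_mem_fr[OF b]])
      fix q assume "q \<in> fr b t"
      then obtain n w where n: "q = (n, w)" "n \<in> carrier A" "w \<in> S" "fr n w = fr b t" using mem_fr_eq[OF b] by (cases q) blast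
      show "(case q of (n, t) \<Rightarrow> fr (t \<otimes> m \<oplus> r \<otimes> n) (r \<otimes> t)) = fr (t \<otimes> a \<oplus> s \<otimes> b) (s \<otimes> t)"
        using fr_congruence(1)[OF a m(2-4) b n(2-4)] n(1) by simp
    qed
    then show "(case p of (m, s) \<Rightarrow> \<Union>(n, t) \<in> fr b t. fr (t \<otimes> m \<oplus> s \<otimes> n) (s \<otimes> t)) = fr (t \<otimes> a \<oplus> s \<otimes> b) (s \<otimes> t)"
      using m(1) by simp
  qed
  finally show ?thesis .
qed

lemma L_mult:
  assumes a: "a \<in> carrier A" "s \<in> S" and b: "b \<in> carrier A" "t \<in> S"
  shows "fr a s \<otimes>\<^bsub>L\<^esub> fr b t = fr (a \<otimes> b) (s \<otimes> t)"
proof -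
  have "fr a s \<otimes>\<^bsub>L\<^esub> fr b t = (\<Union>(m, s) \<in> fr a s. \<Union>(n, t) \<in> fr b t. fr (m \<otimes> n) (s \<otimes> t))"
    by (simp add: dg_localization_def loc_module_def Let_def fr_def)
  also have "\<dots> = fr (a \<otimes> b) (s \<otimes> t)"
  proof (rule UN_const[OF self_mem_fr[OF a]])
    fix p assume "p \<in> fr a s"
    then obtain m r where m: "p = (m, r)" "m \<in> carrier A" "r \<in> S" "fr m r = fr a s" using mem_fr_eq[OF a] by (cases p) blast
    have "(\<Union>(n, t) \<in> fr b t. fr (m \<otimes> n) (r \<otimes> t)) = fr (a \<otimes> b) (s \<otimes> t)"
    proof (rule UN_const[OF self_mem_fr[OF b]])
      fix q assume "q \<in> fr b t"
      then obtain n w where n: "q = (n, w)" "n \<in> carrier A" "w \<in> S" "fr n w = fr b t" using mem_fr_eq[OF b] by (cases q) blast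
      show "(case q of (n, t) \<Rightarrow> fr (m \<otimes> n) (r \<otimes> t)) = fr (a \<otimes> b) (s \<otimes> t)"
        using fr_congruence(2)[OF a m(2-4) b n(2-4)] n(1) by simp
    qed
    then show "(case p of (m, s) \<Rightarrow> \<Union>(n, t) \<in> fr b t. fr (m \<otimes> n) (s \<otimes> t)) = fr (a \<otimes> b) (s \<otimes> t)"
      using m(1) by simp
  qed
  finally show ?thesis .
qed

lemma L_differential:
  assumes a: "a \<in> carrier A" "s \<in> S"
  shows "differential L (fr a s) = fr (differential A a) s"
proof -
  have "differential L (fr a s) = (\<Union>(m, s) \<in> fr a s. fr (differential A m) s)"
    by (simp add: dg_localization_def Let_def fr_def)
  also have "\<dots> = fr (differential A a) s"
  proof (rule UN_const[OF self_mem_fr[OF a]])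
    fix p assume "p \<in> fr a s"
    then obtain m r where m: "p = (m, r)" "m \<in> carrier A" "r \<in> S" "fr m r = fr a s" using mem_fr_eq[OF a] by (cases p) blast
    obtain u where u: "u \<in> S" "u \<otimes> (s \<otimes> m) = u \<otimes> (r \<otimes> a)"
      using m(4) unfolding fr_eq_iff[OF m(2,3) a] by blast
    have "u \<otimes> (s \<otimes> differential A m) = differential A (u \<otimes> (s \<otimes> m))"
      using d_deg0_smult S_deg0 u(1) a m by simp
    also have "\<dots> = u \<otimes> (r \<otimes> differential A a)"
      unfolding u(2) using d_deg0_smult S_deg0 u(1) a m by simp
    finally have "fr (differential A m) r = fr (differential A a) s"
      using u(1) a m d_closed by (subst fr_eq_iff) auto
    then show "(case p of (m, s) \<Rightarrow> fr (differential A m) s) = fr (differential A a) s" using m(1) by simp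
  qed
  finally show ?thesis .
qed

lemma L_carrierE:
  assumes "X \<in> carrier L"
  obtains a s where "a \<in> carrier A" "s \<in> S" "X = fr a s"
  using assms unfolding L_carrier by blast

lemma fr_closed: "a \<in> carrier A \<Longrightarrow> s \<in> S \<Longrightarrow> fr a s \<in> carrier L"
  unfolding L_carrier by blast

lemma fr_deg: "a \<in> deg_part A n \<Longrightarrow> s \<in> S \<Longrightarrow> fr a s \<in> deg_part L n"
  unfolding L_deg_part by blast

lemma L_degE:
  assumes "X \<in> deg_part L n"
  obtains a s where "a \<in> deg_part A n" "a \<in> carrier A" "s \<in> S" "X = fr a s"
  using assms gr_closed unfolding L_deg_part by blast

lemma L_deg_carrier: "X \<in> deg_part L n \<Longrightarrow> X \<in> carrier L"
  using fr_closed by (elim L_degE) simp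

lemma fr_zero: "s \<in> S \<Longrightarrow> fr \<zero> s = \<zero>\<^bsub>L\<^esub>"
  unfolding L_zero by (rule fr_eqI) simp_all

lemma L_add_same:
  assumes "a \<in> carrier A" "b \<in> carrier A" "s \<in> S"
  shows "fr a s \<oplus>\<^bsub>L\<^esub> fr b s = fr (a \<oplus> b) s"
  unfolding L_add[OF assms(1,3,2,3)] by (rule fr_eqI) (use assms in \<open>simp_all add: r_distr m_assoc S_lcomm\<close>)

text \<open>Additive identities for fractions reduce to identities in A once the denominators
  agree.\<close>

lemma common_denominator2:
  assumes X: "X \<in> carrier L" and Y: "Y \<in> carrier L"
  obtains a b s where "a \<in> carrier A" "b \<in> carrier A" "s \<in> S" "X = fr a s" "Y = fr b s"
proof -
  obtain a s where a: "a \<in> carrier A" "s \<in> S" "X = fr a s" using X by (rule L_carrierE)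
  obtain b t where b: "b \<in> carrier A" "t \<in> S" "Y = fr b t" using Y by (rule L_carrierE)
  show thesis
  proof (rule that)
    show "X = fr (t \<otimes> a) (s \<otimes> t)" using fr_cancel[of a s t] a b S_comm[of s t] by simp
    show "Y = fr (s \<otimes> b) (s \<otimes> t)" using fr_cancel[of b t s] a b by simp
  qed (use a b in auto)
qed

lemma common_denominator3:
  assumes X: "X \<in> carrier L" and Y: "Y \<in> carrier L" and Z: "Z \<in> carrier L"
  obtains a b c s where "a \<in> carrier A" "b \<in> carrier A" "c \<in> carrier A" "s \<in> S" "X = fr a s" "Y = fr b s" "Z = fr c s"
proof -
  obtain a b s where a: "a \<in> carrier A" "b \<in> carrier A" "s \<in> S" "X = fr a s" "Y = fr b s"
    using X Y by (rule common_denominator2)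
  obtain c t where c: "c \<in> carrier A" "t \<in> S" "Z = fr c t" using Z by (rule L_carrierE)
  show thesis
  proof (rule that)
    show "X = fr (t \<otimes> a) (s \<otimes> t)" using fr_cancel[of a s t] a c S_comm[of s t] by simp
    show "Y = fr (t \<otimes> b) (s \<otimes> t)" using fr_cancel[of b s t] a c S_comm[of s t] by simp
    show "Z = fr (s \<otimes> c) (s \<otimes> t)" using fr_cancel[of c t s] a c by simp
  qed (use a c in auto)
qed

lemma L_abelian_group: "abelian_group L"
proof (rule abelian_groupI)
  fix X Y assume XY: "X \<in> carrier L" "Y \<in> carrier L"
  from XY obtain a b s where a: "a \<in> carrier A" "b \<in> carrier A" "s \<in> S" "X = fr a s" "Y = fr b s"
    by (rule common_denominator2)
  then show "X \<oplus>\<^bsub>L\<^esub> Y \<in> carrier L" "X \<oplus>\<^bsub>L\<^esub> Y = Y \<oplus>\<^bsub>L\<^esub> X"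
    by (simp_all add: L_add_same fr_closed a_comm)
  fix Z assume Z: "Z \<in> carrier L"
  from XY Z obtain a b c s where "a \<in> carrier A" "b \<in> carrier A" "c \<in> carrier A" "s \<in> S" "X = fr a s" "Y = fr b s" "Z = fr c s"
    by (rule common_denominator3)
  then show "X \<oplus>\<^bsub>L\<^esub> Y \<oplus>\<^bsub>L\<^esub> Z = X \<oplus>\<^bsub>L\<^esub> (Y \<oplus>\<^bsub>L\<^esub> Z)"
    by (simp add: L_add_same a_assoc)
next
  show "\<zero>\<^bsub>L\<^esub> \<in> carrier L" unfolding L_zero by (simp add: fr_closed)
  fix X assume "X \<in> carrier L"
  then obtain a s where a: "a \<in> carrier A" "s \<in> S" "X = fr a s" by (rule L_carrierE)
  then show "\<zero>\<^bsub>L\<^esub> \<oplus>\<^bsub>L\<^esub> X = X" by (simp add: fr_zero[symmetric, of s] L_add_same)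
  have "fr (\<ominus> a) s \<oplus>\<^bsub>L\<^esub> X = \<zero>\<^bsub>L\<^esub>" using a by (simp add: L_add_same l_neg fr_zero)
  then show "\<exists>Y\<in>carrier L. Y \<oplus>\<^bsub>L\<^esub> X = \<zero>\<^bsub>L\<^esub>" using fr_closed[of "\<ominus> a" s] a by (intro bexI) simp_all
qed

lemma L_ring: "ring L"
proof (rule ringI)
  show "abelian_group L" by (rule L_abelian_group)
  show "Group.monoid L"
  proof (rule monoidI)
    fix X Y assume XY: "X \<in> carrier L" "Y \<in> carrier L"
    obtain a s where a: "a \<in> carrier A" "s \<in> S" "X = fr a s" using XY(1) by (rule L_carrierE)
    obtain b t where b: "b \<in> carrier A" "t \<in> S" "Y = fr b t" using XY(2) by (rule L_carrierE)
    show "X \<otimes>\<^bsub>L\<^esub> Y \<in> carrier L" using a b by (simp add: L_mult fr_closed)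
    fix Z assume "Z \<in> carrier L"
    then obtain c r where c: "c \<in> carrier A" "r \<in> S" "Z = fr c r" by (rule L_carrierE)
    show "X \<otimes>\<^bsub>L\<^esub> Y \<otimes>\<^bsub>L\<^esub> Z = X \<otimes>\<^bsub>L\<^esub> (Y \<otimes>\<^bsub>L\<^esub> Z)" using a b c by (simp add: L_mult m_assoc)
  next
    show "\<one>\<^bsub>L\<^esub> \<in> carrier L" by (simp add: L_one fr_closed)
    fix X assume "X \<in> carrier L"
    then obtain a s where "a \<in> carrier A" "s \<in> S" "X = fr a s" by (rule L_carrierE)
    then show "\<one>\<^bsub>L\<^esub> \<otimes>\<^bsub>L\<^esub> X = X" "X \<otimes>\<^bsub>L\<^esub> \<one>\<^bsub>L\<^esub> = X" by (simp_all add: L_one L_mult)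
  qed
  fix X Y Z assume XY: "X \<in> carrier L" "Y \<in> carrier L" and Z: "Z \<in> carrier L"
  obtain a b s where a: "a \<in> carrier A" "b \<in> carrier A" "s \<in> S" "X = fr a s" "Y = fr b s"
    using XY by (rule common_denominator2)
  obtain c t where c: "c \<in> carrier A" "t \<in> S" "Z = fr c t" using Z by (rule L_carrierE)
  show "(X \<oplus>\<^bsub>L\<^esub> Y) \<otimes>\<^bsub>L\<^esub> Z = X \<otimes>\<^bsub>L\<^esub> Z \<oplus>\<^bsub>L\<^esub> Y \<otimes>\<^bsub>L\<^esub> Z"
    using a c by (simp add: L_add_same L_mult l_distr)
  show "Z \<otimes>\<^bsub>L\<^esub> (X \<oplus>\<^bsub>L\<^esub> Y) = Z \<otimes>\<^bsub>L\<^esub> X \<oplus>\<^bsub>L\<^esub> Z \<otimes>\<^bsub>L\<^esub> Y"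
    using a c by (simp add: L_add_same L_mult r_distr)
qed

lemma L_a_inv: "a \<in> carrier A \<Longrightarrow> s \<in> S \<Longrightarrow> \<ominus>\<^bsub>L\<^esub> fr a s = fr (\<ominus> a) s"
  by (rule abelian_group.minus_equality[OF L_abelian_group]) (simp_all add: L_add_same l_neg fr_zero fr_closed)

lemma L_sgn_pow: "a \<in> carrier A \<Longrightarrow> s \<in> S \<Longrightarrow> sgn_pow L n (fr a s) = fr (sgn_pow A n a) s"
  by (simp add: sgn_pow_def L_a_inv)

lemma L_finsum:
  assumes "finite K" "\<And>n. n \<in> K \<Longrightarrow> f n \<in> carrier A" "s \<in> S"
  shows "(\<Oplus>\<^bsub>L\<^esub>n\<in>K. fr (f n) s) = fr (\<Oplus>n\<in>K. f n) s"
  using assms(1,2)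
proof (induction K rule: finite_induct)
  case empty
  interpret L: abelian_group L by (rule L_abelian_group)
  show ?case using assms(3) by (simp add: fr_zero)
next
  case (insert k K)
  interpret L: abelian_group L by (rule L_abelian_group)
  have f: "f k \<in> carrier A" "f \<in> K \<rightarrow> carrier A" "(\<lambda>n. fr (f n) s) \<in> K \<rightarrow> carrier L"
    using insert.prems fr_closed assms(3) by auto
  have "(\<Oplus>\<^bsub>L\<^esub>n\<in>insert k K. fr (f n) s) = fr (f k) s \<oplus>\<^bsub>L\<^esub> fr (\<Oplus>n\<in>K. f n) s"
    using insert f fr_closed assms(3) by (simp add: L.finsum_insert)
  also have "\<dots> = fr (f k \<oplus> (\<Oplus>n\<in>K. f n)) s"
    using f assms(3) by (simp add: L_add_same finsum_closed)
  finally show ?case using insert f by (simp add: finsum_insert)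
qed

lemma L_gr_common_denominator:
  assumes "finite K" "\<And>n. n \<in> K \<Longrightarrow> F n \<in> deg_part L n"
  shows "\<exists>s\<in>S. \<forall>n\<in>K. \<exists>a\<in>deg_part A n. F n = fr a s"
  using assms
proof (induction K rule: finite_induct)
  case empty
  then show ?case using S_one by blast
next
  case (insert k K)
  obtain s where s: "s \<in> S" "\<And>n. n \<in> K \<Longrightarrow> \<exists>a\<in>deg_part A n. F n = fr a s" using insert by blast
  have "F k \<in> deg_part L k" using insert.prems by simp
  then obtain b t where b: "b \<in> deg_part A k" "b \<in> carrier A" "t \<in> S" "F k = fr b t" by (rule L_degE)
  have "\<exists>a\<in>deg_part A n. F n = fr a (s \<otimes> t)" if n: "n \<in> insert k K" for n
  proof (cases "n = k")
    case True
    have "fr (s \<otimes> b) (s \<otimes> t) = fr b t" using fr_cancel b s(1) by simp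
    then show ?thesis using True b(1,4) deg_mult[OF S_deg0[OF s(1)] b(1)] by auto
  next
    case False
    then obtain a where a: "a \<in> deg_part A n" "F n = fr a s" using s(2) n by blast
    have "fr (t \<otimes> a) (s \<otimes> t) = fr a s" using fr_cancel[of a s t] S_comm[of s t] a(1) gr_closed b(3) s(1) by simp
    then show ?thesis using a deg_mult[OF S_deg0[OF b(3)] a(1)] by auto
  qed
  then show ?case using s(1) b(3) by (intro bexI[of _ "s \<otimes> t"]) auto
qed

text \<open>Existence divides a decomposition of the numerator by s. For uniqueness, each of the two
  decompositions is given one denominator, and after clearing them homogeneous components are
  compared in A.\<close>

lemma L_gr_direct_sum:
  assumes X: "X \<in> carrier L"
  shows "\<exists>!F. decomposes L (deg_part L) X F"
proof (rule ex_ex1I)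
  interpret L: abelian_group L by (rule L_abelian_group)
  obtain a s where a: "a \<in> carrier A" "s \<in> S" "X = fr a s" using X by (rule L_carrierE)
  obtain f where "decomposes A (deg_part A) a f" using gr_direct_sum[OF a(1)] by blast
  then have f: "\<And>n. f n \<in> deg_part A n" "finite {n. f n \<noteq> \<zero>}" "a = (\<Oplus>n\<in>{n. f n \<noteq> \<zero>}. f n)"
    by (auto simp: decomposes_def)
  let ?F = "\<lambda>n. fr (f n) s"
  have sub: "{n. ?F n \<noteq> \<zero>\<^bsub>L\<^esub>} \<subseteq> {n. f n \<noteq> \<zero>}" by (rule Collect_mono) (use fr_zero[OF a(2)] in metis)
  have "(\<Oplus>\<^bsub>L\<^esub>n\<in>{n. ?F n \<noteq> \<zero>\<^bsub>L\<^esub>}. ?F n) = (\<Oplus>\<^bsub>L\<^esub>n\<in>{n. f n \<noteq> \<zero>}. ?F n)"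
    by (rule L.add.finprod_mono_neutral_cong_left[OF f(2) sub]) (use fr_closed[OF gr_closed[OF f(1)] a(2)] in auto)
  also have "\<dots> = X" unfolding a(3) using L_finsum[OF f(2) gr_closed[OF f(1)] a(2)] f(3) by simp
  finally have "decomposes L (deg_part L) X ?F"
    unfolding decomposes_def using fr_deg[OF f(1) a(2)] finite_subset[OF sub f(2)] by simp
  then show "\<exists>F. decomposes L (deg_part L) X F" by blast
next
  interpret L: abelian_group L by (rule L_abelian_group)
  fix F G assume F: "decomposes L (deg_part L) X F" and G: "decomposes L (deg_part L) X G"
  have deg: "F n \<in> deg_part L n" "G n \<in> deg_part L n" for n using F G by (simp_all add: decomposes_def)
  have Lc: "F n \<in> carrier L" "G n \<in> carrier L" for n using L_deg_carrier deg by blast+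
  define K where "K = {n. F n \<noteq> \<zero>\<^bsub>L\<^esub>} \<union> {n. G n \<noteq> \<zero>\<^bsub>L\<^esub>}"
  have K: "finite K" using F G by (simp add: K_def decomposes_def)
  have XF: "X = (\<Oplus>\<^bsub>L\<^esub>n\<in>K. F n)"
  proof -
    have "X = (\<Oplus>\<^bsub>L\<^esub>n\<in>{n. F n \<noteq> \<zero>\<^bsub>L\<^esub>}. F n)" using F by (simp add: decomposes_def)
    also have "\<dots> = (\<Oplus>\<^bsub>L\<^esub>n\<in>K. F n)"
      by (rule L.add.finprod_mono_neutral_cong_left[OF K]) (use Lc in \<open>auto simp: K_def\<close>)
    finally show ?thesis .
  qed
  have XG: "X = (\<Oplus>\<^bsub>L\<^esub>n\<in>K. G n)"
  proof -
    have "X = (\<Oplus>\<^bsub>L\<^esub>n\<in>{n. G n \<noteq> \<zero>\<^bsub>L\<^esub>}. G n)" using G by (simp add: decomposes_def)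
    also have "\<dots> = (\<Oplus>\<^bsub>L\<^esub>n\<in>K. G n)"
      by (rule L.add.finprod_mono_neutral_cong_left[OF K]) (use Lc in \<open>auto simp: K_def\<close>)
    finally show ?thesis .
  qed
  obtain s where s: "s \<in> S" "\<forall>n\<in>K. \<exists>a\<in>deg_part A n. F n = fr a s" using L_gr_common_denominator[OF K, of F] deg(1) by blast
  obtain t where t: "t \<in> S" "\<forall>n\<in>K. \<exists>a\<in>deg_part A n. G n = fr a t" using L_gr_common_denominator[OF K, of G] deg(2) by blast
  from bchoice[OF s(2)[unfolded Bex_def]] obtain f where f: "\<And>n. n \<in> K \<Longrightarrow> f n \<in> deg_part A n \<and> F n = fr (f n) s" by blast
  from bchoice[OF t(2)[unfolded Bex_def]] obtain g where g: "\<And>n. n \<in> K \<Longrightarrow> g n \<in> deg_part A n \<and> G n = fr (g n) t" by blast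
  have fc: "\<And>n. n \<in> K \<Longrightarrow> f n \<in> carrier A" and gc: "\<And>n. n \<in> K \<Longrightarrow> g n \<in> carrier A" using f g gr_closed by blast+
  have fP: "f \<in> K \<rightarrow> carrier A" "g \<in> K \<rightarrow> carrier A" using fc gc by blast+
  have "X = (\<Oplus>\<^bsub>L\<^esub>n\<in>K. fr (f n) s)" unfolding XF by (rule L.finsum_cong') (use f fr_closed fc s(1) in auto)
  then have X1: "X = fr (\<Oplus>n\<in>K. f n) s" using L_finsum[OF K fc s(1)] by simp
  have "X = (\<Oplus>\<^bsub>L\<^esub>n\<in>K. fr (g n) t)" unfolding XG by (rule L.finsum_cong') (use g fr_closed gc t(1) in auto)
  then have X2: "X = fr (\<Oplus>n\<in>K. g n) t" using L_finsum[OF K gc t(1)] by simp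
  obtain u where u: "u \<in> S" "u \<otimes> (t \<otimes> (\<Oplus>n\<in>K. f n)) = u \<otimes> (s \<otimes> (\<Oplus>n\<in>K. g n))"
    using X1 X2 fr_eq_iff[OF finsum_closed[OF fP(1)] s(1) finsum_closed[OF fP(2)] t(1)] by auto
  \<comment> \<open>With both denominators and the witness u absorbed, the identity holds in A
    itself, between sums of homogeneous elements of matching degrees.\<close>
  have sum: "(\<Oplus>n\<in>K. (u \<otimes> t) \<otimes> f n) = (\<Oplus>n\<in>K. (u \<otimes> s) \<otimes> g n)"
    using u s(1) t(1) finsum_rdistr[OF K, of "u \<otimes> t" f] finsum_rdistr[OF K, of "u \<otimes> s" g] fP
    by (simp add: m_assoc finsum_closed)
  have deg_f: "(u \<otimes> t) \<otimes> f k \<in> deg_part A k" if k: "k \<in> K" for k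
    using deg_mult[of "u \<otimes> t" 0 "f k" k] S_deg0 f[OF k] u(1) t(1) by simp
  have deg_g: "(u \<otimes> s) \<otimes> g k \<in> deg_part A k" if k: "k \<in> K" for k
    using deg_mult[of "u \<otimes> s" 0 "g k" k] S_deg0 g[OF k] u(1) s(1) by simp
  have e: "(u \<otimes> t) \<otimes> f n = (u \<otimes> s) \<otimes> g n" if n: "n \<in> K" for n
    by (rule finsum_homogeneous_unique[OF K deg_f deg_g sum n])
  show "F = G"
  proof
    fix n
    show "F n = G n"
    proof (cases "n \<in> K")
      case True
      have "u \<otimes> (t \<otimes> f n) = u \<otimes> (s \<otimes> g n)" using e[OF True] u(1) s(1) t(1) fc[OF True] gc[OF True] by (simp add: m_assoc)
      then have "fr (f n) s = fr (g n) t" using fr_eq_iff[OF fc[OF True] s(1) gc[OF True] t(1)] u(1) by blast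
      then show ?thesis using f[OF True] g[OF True] by simp
    qed (simp add: K_def)
  qed
qed

theorem L_dg_ring: "dg_ring L"
proof (intro dg_ring.intro graded_complex.intro graded_complex_axioms.intro dg_ring_axioms.intro)
  interpret L: ring L by (rule L_ring)
  show "ring L" "abelian_group L" by (rule L_ring L_abelian_group)+
  show "additive_subgroup (deg_part L n) L" for n
  proof (rule additive_subgroupI, rule L.add.subgroupI)
    show "deg_part L n \<subseteq> carrier L" using L_deg_carrier by blast
    show "deg_part L n \<noteq> {}" using fr_deg[OF gr_zero S_one] by blast
    show "\<ominus>\<^bsub>L\<^esub> X \<in> deg_part L n" if "X \<in> deg_part L n" for X
      using that by (rule L_degE) (simp add: L_a_inv gr_neg fr_deg)
    show "X \<oplus>\<^bsub>L\<^esub> Y \<in> deg_part L n" if X: "X \<in> deg_part L n" and Y: "Y \<in> deg_part L n" for X Y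
    proof -
      obtain a s where a: "a \<in> deg_part A n" "a \<in> carrier A" "s \<in> S" "X = fr a s" using X by (rule L_degE)
      obtain b t where b: "b \<in> deg_part A n" "b \<in> carrier A" "t \<in> S" "Y = fr b t" using Y by (rule L_degE)
      have "t \<otimes> a \<oplus> s \<otimes> b \<in> deg_part A n"
        using gr_add deg_mult[OF S_deg0[OF b(3)] a(1)] deg_mult[OF S_deg0[OF a(3)] b(1)] by simp
      then show ?thesis using a b L_add fr_deg by simp
    qed
  qed
  show "\<exists>!F. decomposes L (deg_part L) X F" if "X \<in> carrier L" for X by (rule L_gr_direct_sum[OF that])
  show "differential L (X \<oplus>\<^bsub>L\<^esub> Y) = differential L X \<oplus>\<^bsub>L\<^esub> differential L Y"
    if XY: "X \<in> carrier L" "Y \<in> carrier L" for X Y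
  proof -
    obtain a b s where "a \<in> carrier A" "b \<in> carrier A" "s \<in> S" "X = fr a s" "Y = fr b s" using XY by (rule common_denominator2)
    then show ?thesis by (simp add: L_add_same L_differential d_add d_closed)
  qed
  show "differential L X \<in> deg_part L (n + 1)" if "X \<in> deg_part L n" for X n
    using that by (rule L_degE) (simp add: L_differential fr_deg d_degree)
  show "differential L (differential L X) = \<zero>\<^bsub>L\<^esub>" if "X \<in> carrier L" for X
    using that by (rule L_carrierE) (simp add: L_differential d_closed d_d fr_zero)
  show "\<one>\<^bsub>L\<^esub> \<in> deg_part L 0" unfolding L_one by (rule fr_deg[OF deg_one S_one])
  show "X \<otimes>\<^bsub>L\<^esub> Y \<in> deg_part L (i + j)" if X: "X \<in> deg_part L i" and Y: "Y \<in> deg_part L j" for X Y i j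
  proof -
    obtain a s where a: "a \<in> deg_part A i" "a \<in> carrier A" "s \<in> S" "X = fr a s" using X by (rule L_degE)
    obtain b t where b: "b \<in> deg_part A j" "b \<in> carrier A" "t \<in> S" "Y = fr b t" using Y by (rule L_degE)
    show ?thesis using a b by (simp add: L_mult fr_deg deg_mult)
  qed
  show "deg_part L n = {\<zero>\<^bsub>L\<^esub>}" if n: "n > 0" for n
    unfolding L_deg_part non_positive[OF n] by (auto simp: fr_zero intro!: exI[of _ \<one>])
  show "differential L (X \<otimes>\<^bsub>L\<^esub> Y) = differential L X \<otimes>\<^bsub>L\<^esub> Y \<oplus>\<^bsub>L\<^esub> sgn_pow L i (X \<otimes>\<^bsub>L\<^esub> differential L Y)"
    if X: "X \<in> deg_part L i" and Y: "Y \<in> carrier L" for X Y i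
  proof -
    obtain a s where a: "a \<in> deg_part A i" "a \<in> carrier A" "s \<in> S" "X = fr a s" using X by (rule L_degE)
    obtain b t where b: "b \<in> carrier A" "t \<in> S" "Y = fr b t" using Y by (rule L_carrierE)
    have "sgn_pow A i (a \<otimes> differential A b) \<in> carrier A" using a b d_closed by (simp add: sgn_pow_def)
    then show ?thesis
      using a b leibniz[OF a(1) b(1)] by (simp add: L_mult L_differential d_closed L_sgn_pow L_add_same)
  qed
  show "Y \<otimes>\<^bsub>L\<^esub> X = sgn_pow L (i * j) (X \<otimes>\<^bsub>L\<^esub> Y)" if X: "X \<in> deg_part L i" and Y: "Y \<in> deg_part L j" for X Y i j
  proof -
    obtain a s where a: "a \<in> deg_part A i" "a \<in> carrier A" "s \<in> S" "X = fr a s" using X by (rule L_degE)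
    obtain b t where b: "b \<in> deg_part A j" "b \<in> carrier A" "t \<in> S" "Y = fr b t" using Y by (rule L_degE)
    show ?thesis
      using a b graded_comm[OF a(1) b(1)] S_comm[of s t] by (simp add: L_mult L_sgn_pow)
  qed
  show "X \<otimes>\<^bsub>L\<^esub> X = \<zero>\<^bsub>L\<^esub>" if X: "X \<in> deg_part L i" and i: "odd i" for X i
  proof -
    obtain a s where a: "a \<in> deg_part A i" "a \<in> carrier A" "s \<in> S" "X = fr a s" using X by (rule L_degE)
    then show ?thesis using odd_square[OF a(1) i] by (simp add: L_mult fr_zero)
  qed
qed

end

section \<open>The localization map and its effect on H^0\<close>

context dg_loc
begin

sublocale L: dg_ring L by (rule L_dg_ring)

definition loc :: "'a \<Rightarrow> ('a \<times> 'a) set" where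
  "loc a = fr a \<one>"

text \<open>Defined through the chosen lift; \<open>loc_H0_proj\<close> allows any lift.\<close>

definition loc_H0 :: "'a set \<Rightarrow> ('a \<times> 'a) set set" where
  "loc_H0 x = H0_proj L (loc (H0_lift A x))"

lemma loc_deg: "a \<in> deg_part A n \<Longrightarrow> loc a \<in> deg_part L n"
  unfolding loc_def by (simp add: fr_deg)

lemma loc_mult: "a \<in> carrier A \<Longrightarrow> b \<in> carrier A \<Longrightarrow> loc (a \<otimes> b) = loc a \<otimes>\<^bsub>L\<^esub> loc b"
  unfolding loc_def by (simp add: L_mult)

lemma loc_add: "a \<in> carrier A \<Longrightarrow> b \<in> carrier A \<Longrightarrow> loc (a \<oplus> b) = loc a \<oplus>\<^bsub>L\<^esub> loc b"
  unfolding loc_def by (simp add: L_add_same)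

lemma loc_diff: "a \<in> carrier A \<Longrightarrow> b \<in> carrier A \<Longrightarrow> loc (a \<ominus> b) = loc a \<ominus>\<^bsub>L\<^esub> loc b"
  unfolding loc_def a_minus_def by (simp add: L_add_same L_a_inv)

lemma loc_differential: "a \<in> carrier A \<Longrightarrow> loc (differential A a) = differential L (loc a)"
  unfolding loc_def by (simp add: L_differential)

lemma loc_smult_fr: "s \<in> S \<Longrightarrow> a \<in> carrier A \<Longrightarrow> loc s \<otimes>\<^bsub>L\<^esub> fr a s = loc a"
  unfolding loc_def using fr_cancel[of a \<one> s] by (simp add: L_mult)

lemma loc_zero_iff:
  assumes "a \<in> carrier A"
  shows "loc a = \<zero>\<^bsub>L\<^esub> \<longleftrightarrow> (\<exists>s\<in>S. s \<otimes> a = \<zero>)"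
  unfolding loc_def L_zero using fr_eq_iff[of a \<one> \<zero> \<one>] assms by simp

lemma loc_inverse: "s \<in> S \<Longrightarrow> fr \<one> s \<in> deg_part L 0 \<and> fr \<one> s \<otimes>\<^bsub>L\<^esub> loc s = \<one>\<^bsub>L\<^esub>"
proof -
  assume s: "s \<in> S"
  have "fr (\<one> \<otimes> s) (s \<otimes> \<one>) = fr \<one> \<one>" by (rule fr_eqI) (use s in simp_all)
  then show ?thesis using s by (simp add: fr_deg deg_one loc_def L_one L_mult)
qed

lemma loc_boundary_ideal: "c \<in> boundary_ideal A \<Longrightarrow> loc c \<in> boundary_ideal L"
proof -
  assume "c \<in> boundary_ideal A"
  then obtain b where b: "b \<in> deg_part A (- 1)" "c = differential A b" unfolding boundary_ideal_eq by blast
  have "loc c = differential L (loc b)" unfolding b(2) by (rule loc_differential[OF gr_closed[OF b(1)]])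
  then show ?thesis unfolding boundary_ideal_eq using loc_deg[OF b(1)] by (rule image_eqI)
qed

lemma loc_map_self: "loc_map A (self_module A) L (self_module L) loc S loc"
proof (intro loc_map.intro loc_map_axioms.intro)
  show "cplx A (self_module A)" by (rule self_cplx)
  show "cplx L (self_module L)" by (rule L.self_cplx)
  show "\<exists>s\<in>S. \<exists>x\<in>mdeg_part (self_module A) n. loc s \<odot>\<^bsub>self_module L\<^esub> X = loc x"
    if X: "X \<in> mdeg_part (self_module L) n" for X n
  proof -
    have "X \<in> deg_part L n" using X by simp
    then obtain a s where "a \<in> deg_part A n" "a \<in> carrier A" "s \<in> S" "X = fr a s" by (rule L_degE)
    then show ?thesis using loc_smult_fr by (intro bexI[of _ s] bexI[of _ a]) simp_all
  qed
  show "\<exists>s\<in>S. s \<odot>\<^bsub>self_module A\<^esub> x = \<zero>\<^bsub>self_module A\<^esub>"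
    if "x \<in> mdeg_part (self_module A) n" "loc x = \<zero>\<^bsub>self_module L\<^esub>" for x n
    using that loc_zero_iff[of x] gr_closed by simp
  show "X = \<zero>\<^bsub>self_module L\<^esub>"
    if s: "s \<in> S" and X: "X \<in> mdeg_part (self_module L) n" and z: "loc s \<odot>\<^bsub>self_module L\<^esub> X = \<zero>\<^bsub>self_module L\<^esub>" for s X n
  proof -
    have c: "X \<in> carrier L" "loc s \<in> carrier L" "fr \<one> s \<in> carrier L"
      using X s L.gr_closed fr_closed by (auto simp: loc_def)
    have "X = (fr \<one> s \<otimes>\<^bsub>L\<^esub> loc s) \<otimes>\<^bsub>L\<^esub> X" using loc_inverse[OF s] c by simp
    also have "\<dots> = \<zero>\<^bsub>L\<^esub>" using z c by (simp add: L.m_assoc)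
    finally show ?thesis by simp
  qed
  show "\<exists>X'\<in>mdeg_part (self_module L) n. loc s \<odot>\<^bsub>self_module L\<^esub> X' = X"
    if s: "s \<in> S" and X: "X \<in> mdeg_part (self_module L) n" for s X n
  proof -
    have "X \<in> deg_part L n" using X by simp
    then obtain a t where a: "a \<in> deg_part A n" "a \<in> carrier A" "t \<in> S" "X = fr a t" by (rule L_degE)
    have "loc s \<otimes>\<^bsub>L\<^esub> fr a (s \<otimes> t) = X"
      using fr_cancel[of a t s] a s by (simp add: loc_def L_mult)
    moreover have "fr a (s \<otimes> t) \<in> deg_part L n" using a s by (simp add: fr_deg)
    ultimately show ?thesis by auto
  qed
qed (use loc_deg loc_mult loc_add loc_differential S_deg0 gr_closed in \<open>auto simp: fr_closed loc_def\<close>)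

text \<open>Two lifts differ by a boundary, and \<open>loc\<close> sends boundaries to
  boundaries.\<close>

lemma loc_H0_proj:
  assumes a: "a \<in> deg_part A 0"
  shows "loc_H0 (H0_proj A a) = H0_proj L (loc a)"
proof -
  note x = H0_proj_closed[OF a]
  note l = H0_lift_closed[OF x]
  have "H0_lift A (H0_proj A a) \<ominus> a \<in> boundary_ideal A"
    using H0_proj_eq_iff[OF l a] H0_proj_lift[OF x] by simp
  then have "loc (H0_lift A (H0_proj A a)) \<ominus>\<^bsub>L\<^esub> loc a \<in> boundary_ideal L"
    using loc_boundary_ideal loc_diff[OF gr_closed[OF l] gr_closed[OF a]] by fastforce
  then show ?thesis
    unfolding loc_H0_def using L.H0_proj_eq_iff[OF loc_deg[OF l] loc_deg[OF a]] by simp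
qed

text \<open>This identifies H^0 of the localized DG-ring with the localization of H^0(A). Inverses
  and fractions are explicit; the kernel is where exactness of localization is needed.\<close>

lemma ring_localization_H0: "ring_localization (H0 A) (H0 L) loc_H0 P"
proof (intro ring_localization.intro ring_localization_axioms.intro)
  show "cring (H0 A)" "cring (H0 L)" by (rule H0_cring L.H0_cring)+
  show "P \<in> spec (H0 A)" by (rule P_spec)
  show "loc_H0 \<in> ring_hom (H0 A) (H0 L)"
  proof (rule ring_hom_memI)
    fix x assume x: "x \<in> carrier (H0 A)"
    then obtain a where a: "a \<in> deg_part A 0" "x = H0_proj A a" unfolding carrier_H0 by blast
    show "loc_H0 x \<in> carrier (H0 L)" using a loc_H0_proj L.H0_proj_closed[OF loc_deg] by simp
    fix y assume "y \<in> carrier (H0 A)"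
    then obtain b where b: "b \<in> deg_part A 0" "y = H0_proj A b" unfolding carrier_H0 by blast
    note c = gr_closed[OF a(1)] gr_closed[OF b(1)]
    have ab: "a \<otimes> b \<in> deg_part A 0" "a \<oplus> b \<in> deg_part A 0" using deg_mult[OF a(1) b(1)] gr_add[OF a(1) b(1)] by simp_all
    note pa = loc_deg[OF a(1)] loc_deg[OF b(1)]
    show "loc_H0 (x \<otimes>\<^bsub>H0 A\<^esub> y) = loc_H0 x \<otimes>\<^bsub>H0 L\<^esub> loc_H0 y"
      unfolding a(2) b(2) H0_proj_simps(2)[OF a(1) b(1), symmetric] loc_H0_proj[OF ab(1)] loc_H0_proj[OF a(1)] loc_H0_proj[OF b(1)]
        loc_mult[OF c] by (rule L.H0_proj_simps(2)[OF pa])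
    show "loc_H0 (x \<oplus>\<^bsub>H0 A\<^esub> y) = loc_H0 x \<oplus>\<^bsub>H0 L\<^esub> loc_H0 y"
      unfolding a(2) b(2) H0_proj_simps(1)[OF a(1) b(1), symmetric] loc_H0_proj[OF ab(2)] loc_H0_proj[OF a(1)] loc_H0_proj[OF b(1)]
        loc_add[OF c] by (rule L.H0_proj_simps(1)[OF pa])
  next
    show "loc_H0 \<one>\<^bsub>H0 A\<^esub> = \<one>\<^bsub>H0 L\<^esub>"
      unfolding H0_proj_one[symmetric] L.H0_proj_one[symmetric] loc_H0_proj[OF deg_one] by (simp add: loc_def L_one)
  qed
next
  fix x assume x: "x \<in> carrier (H0 A)" "x \<notin> P"
  then obtain s where s: "s \<in> deg_part A 0" "x = H0_proj A s" unfolding carrier_H0 by blast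
  have sS: "s \<in> S" using s x by (simp add: lift_compl_def)
  note i = loc_inverse[OF sS]
  have "H0_proj L (fr \<one> s) \<otimes>\<^bsub>H0 L\<^esub> loc_H0 x = \<one>\<^bsub>H0 L\<^esub>"
    unfolding s(2) loc_H0_proj[OF s(1)] using L.H0_proj_simps(2)[of "fr \<one> s" "loc s"] i loc_deg[OF s(1)] L.H0_proj_one by simp
  then show "\<exists>t\<in>carrier (H0 L). t \<otimes>\<^bsub>H0 L\<^esub> loc_H0 x = \<one>\<^bsub>H0 L\<^esub>"
    using L.H0_proj_closed i by blast
next
  fix y assume "y \<in> carrier (H0 L)"
  then obtain Y where Y: "Y \<in> deg_part L 0" "y = H0_proj L Y" unfolding L.carrier_H0 by blast
  obtain a s where a: "a \<in> deg_part A 0" "a \<in> carrier A" "s \<in> S" "Y = fr a s" using Y(1) by (rule L_degE)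
  have s0: "s \<in> deg_part A 0" by (rule S_deg0[OF a(3)])
  have "loc_H0 (H0_proj A s) \<otimes>\<^bsub>H0 L\<^esub> y = loc_H0 (H0_proj A a)"
    unfolding loc_H0_proj[OF s0] loc_H0_proj[OF a(1)] Y(2)
    using L.H0_proj_simps(2)[OF loc_deg[OF s0] Y(1)] loc_smult_fr[OF a(3,2)] a(4) by simp
  moreover have "H0_proj A s \<in> carrier (H0 A) - P" using a(3) s0 H0_proj_closed by (simp add: lift_compl_def)
  ultimately show "\<exists>s\<in>carrier (H0 A) - P. \<exists>x\<in>carrier (H0 A). loc_H0 s \<otimes>\<^bsub>H0 L\<^esub> y = loc_H0 x"
    using H0_proj_closed[OF a(1)] by blast
next
  fix x assume x: "x \<in> carrier (H0 A)" and z: "loc_H0 x = \<zero>\<^bsub>H0 L\<^esub>"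
  then obtain a where a: "a \<in> deg_part A 0" "x = H0_proj A a" unfolding carrier_H0 by blast
  have "loc a \<in> boundary_ideal L"
    using z L.H0_proj_zero_iff[OF loc_deg[OF a(1)]] unfolding a(2) loc_H0_proj[OF a(1)] by simp
  then have lB: "loc a \<in> coboundaries (self_module L) 0" .
  interpret lm: loc_map A "self_module A" L "self_module L" loc S loc by (rule loc_map_self)
  have aZ: "a \<in> cocycles (self_module A) 0" using a(1) d_deg0 by (simp add: cocycles_def)
  obtain s where s: "s \<in> S" "s \<otimes> a \<in> boundary_ideal A"
    using lm.psi_coboundary_iff[OF aZ] lB by auto
  have s0: "s \<in> deg_part A 0" by (rule S_deg0[OF s(1)])
  have sa: "s \<otimes> a \<in> deg_part A 0" using deg_mult[OF s0 a(1)] by simp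
  have "H0_proj A s \<otimes>\<^bsub>H0 A\<^esub> x = \<zero>\<^bsub>H0 A\<^esub>"
    unfolding a(2) using H0_proj_simps(2)[OF s0 a(1)] H0_proj_zero_iff[OF sa] s(2) by simp
  moreover have "H0_proj A s \<in> carrier (H0 A) - P" using s(1) s0 H0_proj_closed by (simp add: lift_compl_def)
  ultimately show "\<exists>s\<in>carrier (H0 A) - P. s \<otimes>\<^bsub>H0 A\<^esub> x = \<zero>\<^bsub>H0 A\<^esub>" by blast
qed

sublocale H0: ring_localization "H0 A" "H0 L" loc_H0 P
  by (rule ring_localization_H0)

lemma S_unit: "s \<in> S \<Longrightarrow> \<exists>t\<in>deg_part L 0. t \<otimes>\<^bsub>L\<^esub> loc s = \<one>\<^bsub>L\<^esub>"
  using loc_inverse by blast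

lemma L_noetherian_local:
  assumes "noetherian_dg_ring A"
  shows "noetherian_local_dg_ring L H0.loc_max_ideal"
proof -
  have "noetherian_ring (H0 L)" using H0.noetherian_loc assms by (simp add: noetherian_dg_ring_def)
  moreover have "fin_gen_module (H0 L) (cohomology (self_module L) n)" for n
    by (rule loc_map.fin_gen_cohomology[OF loc_map_self S_unit self_cohomology_fin_gen[OF assms]])
  ultimately show ?thesis
    using H0.local_ring_loc L_dg_ring by (simp add: noetherian_local_dg_ring_def noetherian_dg_ring_def)
qed

lemma L_bounded:
  assumes "bounded_cohomology A"
  shows "bounded_cohomology L"
proof -
  interpret M: cplx A "self_module A" by (rule self_cplx)
  interpret L': cplx L "self_module L" by (rule L.self_cplx)
  obtain N where N: "\<And>i. i < N \<Longrightarrow> i \<notin> nonzero_degrees (self_module A)"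
    using assms unfolding bounded_cohomology_def by blast
  have "i \<notin> nonzero_degrees (self_module L)" if "i < N" for i
    using N[OF that] loc_map.exact_localize[OF loc_map_self] unfolding M.nonzero_degrees_iff L'.nonzero_degrees_iff by blast
  then show ?thesis unfolding bounded_cohomology_def by blast
qed

section \<open>Regular sequences under localization\<close>

text \<open>Both complexes start in the same degree i, so regularity is tested in one degree. A
  class of N killed by x is, up to a denominator, the image of some u; then txu is a coboundary for
  some t, and regularity of x on M makes tu a coboundary.\<close>

lemma regular_elem_localize:
  fixes M :: "('a, 'm nest) dg_module" and N :: "(('a \<times> 'a) set, 'n nest) dg_module"
  assumes A: "local_dg A m" and L: "local_dg L H0.loc_max_ideal"
    and lm: "loc_map A M L N loc S \<psi>" and M: "fin_cplx A M" "inf_at M i" and N: "fin_cplx L N" "inf_at N i"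
    and x: "regular_elem A m M x" "x \<in> P"
  shows "regular_elem L H0.loc_max_ideal N (loc_H0 x)"
proof -
  interpret A: local_dg A m by (rule A)
  interpret L': local_dg L H0.loc_max_ideal by (rule L)
  interpret lm: loc_map A M L N loc S \<psi> by (rule lm)
  have xc: "x \<in> carrier (H0 A)" by (rule H0.P_carrier[OF x(2)])
  note l = H0_lift_closed[OF xc]
  have reg: "X = \<zero>\<^bsub>cohomology M i\<^esub>"
    if "X \<in> carrier (cohomology M i)" "x \<odot>\<^bsub>cohomology M i\<^esub> X = \<zero>\<^bsub>cohomology M i\<^esub>" for X
    using A.regular_elem_iff[OF M] x(1) that by blast
  have "X = \<zero>\<^bsub>cohomology N i\<^esub>"
    if X: "X \<in> carrier (cohomology N i)" and z: "loc_H0 x \<odot>\<^bsub>cohomology N i\<^esub> X = \<zero>\<^bsub>cohomology N i\<^esub>" for X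
  proof -
    obtain w where w: "w \<in> cocycles N i" "X = coh_class N i w" using X by (rule lm.L.cohomologyE)
    note wc = lm.L.cocycle_closed[OF w(1)]
    have ll: "loc (H0_lift A x) \<in> deg_part L 0" by (rule loc_deg[OF l])
    have B: "loc (H0_lift A x) \<odot>\<^bsub>N\<^esub> w \<in> coboundaries N i"
      using z lm.L.smult_cohomology[OF ll w(1)] lm.L.coh_class_zero_iff[OF lm.L.smult_cl[OF ll wc]]
      unfolding w(2) loc_H0_def by simp
    obtain s u where s: "s \<in> S" and u: "u \<in> cocycles M i" "loc s \<odot>\<^bsub>N\<^esub> w = \<psi> u" using lm.cocycle_fraction[OF w(1)] by blast
    note uc = lm.M.cocycle_closed[OF u(1)]
    have "\<psi> (H0_lift A x \<odot>\<^bsub>M\<^esub> u) = loc s \<odot>\<^bsub>N\<^esub> (loc (H0_lift A x) \<odot>\<^bsub>N\<^esub> w)"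
      using lm.psi_smult[OF l uc] u(2) lm.phi_smult_comm[OF S_deg0[OF s] l wc] by simp
    then have "\<psi> (H0_lift A x \<odot>\<^bsub>M\<^esub> u) \<in> coboundaries N i"
      using lm.L.submoduleE(4)[OF lm.L.coboundary_submodule _ B, of "loc s"] lm.S_phi[OF s] by simp
    then obtain t where t: "t \<in> S" "t \<odot>\<^bsub>M\<^esub> (H0_lift A x \<odot>\<^bsub>M\<^esub> u) \<in> coboundaries M i"
      using lm.psi_coboundary_iff[OF lm.M.cocycle_smult[OF l u(1)]] by blast
    note t0 = S_deg0[OF t(1)]
    have tu: "t \<odot>\<^bsub>M\<^esub> u \<in> cocycles M i" by (rule lm.M.cocycle_smult[OF t0 u(1)])
    have "H0_lift A x \<odot>\<^bsub>M\<^esub> (t \<odot>\<^bsub>M\<^esub> u) = t \<odot>\<^bsub>M\<^esub> (H0_lift A x \<odot>\<^bsub>M\<^esub> u)"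
      using lm.M.smult_assoc1[of t "H0_lift A x" u] lm.M.smult_assoc1[of "H0_lift A x" t u]
        lm.M.R.m_comm[of t "H0_lift A x"] t0 l uc by simp
    then have "x \<odot>\<^bsub>cohomology M i\<^esub> coh_class M i (t \<odot>\<^bsub>M\<^esub> u) = \<zero>\<^bsub>cohomology M i\<^esub>"
      using lm.M.smult_cohomology_lift[OF xc tu] t(2) lm.M.coh_class_zero_iff[OF lm.M.coboundary_closed[OF t(2)]] by simp
    then have "coh_class M i (t \<odot>\<^bsub>M\<^esub> u) = \<zero>\<^bsub>cohomology M i\<^esub>" by (rule reg[OF lm.M.coh_class_closed[OF tu]])
    then have "t \<odot>\<^bsub>M\<^esub> u \<in> coboundaries M i" using lm.M.coh_class_zero_iff[OF lm.M.cocycle_closed[OF tu]] by simp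
    then have "\<psi> u \<in> coboundaries N i" using lm.psi_coboundary_iff[OF u(1)] t(1) by blast
    then have "w \<in> coboundaries N i" using lm.divide_coboundary[OF s, of w i] u(2) w(1) by (simp add: cocycles_def)
    then show ?thesis using lm.L.coh_class_zero_iff[OF wc] w(2) by simp
  qed
  moreover have "loc_H0 x \<in> H0.loc_max_ideal" using H0.phi_loc_max_ideal[OF xc] x(2) by simp
  ultimately show ?thesis using L'.regular_elem_iff[OF N] by blast
qed

text \<open>The comparison map is quantified existentially inside the induction, because each Koszul
  factor replaces it by a new, twisted one.\<close>

lemma regular_seq_localize:
  fixes M :: "('a, 'm nest) dg_module" and N :: "(('a \<times> 'a) set, 'n nest) dg_module"
  assumes A: "local_dg A m" and L: "local_dg L H0.loc_max_ideal"
    and "\<exists>\<psi>. loc_map A M L N loc S \<psi>" "fin_cplx A M" "inf_at M i" "fin_cplx L N" "inf_at N i"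
    and "regular_seq_nest A m M xs" "set xs \<subseteq> P"
  shows "regular_seq_nest L H0.loc_max_ideal N (map loc_H0 xs)"
  using assms(3-)
proof (induction xs arbitrary: M N)
  case Nil
  then show ?case by simp
next
  case (Cons x xs)
  interpret A: local_dg A m by (rule A)
  interpret L': local_dg L H0.loc_max_ideal by (rule L)
  have x: "regular_elem A m M x" "x \<in> P" "regular_seq_nest A m (kos A M (H0_lift A x)) xs" "set xs \<subseteq> P"
    using Cons.prems(6,7) by (simp_all add: regular_seq_nest_Cons del: regular_seq_nest.simps(2))
  obtain \<psi> where lm: "loc_map A M L N loc S \<psi>" using Cons.prems(1) by blast
  have rx: "regular_elem L H0.loc_max_ideal N (loc_H0 x)"
    by (rule regular_elem_localize[OF A L lm Cons.prems(2-5) x(1,2)])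
  have xc: "x \<in> carrier (H0 A)" by (rule H0.P_carrier[OF x(2)])
  have lxc: "loc_H0 x \<in> carrier (H0 L)" by (rule H0.phi_simps(1)[OF xc])
  note l = H0_lift_closed[OF xc] and l' = L.H0_lift_closed[OF lxc]
  \<comment> \<open>The lift chosen in the localization and the image of the lift chosen in A
    represent the same class, so they differ by a boundary, as \<open>loc_map_kos\<close>
    requires.\<close>
  have "H0_proj L (H0_lift L (loc_H0 x)) = H0_proj L (loc (H0_lift A x))"
    using L.H0_proj_lift[OF lxc] by (simp add: loc_H0_def)
  then have "H0_lift L (loc_H0 x) \<ominus>\<^bsub>L\<^esub> loc (H0_lift A x) \<in> boundary_ideal L"
    using L.H0_proj_eq_iff[OF l' loc_deg[OF l]] by simp
  then have "\<exists>\<psi>. loc_map A (kos A M (H0_lift A x)) L (kos L N (H0_lift L (loc_H0 x))) loc S \<psi>"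
    by (rule loc_map_kos[OF lm l l'])
  then have "regular_seq_nest L H0.loc_max_ideal (kos L N (H0_lift L (loc_H0 x))) (map loc_H0 xs)"
    by (rule Cons.IH[OF _ A.fin_cplx_kos[OF Cons.prems(2) xc] A.inf_at_kos[OF Cons.prems(2,3) x(1)]
          L'.fin_cplx_kos[OF Cons.prems(4) lxc] L'.inf_at_kos[OF Cons.prems(4,5) rx] x(3,4)])
  then show ?case using rx by (simp add: regular_seq_nest_Cons del: regular_seq_nest.simps(2))
qed

end

section \<open>Depth and dimension of the localized DG-ring\<close>

lemma local_dgI:
  assumes "noetherian_local_dg_ring A m"
  shows "local_dg A m"
  using assms unfolding noetherian_local_dg_ring_def noetherian_dg_ring_def
  by (intro local_dg.intro noeth_local_ring.intro noeth_local_ring_axioms.intro) simp_all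

lemma (in local_dg) self_facts:
  assumes "noetherian_dg_ring A" "bounded_cohomology A"
  defines "M \<equiv> transport Leaf (self_module A)" and "i \<equiv> dg_inf (self_module A)"
  shows "fin_cplx A M" "inf_at M i" "inf_at (self_module A) i"
proof -
  interpret C: cplx A "self_module A" by (rule dg.self_cplx)
  show "fin_cplx A M" unfolding M_def by (rule dg.self_fin_cplx[OF assms(1)])
  \<comment> \<open>By locality \<one> lies outside m, so H^0(A) is nonzero and the infimum is a
    genuine one.\<close>
  have "\<one>\<^bsub>H0 A\<^esub> \<noteq> \<zero>\<^bsub>H0 A\<^esub>"
    using HR.one_notin_m additive_subgroup.zero_closed[OF ideal.axioms(1)[OF HR.m_ideal]] by metis
  then show i: "inf_at (self_module A) i" unfolding i_def by (rule dg.self_inf_at[OF assms(2)])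
  show "inf_at M i" using i exact_at_iso[OF C.loc_map_Leaf] unfolding inf_at_def M_def by simp
qed

lemma (in local_dg) max_regular_length_le:
  assumes "noetherian_dg_ring A" "bounded_cohomology A"
  shows "max_regular_length A m \<le> krull_dim (H0 A)"
  unfolding max_regular_length_def
proof (rule Sup_least)
  fix n assume "n \<in> {enat (length xs) |xs. regular_seq A m (self_module A) xs}"
  then obtain xs where "n = enat (length xs)" "regular_seq_nest A m (transport Leaf (self_module A)) xs"
    unfolding regular_seq_def by blast
  then show "n \<le> krull_dim (H0 A)" using regular_seq_le_krull_dim[OF self_facts(1,2)[OF assms]] by simp
qed

text \<open>If every u were killed by some s outside p, all fractions would equal zero and p would
  not lie in the support. Hence one u survives every s.\<close>

lemma supp_nonzero:
  assumes R: "cring R" and M: "module R M" and p: "p \<in> supp R M"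
  shows "\<exists>u\<in>carrier M. \<forall>s\<in>carrier R - p. s \<odot>\<^bsub>M\<^esub> u \<noteq> \<zero>\<^bsub>M\<^esub>"
proof (rule ccontr)
  interpret module R M by (rule M)
  assume n: "\<not> ?thesis"
  let ?S = "carrier R - p"
  have ps: "p \<in> spec R" using p by (simp add: supp_def)
  have S1: "\<one>\<^bsub>R\<^esub> \<in> ?S" using spec_one[OF ps] by simp
  have Sm: "s \<otimes>\<^bsub>R\<^esub> t \<in> ?S" if "s \<in> ?S" "t \<in> ?S" for s t using spec_mult[OF ps] that by blast
  have z: "loc_frac M ?S u s = loc_frac M ?S \<zero>\<^bsub>M\<^esub> \<one>\<^bsub>R\<^esub>" if u: "u \<in> carrier M" and s: "s \<in> ?S" for u s
  proof -
    obtain v where v: "v \<in> ?S" "v \<odot>\<^bsub>M\<^esub> u = \<zero>\<^bsub>M\<^esub>" using n u by blast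
    have sc: "s \<in> carrier R" "v \<in> carrier R" using s v by blast+
    \<comment> \<open>Fractions are sets of pairs, so u/s = 0/1 is checked on every pair (x, t); the
      element v killing u enters as an additional factor of the witness in both directions.\<close>
    have key: "(\<exists>w\<in>?S. w \<odot>\<^bsub>M\<^esub> (t \<odot>\<^bsub>M\<^esub> u) = w \<odot>\<^bsub>M\<^esub> (s \<odot>\<^bsub>M\<^esub> x)) \<longleftrightarrow>
      (\<exists>w\<in>?S. w \<odot>\<^bsub>M\<^esub> (t \<odot>\<^bsub>M\<^esub> \<zero>\<^bsub>M\<^esub>) = w \<odot>\<^bsub>M\<^esub> (\<one>\<^bsub>R\<^esub> \<odot>\<^bsub>M\<^esub> x))"
      if x: "x \<in> carrier M" and t: "t \<in> ?S" for x t
    proof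
      have tc: "t \<in> carrier R" using t by blast
      assume "\<exists>w\<in>?S. w \<odot>\<^bsub>M\<^esub> (t \<odot>\<^bsub>M\<^esub> u) = w \<odot>\<^bsub>M\<^esub> (s \<odot>\<^bsub>M\<^esub> x)"
      then obtain w where w: "w \<in> ?S" "w \<odot>\<^bsub>M\<^esub> (t \<odot>\<^bsub>M\<^esub> u) = w \<odot>\<^bsub>M\<^esub> (s \<odot>\<^bsub>M\<^esub> x)" by blast
      have wc: "w \<in> carrier R" using w by blast
      have "(v \<otimes>\<^bsub>R\<^esub> (w \<otimes>\<^bsub>R\<^esub> s)) \<odot>\<^bsub>M\<^esub> x = v \<odot>\<^bsub>M\<^esub> (w \<odot>\<^bsub>M\<^esub> (s \<odot>\<^bsub>M\<^esub> x))"
        using sc wc x by (simp add: smult_assoc1)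
      also have "\<dots> = (v \<otimes>\<^bsub>R\<^esub> (w \<otimes>\<^bsub>R\<^esub> t)) \<odot>\<^bsub>M\<^esub> u"
        unfolding w(2)[symmetric] using sc wc tc u by (simp add: smult_assoc1)
      also have "\<dots> = (w \<otimes>\<^bsub>R\<^esub> t) \<odot>\<^bsub>M\<^esub> (v \<odot>\<^bsub>M\<^esub> u)"
        using sc wc tc u R.m_comm[of v "w \<otimes>\<^bsub>R\<^esub> t"] smult_assoc1[of "w \<otimes>\<^bsub>R\<^esub> t" v u] by simp
      also have "\<dots> = \<zero>\<^bsub>M\<^esub>" using v(2) wc tc by simp
      finally have e: "(v \<otimes>\<^bsub>R\<^esub> (w \<otimes>\<^bsub>R\<^esub> s)) \<odot>\<^bsub>M\<^esub> x = \<zero>\<^bsub>M\<^esub>" .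
      have q: "v \<otimes>\<^bsub>R\<^esub> (w \<otimes>\<^bsub>R\<^esub> s) \<in> ?S" by (rule Sm[OF v(1) Sm[OF w(1) s]])
      then have qc: "v \<otimes>\<^bsub>R\<^esub> (w \<otimes>\<^bsub>R\<^esub> s) \<in> carrier R" by blast
      show "\<exists>w\<in>?S. w \<odot>\<^bsub>M\<^esub> (t \<odot>\<^bsub>M\<^esub> \<zero>\<^bsub>M\<^esub>) = w \<odot>\<^bsub>M\<^esub> (\<one>\<^bsub>R\<^esub> \<odot>\<^bsub>M\<^esub> x)"
        by (rule bexI[OF _ q]) (use e x tc qc in simp)
    next
      have tc: "t \<in> carrier R" using t by blast
      assume "\<exists>w\<in>?S. w \<odot>\<^bsub>M\<^esub> (t \<odot>\<^bsub>M\<^esub> \<zero>\<^bsub>M\<^esub>) = w \<odot>\<^bsub>M\<^esub> (\<one>\<^bsub>R\<^esub> \<odot>\<^bsub>M\<^esub> x)"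
      then obtain w where w: "w \<in> ?S" "w \<odot>\<^bsub>M\<^esub> (t \<odot>\<^bsub>M\<^esub> \<zero>\<^bsub>M\<^esub>) = w \<odot>\<^bsub>M\<^esub> (\<one>\<^bsub>R\<^esub> \<odot>\<^bsub>M\<^esub> x)" by blast
      have wc: "w \<in> carrier R" using w by blast
      have wx: "w \<odot>\<^bsub>M\<^esub> x = \<zero>\<^bsub>M\<^esub>" using w(2) wc tc x by simp
      have "(v \<otimes>\<^bsub>R\<^esub> w) \<odot>\<^bsub>M\<^esub> (t \<odot>\<^bsub>M\<^esub> u) = (w \<otimes>\<^bsub>R\<^esub> t) \<odot>\<^bsub>M\<^esub> (v \<odot>\<^bsub>M\<^esub> u)"
        using sc wc tc u by (simp add: smult_assoc1[symmetric] R.m_ac)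
      then have 1: "(v \<otimes>\<^bsub>R\<^esub> w) \<odot>\<^bsub>M\<^esub> (t \<odot>\<^bsub>M\<^esub> u) = \<zero>\<^bsub>M\<^esub>" using v(2) wc tc by simp
      have "(v \<otimes>\<^bsub>R\<^esub> w) \<odot>\<^bsub>M\<^esub> (s \<odot>\<^bsub>M\<^esub> x) = (v \<otimes>\<^bsub>R\<^esub> s) \<odot>\<^bsub>M\<^esub> (w \<odot>\<^bsub>M\<^esub> x)"
        using sc wc tc x by (simp add: smult_assoc1[symmetric] R.m_ac)
      then have 2: "(v \<otimes>\<^bsub>R\<^esub> w) \<odot>\<^bsub>M\<^esub> (s \<odot>\<^bsub>M\<^esub> x) = \<zero>\<^bsub>M\<^esub>" using wx sc by simp
      show "\<exists>w\<in>?S. w \<odot>\<^bsub>M\<^esub> (t \<odot>\<^bsub>M\<^esub> u) = w \<odot>\<^bsub>M\<^esub> (s \<odot>\<^bsub>M\<^esub> x)"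
        by (rule bexI[OF _ Sm[OF v(1) w(1)]]) (simp add: 1 2)
    qed
    have "(x, t) \<in> loc_frac M ?S u s \<longleftrightarrow> (x, t) \<in> loc_frac M ?S \<zero>\<^bsub>M\<^esub> \<one>\<^bsub>R\<^esub>" for x t
      unfolding loc_frac_def mem_Collect_eq prod.case by (intro conj_cong refl key)
    then show ?thesis by (intro equalityI subrelI) simp_all
  qed
  have "carrier (loc_module R M ?S) = {\<zero>\<^bsub>loc_module R M ?S\<^esub>}"
  proof (intro equalityI subsetI)
    fix X assume "X \<in> carrier (loc_module R M ?S)"
    then obtain u s where "X = loc_frac M ?S u s" "u \<in> carrier M" "s \<in> ?S" by (auto simp: loc_module_def)
    then show "X \<in> {\<zero>\<^bsub>loc_module R M ?S\<^esub>}" using z[of u s] by (simp add: loc_module_def)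
  next
    fix X assume "X \<in> {\<zero>\<^bsub>loc_module R M ?S\<^esub>}"
    then have "X = loc_frac M ?S \<zero>\<^bsub>M\<^esub> \<one>\<^bsub>R\<^esub>" by (simp add: loc_module_def)
    then show "X \<in> carrier (loc_module R M ?S)" using S1 M.zero_closed unfolding loc_module_def by fastforce
  qed
  then show False using p unfolding supp_def by blast
qed

theorem theorem2p5:
  fixes A :: "'a dg_ring" and m :: "'a set set"
  assumes "local_cohen_macaulay A m"
    and "constant_amplitude A"
    and "catenary (H0 A)"
  shows "cohen_macaulay A"
proof -
  have nl: "noetherian_local_dg_ring A m" and bd: "bounded_cohomology A"
    and cm: "max_regular_length A m = krull_dim (H0 A)"
    using assms(1) by (simp_all add: local_cohen_macaulay_def)
  have nA: "noetherian_dg_ring A" using nl by (simp add: noetherian_local_dg_ring_def)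
  have lA: "local_dg A m" by (rule local_dgI[OF nl])
  interpret A: local_dg A m by (rule lA)
  let ?M = "transport Leaf (self_module A)" and ?i = "dg_inf (self_module A)"
  note M = A.self_facts[OF nA bd]
  interpret C: cplx A "self_module A" by (rule A.dg.self_cplx)
  \<comment> \<open>Every regular sequence yields a chain starting at this fixed prime q, and
    catenarity bounds the chains from q to m.\<close>
  obtain q where q: "q \<in> ass_primes (H0 A) (cohomology ?M ?i)" using A.ex_ass_prime[OF M(1,2)] by blast
  have qs: "q \<in> spec (H0 A)" using q by (simp add: ass_primes_def)
  obtain n where n: "\<And>ps. prime_chain (H0 A) ps \<Longrightarrow> hd ps = q \<Longrightarrow> last ps = m \<Longrightarrow> length ps \<le> n"
    using assms(3) qs A.HR.m_spec A.HR.spec_le_m[OF qs] unfolding catenary_def by meson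
  have bound: "length xs \<le> n" if xs: "regular_seq_nest A m ?M xs" for xs
  proof -
    obtain ps where ps: "prime_chain (H0 A) ps" "hd ps = q" "length ps = Suc (length xs)"
      using A.regular_seq_chain[OF M(1,2) xs q] by blast
    have ne: "ps \<noteq> []" using ps(3) by auto
    have l: "last ps \<in> spec (H0 A)" using ps(1) ne unfolding prime_chain_def by auto
    show ?thesis
    \<comment> \<open>The bound n concerns chains ending in m, so m is appended unless it is already
      the last prime; either way length xs \<le> n follows.\<close>
    proof (cases "last ps = m")
      case True
      then show ?thesis using n[OF ps(1,2)] ps(3) by simp
    next
      case False
      then have "prime_chain (H0 A) [last ps, m]"
        using l A.HR.m_spec A.HR.spec_le_m[OF l] by (auto simp: prime_chain_def)
      from prime_chain_append[OF ps(1) this] have "prime_chain (H0 A) (ps @ [m])" by simp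
      from n[OF this] show ?thesis using ps(2,3) ne by simp
    qed
  qed
  let ?Len = "{enat (length xs) |xs. regular_seq A m (self_module A) xs}"
  have fin: "finite ?Len"
  proof (rule finite_subset)
    show "?Len \<subseteq> enat ` {..n}" using bound unfolding regular_seq_def by auto
  qed simp
  have "enat (length []) \<in> ?Len" unfolding regular_seq_def by (rule CollectI, rule exI[of _ "[]"]) simp
  then have ne: "?Len \<noteq> {}" by blast
  \<comment> \<open>A finite nonempty set of \<open>enat\<close> values attains its supremum. This
    provides a regular sequence \<open>zs\<close> whose length equals dim H^0(A).\<close>
  then have "Sup ?Len = Max ?Len" unfolding Sup_enat_def using fin by presburger
  then have "Sup ?Len \<in> ?Len" using Max_in[OF fin ne] by (simp only:)
  then obtain zs where zs: "regular_seq_nest A m ?M zs" "krull_dim (H0 A) = enat (length zs)"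
    using cm unfolding max_regular_length_def regular_seq_def by auto
  have "\<exists>m'. local_cohen_macaulay (dg_localization A P) m'" if P: "P \<in> spec (H0 A)" for P
  proof -
    interpret D: dg_loc A P by unfold_locales (rule P)
    let ?L = "dg_localization A P" and ?m = "D.H0.loc_max_ideal"
    have nl': "noetherian_local_dg_ring ?L ?m" by (rule D.L_noetherian_local[OF nA])
    have nL: "noetherian_dg_ring ?L" using nl' by (simp add: noetherian_local_dg_ring_def)
    have bL: "bounded_cohomology ?L" by (rule D.L_bounded[OF bd])
    have lL: "local_dg ?L ?m" by (rule local_dgI[OF nl'])
    interpret L: local_dg ?L ?m by (rule lL)
    let ?N = "transport Leaf (self_module ?L)"
    note N = L.self_facts[OF nL bL]
    interpret T: cplx ?L "self_module ?L" by (rule D.L.self_cplx)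
    interpret lm: loc_map A "self_module A" ?L "self_module ?L" D.loc D.S D.loc by (rule D.loc_map_self)
    \<comment> \<open>Constant amplitude enters here: some class of degree inf(A) survives
      localization at P, so the localized DG-ring starts in the same degree.\<close>
    have "P \<in> supp (H0 A) (cohomology (self_module A) ?i)" using assms(2) P by (simp add: constant_amplitude_def)
    from supp_nonzero[OF A.dg.H0_cring C.cohomology_module this] obtain U where
      U: "U \<in> carrier (cohomology (self_module A) ?i)"
      "\<And>s. s \<in> carrier (H0 A) - P \<Longrightarrow> s \<odot>\<^bsub>cohomology (self_module A) ?i\<^esub> U \<noteq> \<zero>\<^bsub>cohomology (self_module A) ?i\<^esub>" by blast
    obtain u where u: "u \<in> cocycles (self_module A) ?i" "U = coh_class (self_module A) ?i u" using U(1) by (rule C.cohomologyE)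
    have "D.loc u \<notin> coboundaries (self_module ?L) ?i"
    proof
      assume "D.loc u \<in> coboundaries (self_module ?L) ?i"
      then obtain s where s: "s \<in> D.S" "s \<odot>\<^bsub>self_module A\<^esub> u \<in> coboundaries (self_module A) ?i"
        using lm.psi_coboundary_iff[OF u(1)] by blast
      have "H0_proj A s \<in> carrier (H0 A) - P"
        using s(1) A.dg.H0_proj_closed by (simp add: lift_compl_def)
      moreover have "H0_proj A s \<odot>\<^bsub>cohomology (self_module A) ?i\<^esub> U = \<zero>\<^bsub>cohomology (self_module A) ?i\<^esub>"
        unfolding u(2) C.smult_cohomology[OF D.S_deg0[OF s(1)] u(1)]
        using C.coh_class_zero_iff[OF C.coboundary_closed[OF s(2)]] s(2) by blast
      ultimately show False using U(2) by blast
    qed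
    then have "\<not> exact_at (self_module ?L) ?i" using lm.psi_cocycle[OF u(1)] unfolding exact_at_def by blast
    moreover have "exact_at (self_module ?L) j" if "j < ?i" for j
      using M(3) that lm.exact_localize unfolding inf_at_def exact_at_def by blast
    ultimately have iL: "inf_at (self_module ?L) ?i" by (simp add: inf_at_def)
    have iN: "inf_at ?N ?i" using iL exact_at_iso[OF T.loc_map_Leaf] unfolding inf_at_def by simp
    have lmN: "\<exists>\<psi>. loc_map A ?M ?L ?N D.loc D.S \<psi>" by (rule loc_map_transport_Leaf[OF D.loc_map_self])
    \<comment> \<open>A chain in H^0 of the localization contracts to a chain below P, which yields
      a regular sequence of that length inside P; its image is regular over the
      localization.\<close>
    have "krull_dim (H0 ?L) \<le> max_regular_length ?L ?m"
      unfolding krull_dim_def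
    proof (rule Sup_least)
      fix k assume "k \<in> {enat (length ps - 1) |ps. prime_chain (H0 ?L) ps}"
      then obtain ps where ps: "k = enat (length ps - 1)" "prime_chain (H0 ?L) ps" by blast
      have ne: "0 < length ps" using ps(2) by (simp add: prime_chain_def)
      let ?ps = "map D.H0.contraction ps"
      obtain xs where xs: "regular_seq_nest A m ?M xs" "set xs \<subseteq> P" "length xs = length ps - 1"
        using A.regular_seq_in_prime[OF M(1,2) zs(1) _ P D.H0.contraction_chain[OF ps(2)], of "length ps - 1"] zs(2) ne
        by auto
      have "regular_seq_nest ?L ?m ?N (map D.loc_H0 xs)"
        by (rule D.regular_seq_localize[OF lA lL lmN M(1,2) N(1) iN xs(1,2)])
      then have "enat (length (map D.loc_H0 xs)) \<in> {enat (length xs) |xs. regular_seq ?L ?m (self_module ?L) xs}"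
        unfolding regular_seq_def by blast
      from Sup_upper[OF this] show "k \<le> max_regular_length ?L ?m"
        unfolding max_regular_length_def using ps(1) xs(3) by simp
    qed
    then have "local_cohen_macaulay ?L ?m"
      unfolding local_cohen_macaulay_def using nl' bL L.max_regular_length_le[OF nL bL] by simp
    then show ?thesis by blast
  qed
  then show ?thesis unfolding cohen_macaulay_def using nA bd by blast
qed

end
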